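(* Let $\phi\colon E\to G$ be a morphism of finite free multigraded $Q$-modules. The Taylor complex $T_\bullet(\phi)$ is exact (i.e. $\mathrm H_i(T_\bullet(\phi))=0$ for all $i\neq 0$) if and only if for every multidegree $\alpha\in\mathbb N^n$ the matrix $C_\alpha$ is of maximal rank.
   Context: **Setting.** $\Bbbk$ is a field and $Q=\Bbbk[x_1,\dots,x_n]$ with its standard $\mathbb N^n$-grading ("multigrading"), where $x^{a}=x_1^{a_1}\cdots x_n^{a_n}$ has multidegree $a$. On multidegrees, $\preceq$ is the componentwise partial order and $\mathrm{lcm}$ is the componentwise maximum. $E$ and $G$ are finite free $\mathbb N^n$-graded $Q$-modules of ranks $e,g$ with fixed homogeneous bases $\epsilon_1,\dots,\epsilon_e$ and $\gamma_1,\dots,\gamma_g$, and $\phi\colon E\to G$ is a $Q$-linear map preserving multidegrees. Its matrix in these bases has entries $c_{ij}x^{a_{ij}}$ with $c_{ij}\in\Bbbk$; $C=(c_{ij})$ is the coefficient matrix. Let $U$ and $W$ be the $\Bbbk$-vector spaces with bases $\epsilon_1,\dots,\epsilon_e$ and $\gamma_1,\dots,\gamma_g$, let $s\colon U\to W$ be the linear map with matrix $C$, let $r=\mathrm{rank}\,\phi=\mathrm{rank}\,C$, and $V=\mathrm{im}(s)$, so $\dim V=r$. $V^*$ is the dual of $V$, and $D_p$ is the $p$-th divided power, $D_pV^*=(\mathrm{Sym}_pV)^*$. Unadorned tensor products are over $\Bbbk$. **Maximal rank.** For a multidegree $\alpha$, $C_\alpha$ is the submatrix of $C$ consisting of the columns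 $j$ with $|\epsilon_j|\preceq\alpha$. It is of maximal rank if $\mathrm{rank}\,C_\alpha=\min(r,\ \text{number of columns of }C_\alpha)$. **Maps $s_i$.** For $I=\{i_1<\dots<i_p\}\subseteq\{1,\dots,e\}$ put $\epsilon_I=\epsilon_{i_1}\wedge\dots\wedge\epsilon_{i_p}\in\wedge^pU$, of multidegree $|\epsilon_I|=\mathrm{lcm}(|\epsilon_{i_1}|,\dots,|\epsilon_{i_p}|)$; elements of $D_pV^*$ and $\wedge^rV^*$ have multidegree $0$. Let $\upsilon_1,\dots,\upsilon_r$ be a basis of $V^*$, $\upsilon_{[r]}=\upsilon_1\wedge\dots\wedge\upsilon_r$, and for $b=(b_1,\dots,b_r)$ let $\upsilon^{(b)}=\upsilon_1^{(b_1)}\cdots\upsilon_r^{(b_r)}$ (these, with $b_j\ge0$, $\sum b_j=p$, are a basis of $D_pV^*$), with $\upsilon^{(b)}=0$ if some $b_j<0$; $b-e_j$ denotes $b$ with its $j$-th entry decreased by $1$. For $i\ge3$ and $|I|=r+i-1$, $$s_i(\upsilon^{(b)}\otimes\epsilon_I\otimes\upsilon_{[r]})=\sum_{j=1}^r\sum_{l\in I}\mathrm{sgn}(l,I\setminus l)\,\upsilon_j(s(\epsilon_l))\,\upsilon^{(b-e_j)}\otimes\epsilon_{I\setminus l}\otimes\upsilon_{[r]},$$ and for $|J|=r+1$, $$s_2(\epsilon_J\otimes\upsilon_{[r]})=\sum_{l\in J}\mathrm{sgn}(l,J\setminus l)\,\det\big(\upsilon_j(s(\epsilon_k))\big)_{1\le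 j\le r,\;k\in J\setminus l}\;\epsilon_l,$$ where $\mathrm{sgn}(l,I\setminus l)=(-1)^{\#\{k\in I:\,k<l\}}$. These maps do not depend on the basis $\upsilon$. **Taylor complex.** $T_\bullet(\phi)$ is the complex of free multigraded $Q$-modules with $T_0=G$, $T_1=E$, and for $i\ge2$ $$T_i=\bigoplus_{|I|=r+i-1}Q\otimes D_{i-2}V^*\otimes\epsilon_I\otimes\wedge^rV^*,$$ with first differential $\phi_1=\phi$ and, for $i\ge2$, $\phi_i\colon T_i\to T_{i-1}$ the homogenization of $s_i$: if $s_i^{I,J}$ is the component of $s_i$ from the $\epsilon_I$-summand to the $\epsilon_J$-summand (for $i=2$: to $\Bbbk\epsilon_l$, $J=\{l\}$), then $\phi_i^{I,J}(y\otimes z)=x^{|\epsilon_I|-|\epsilon_J|}y\otimes s_i^{I,J}(z)$. *)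

theory Defs
  imports "HOL-Library.Poly_Mapping" "Jordan_Normal_Form.DL_Rank" "Jordan_Normal_Form.DL_Submatrix"
begin

text \<open>
  The field is \<open>'k\<close>; \<open>Q\<close> is the ring of polynomials over \<open>'k\<close> in the variables with indices
  \<open>0, \<dots>, n - 1\<close> (so \<open>n = 0\<close> is allowed), sitting inside the polynomials in countably many
  variables.  All index ranges are zero-based.

  The order \<open>\<le>\<close> that the library puts on \<open>nat \<Rightarrow>\<^sub>0 nat\<close> is lexicographic, hence the separate
  componentwise order \<open>mdeg_le\<close>.  Subtraction on \<open>nat \<Rightarrow>\<^sub>0 nat\<close> is componentwise and truncated.
\<close>

type_synonym mdeg = "nat \<Rightarrow>\<^sub>0 nat"

type_synonym 'k mpoly = "mdeg \<Rightarrow>\<^sub>0 'k"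

definition mdegs :: "nat \<Rightarrow> mdeg set" where
  "mdegs n = {a. Poly_Mapping.keys a \<subseteq> {..<n}}"

definition polys :: "nat \<Rightarrow> 'k::field mpoly set" where
  "polys n = {p. Poly_Mapping.keys p \<subseteq> mdegs n}"

definition mdeg_le :: "mdeg \<Rightarrow> mdeg \<Rightarrow> bool" (infix "\<preceq>" 50) where
  "a \<preceq> b \<longleftrightarrow> (\<forall>v. Poly_Mapping.lookup a v \<le> Poly_Mapping.lookup b v)"

text \<open>The least common multiple of the multidegrees \<open>d i\<close> for \<open>i\<close> in a finite set \<open>I\<close>.\<close>

definition lcm_deg :: "(nat \<Rightarrow> mdeg) \<Rightarrow> nat set \<Rightarrow> mdeg" where
  "lcm_deg d I = Abs_poly_mapping (\<lambda>v. Max (insert 0 ((\<lambda>i. Poly_Mapping.lookup (d i) v) ` I)))"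


section \<open>Multigraded free modules and their morphisms\<close>

text \<open>
  The free \<open>Q\<close>-module with basis \<open>B\<close> is rendered by coordinate functions; the multigrading is
  given by the multidegrees \<open>deg b\<close> of the basis elements.
\<close>

definition free_module :: "nat \<Rightarrow> 'b set \<Rightarrow> ('b \<Rightarrow> 'k::field mpoly) set" where
  "free_module n B = {x. (\<forall>b. x b \<in> polys n) \<and> (\<forall>b. b \<notin> B \<longrightarrow> x b = 0)}"

definition basis_elem :: "'b \<Rightarrow> 'b \<Rightarrow> 'k::field mpoly" where
  "basis_elem b = (\<lambda>c. if c = b then 1 else 0)"

definition homogeneous :: "('b \<Rightarrow> mdeg) \<Rightarrow> mdeg \<Rightarrow> ('b \<Rightarrow> 'k::field mpoly) \<Rightarrow> bool" where
  "homogeneous deg \<alpha> x \<longleftrightarrow> (\<forall>b. \<forall>m \<in> Poly_Mapping.keys (x b). m + deg b = \<alpha>)"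

definition multigraded_hom ::
  "nat \<Rightarrow> 'b set \<Rightarrow> ('b \<Rightarrow> mdeg) \<Rightarrow> 'c set \<Rightarrow> ('c \<Rightarrow> mdeg) \<Rightarrow>
   (('b \<Rightarrow> 'k::field mpoly) \<Rightarrow> ('c \<Rightarrow> 'k mpoly)) \<Rightarrow> bool" where
  "multigraded_hom n B degB B' degB' f \<longleftrightarrow>
     (\<forall>x \<in> free_module n B. f x \<in> free_module n B') \<and>
     (\<forall>x \<in> free_module n B. \<forall>y \<in> free_module n B. f (\<lambda>b. x b + y b) = (\<lambda>c. f x c + f y c)) \<and>
     (\<forall>p \<in> polys n. \<forall>x \<in> free_module n B. f (\<lambda>b. p * x b) = (\<lambda>c. p * f x c)) \<and>
     (\<forall>\<alpha> \<in> mdegs n. \<forall>x \<in> free_module n B. homogeneous degB \<alpha> x \<longrightarrow> homogeneous degB' \<alpha> (f x))"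

text \<open>
  For a morphism \<open>\<phi>\<close> of multigraded modules, the entry of \<open>\<phi>\<close> at \<open>(i, j)\<close> is a scalar multiple of
  the monomial of exponent \<open>dE j - dG i\<close>, and it is zero unless \<open>dG i \<preceq> dE j\<close>.  So the lookup below
  gives the scalar \<open>c\<^sub>i\<^sub>j\<close> also where the subtraction is truncated.
\<close>

definition coeff_matrix ::
  "nat \<Rightarrow> nat \<Rightarrow> (nat \<Rightarrow> mdeg) \<Rightarrow> (nat \<Rightarrow> mdeg) \<Rightarrow>
   ((nat \<Rightarrow> 'k::field mpoly) \<Rightarrow> (nat \<Rightarrow> 'k mpoly)) \<Rightarrow> 'k mat" where
  "coeff_matrix e g dE dG \<phi> =
     mat g e (\<lambda>(i, j). Poly_Mapping.lookup (\<phi> (basis_elem j) i) (dE j - dG i))"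

definition mat_rank :: "'k::field mat \<Rightarrow> nat" where
  "mat_rank A = vec_space.rank (dim_row A) A"

definition cols_upto :: "'k::field mat \<Rightarrow> (nat \<Rightarrow> mdeg) \<Rightarrow> mdeg \<Rightarrow> 'k mat" where
  "cols_upto C dE \<alpha> = submatrix C UNIV {j. dE j \<preceq> \<alpha>}"

definition maximal_rank :: "'k::field mat \<Rightarrow> (nat \<Rightarrow> mdeg) \<Rightarrow> mdeg \<Rightarrow> bool" where
  "maximal_rank C dE \<alpha> \<longleftrightarrow>
     mat_rank (cols_upto C dE \<alpha>) = min (mat_rank C) (dim_col (cols_upto C dE \<alpha>))"


section \<open>The dual of the image\<close>

definition mat_image :: "'k::field mat \<Rightarrow> 'k vec set" where
  "mat_image C = {C *\<^sub>v u |u. u \<in> carrier_vec (dim_col C)}"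

definition linear_form :: "'k::field vec set \<Rightarrow> ('k vec \<Rightarrow> 'k) \<Rightarrow> bool" where
  "linear_form V f \<longleftrightarrow>
     (\<forall>v \<in> V. \<forall>w \<in> V. f (v + w) = f v + f w) \<and> (\<forall>a. \<forall>v \<in> V. f (a \<cdot>\<^sub>v v) = a * f v)"

text \<open>
  \<open>\<upsilon> 0, \<dots>, \<upsilon> (r - 1)\<close> is a basis of the dual space of \<open>V\<close>; forms on \<open>V\<close> are compared only on \<open>V\<close>.
\<close>

definition dual_space_basis :: "'k::field vec set \<Rightarrow> nat \<Rightarrow> (nat \<Rightarrow> 'k vec \<Rightarrow> 'k) \<Rightarrow> bool" where
  "dual_space_basis V r \<upsilon> \<longleftrightarrow>
     (\<forall>j<r. linear_form V (\<upsilon> j)) \<and>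
     (\<forall>c. (\<forall>v \<in> V. (\<Sum>j<r. c j * \<upsilon> j v) = 0) \<longrightarrow> (\<forall>j<r. c j = 0)) \<and>
     (\<forall>f. linear_form V f \<longrightarrow> (\<exists>c. \<forall>v \<in> V. f v = (\<Sum>j<r. c j * \<upsilon> j v)))"


section \<open>The Taylor complex\<close>

text \<open>
  Basis elements of the terms of the complex: \<open>Gam i\<close> and \<open>Eps j\<close> are the given bases of \<open>G\<close> and
  \<open>E\<close>, and \<open>Tay b I\<close> stands for \<open>\<upsilon>\<^bsup>(b)\<^esup> \<otimes> \<epsilon>\<^sub>I \<otimes> \<upsilon>\<^bsub>[r]\<^esub>\<close>, where \<open>\<upsilon>\<close> is the chosen basis of the dual
  of \<open>V\<close> and \<open>\<upsilon>\<^bsup>(b)\<^esup>\<close> is the divided power monomial of exponent vector \<open>b\<close>.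
\<close>

datatype gen = Gam nat | Eps nat | Tay "nat \<Rightarrow> nat" "nat set"

definition exponents :: "nat \<Rightarrow> nat \<Rightarrow> (nat \<Rightarrow> nat) set" where
  "exponents r p = {b. (\<forall>j\<ge>r. b j = 0) \<and> (\<Sum>j<r. b j) = p}"

definition taylor_basis :: "nat \<Rightarrow> nat \<Rightarrow> nat \<Rightarrow> nat \<Rightarrow> gen set" where
  "taylor_basis e g r i =
     (if i = 0 then Gam ` {..<g}
      else if i = 1 then Eps ` {..<e}
      else {Tay b I |b I. b \<in> exponents r (i - 2) \<and> I \<subseteq> {..<e} \<and> card I = r + i - 1})"

fun gen_deg :: "(nat \<Rightarrow> mdeg) \<Rightarrow> (nat \<Rightarrow> mdeg) \<Rightarrow> gen \<Rightarrow> mdeg" where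
  "gen_deg dE dG (Gam i) = dG i"
| "gen_deg dE dG (Eps j) = dE j"
| "gen_deg dE dG (Tay b I) = lcm_deg dE I"

text \<open>\<open>sgn_ins l K\<close> is the sign \<open>sgn(l, K)\<close>, used for \<open>K = I - {l}\<close>.\<close>

definition sgn_ins :: "nat \<Rightarrow> nat set \<Rightarrow> 'k::field" where
  "sgn_ins l K = (- 1) ^ card {k \<in> K. k < l}"

definition s_eps :: "'k::field mat \<Rightarrow> nat \<Rightarrow> 'k vec" where
  "s_eps C l = C *\<^sub>v unit_vec (dim_col C) l"

definition minor_det :: "'k::field mat \<Rightarrow> nat \<Rightarrow> (nat \<Rightarrow> 'k vec \<Rightarrow> 'k) \<Rightarrow> nat set \<Rightarrow> 'k" where
  "minor_det C r \<upsilon> K = det (mat r r (\<lambda>(j, k). \<upsilon> j (s_eps C (sorted_list_of_set K ! k))))"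

text \<open>
  \<open>taylor_s C r \<upsilon> i b c\<close> is the coefficient at the basis element \<open>c\<close> of the image of the basis
  element \<open>b\<close> under \<open>s\<^sub>i\<close> (\<open>i \<ge> 2\<close>).  The guard \<open>0 < b j\<close> realises the convention that
  divided power monomials with a negative exponent vanish.
\<close>

fun taylor_s :: "'k::field mat \<Rightarrow> nat \<Rightarrow> (nat \<Rightarrow> 'k vec \<Rightarrow> 'k) \<Rightarrow> nat \<Rightarrow> gen \<Rightarrow> gen \<Rightarrow> 'k" where
  "taylor_s C r \<upsilon> i (Tay b I) c =
     (if i = 2 then
        (\<Sum>l\<in>I. sgn_ins l (I - {l}) * minor_det C r \<upsilon> (I - {l}) * of_bool (c = Eps l))
      else
        (\<Sum>j<r. \<Sum>l\<in>I. if 0 < b j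
           then sgn_ins l (I - {l}) * \<upsilon> j (s_eps C l) * of_bool (c = Tay (b(j := b j - 1)) (I - {l}))
           else 0))"
| "taylor_s C r \<upsilon> i _ c = 0"

definition taylor_module :: "nat \<Rightarrow> nat \<Rightarrow> nat \<Rightarrow> nat \<Rightarrow> nat \<Rightarrow> (gen \<Rightarrow> 'k::field mpoly) set" where
  "taylor_module n e g r i = free_module n (taylor_basis e g r i)"

text \<open>
  The differential from degree \<open>i\<close> to degree \<open>i - 1\<close>, for \<open>i \<ge> 1\<close>.  For \<open>i = 1\<close> it is \<open>\<phi>\<close>
  itself.  For \<open>i \<ge> 2\<close> it is the homogenization of \<open>s\<^sub>i\<close>: the subtraction of multidegrees is only
  truncated at pairs \<open>b\<close>, \<open>c\<close> where the coefficient vanishes.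
\<close>

definition taylor_diff ::
  "nat \<Rightarrow> nat \<Rightarrow> (nat \<Rightarrow> mdeg) \<Rightarrow> (nat \<Rightarrow> mdeg) \<Rightarrow>
   ((nat \<Rightarrow> 'k::field mpoly) \<Rightarrow> (nat \<Rightarrow> 'k mpoly)) \<Rightarrow> (nat \<Rightarrow> 'k vec \<Rightarrow> 'k) \<Rightarrow>
   nat \<Rightarrow> (gen \<Rightarrow> 'k mpoly) \<Rightarrow> (gen \<Rightarrow> 'k mpoly)" where
  "taylor_diff e g dE dG \<phi> \<upsilon> i x =
     (let C = coeff_matrix e g dE dG \<phi>; r = mat_rank C in
      if i = 1 then (\<lambda>c. case c of Gam k \<Rightarrow> \<phi> (\<lambda>j. x (Eps j)) k | _ \<Rightarrow> 0)
      else (\<lambda>c. \<Sum>b \<in> taylor_basis e g r i.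
              Poly_Mapping.single (gen_deg dE dG b - gen_deg dE dG c) (taylor_s C r \<upsilon> i b c) * x b))"

definition taylor_exact ::
  "nat \<Rightarrow> nat \<Rightarrow> nat \<Rightarrow> (nat \<Rightarrow> mdeg) \<Rightarrow> (nat \<Rightarrow> mdeg) \<Rightarrow>
   ((nat \<Rightarrow> 'k::field mpoly) \<Rightarrow> (nat \<Rightarrow> 'k mpoly)) \<Rightarrow> (nat \<Rightarrow> 'k vec \<Rightarrow> 'k) \<Rightarrow> bool" where
  "taylor_exact n e g dE dG \<phi> \<upsilon> \<longleftrightarrow>
     (let T = taylor_module n e g (mat_rank (coeff_matrix e g dE dG \<phi>));
          d = taylor_diff e g dE dG \<phi> \<upsilon>
      in \<forall>i\<ge>1. {x \<in> T i. d i x = (\<lambda>_. 0)} = d (i + 1) ` T (i + 1))"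

end

theory Submission
  imports Defs "HOL-Library.Function_Algebras"
begin

text \<open>
  Exactness can be tested one multidegree \<open>\<alpha>\<close> at a time.  In degree \<open>\<alpha>\<close> the complex becomes a complex
  of vector spaces, its strand: the part spanned by the basis elements of degree \<open>\<preceq> \<alpha>\<close>, on which
  the powers of the variables disappear and only the maps \<open>s\<^sub>i\<close> remain (\<open>exact_iff_strands_exact\<close>).
  Let \<open>A\<close> be the set of the columns \<open>l\<close> with \<open>dE l \<preceq> \<alpha>\<close>, let \<open>U\<^sub>A\<close> be spanned by the corresponding
  \<open>\<epsilon>\<^sub>l\<close>, and let \<open>f\<^sub>j = \<upsilon>\<^sub>j \<circ> s\<close>.  In homological degree \<open>i \<ge> 2\<close> the strand is
  \<open>D\<^bsub>i-2\<^esub> V\<^sup>* \<otimes> \<Lambda>\<^bsup>r+i-1\<^esup> U\<^sub>A\<close>.  For \<open>i \<ge> 3\<close> its differential is the sum over \<open>j\<close> of lowering the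
  exponent of \<open>\<upsilon>\<^sub>j\<close> times the contraction \<open>\<iota>\<^sub>j\<close> with \<open>f\<^sub>j\<close> (\<open>d_Tay\<close>), and for \<open>i = 2\<close> it is, up to a sign
  that depends on \<open>r\<close> only, the iterated contraction \<open>\<iota>\<^sub>0 \<dots> \<iota>\<^bsub>r-1\<^esub>\<close>, because Laplace expansion along the
  last row turns that operator into the sum over minors that defines \<open>s\<^sub>2\<close> (\<open>d_Eps_contraction\<close>).
  Contractions anticommute and have square zero, so that consecutive differentials compose to zero.

  Suppose first that the \<open>f\<^sub>j\<close> are linearly independent on \<open>U\<^sub>A\<close>, which means that \<open>C\<^sub>\<alpha>\<close> has rank \<open>r\<close>.
  Then \<open>U\<^sub>A\<close> contains vectors \<open>u\<^sub>k\<close> with \<open>f\<^sub>j(u\<^sub>k) = \<delta>\<^sub>j\<^sub>k\<close>, and the exterior multiplications \<open>h\<^sub>k\<close> by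
  \<open>u\<^sub>k\<close> satisfy \<open>\<iota>\<^sub>j h\<^sub>k + h\<^sub>k \<iota>\<^sub>j = \<delta>\<^sub>j\<^sub>k\<close>.  Together with the anticommutation of the
  contractions these relations yield an explicit contracting homotopy over any field
  (\<open>koszul_exact\<close>), hence the strand is exact.

  If \<open>A\<close> has at most \<open>r\<close> elements, all terms of homological degree \<open>\<ge> 2\<close> vanish, and exactness says
  that \<open>s\<close> is injective on \<open>U\<^sub>A\<close>, that is, \<open>C\<^sub>\<alpha>\<close> has full column rank.  If \<open>A\<close> has more than \<open>r\<close>
  elements and the \<open>f\<^sub>j\<close> are dependent on \<open>U\<^sub>A\<close>, all minors that occur in \<open>s\<^sub>2\<close> vanish, and exactness
  would again make \<open>s\<close> injective on \<open>U\<^sub>A\<close>; but then \<open>C\<^sub>\<alpha>\<close> would have rank \<open>card A > r\<close>.  The two cases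
  together are \<open>strand_exact_iff_maximal_rank\<close>.
\<close>

section \<open>Strands of maps between multigraded free modules\<close>

lemma mdeg_le_iff_add: "a \<preceq> b \<longleftrightarrow> (\<exists>c. b = a + c)"
proof
  assume "a \<preceq> b"
  then have "b = a + (b - a)"
    by (intro poly_mapping_eqI) (auto simp: mdeg_le_def lookup_add lookup_minus)
  then show "\<exists>c. b = a + c" ..
qed (auto simp: mdeg_le_def lookup_add)

lemma mdeg_le_refl [simp]: "a \<preceq> a"
  by (simp add: mdeg_le_def)

lemma mdeg_le_trans: "a \<preceq> b \<Longrightarrow> b \<preceq> c \<Longrightarrow> a \<preceq> c"
  unfolding mdeg_le_def using le_trans by blast

lemma mdegs_add_iff: "a + b \<in> mdegs n \<longleftrightarrow> a \<in> mdegs n \<and> b \<in> mdegs n"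
proof -
  have "Poly_Mapping.keys (a + b) = Poly_Mapping.keys a \<union> Poly_Mapping.keys b"
    by (auto simp: in_keys_iff lookup_add)
  then show ?thesis
    by (simp add: mdegs_def)
qed

lemma lookup_single_times:
  fixes p :: "'k::field mpoly"
  shows "Poly_Mapping.lookup (Poly_Mapping.single a c * p) m =
    (if a \<preceq> m then c * Poly_Mapping.lookup p (m - a) else 0)"
proof -
  have eq: "a + k = m \<longleftrightarrow> a \<preceq> m \<and> k = m - a" for k
    by (auto simp: mdeg_le_iff_add)
  have "p = (\<Sum>k\<in>Poly_Mapping.keys p. Poly_Mapping.single k (Poly_Mapping.lookup p k))"
    by (intro poly_mapping_eqI) (simp add: lookup_sum lookup_single when_def sum.delta in_keys_iff)
  then have "Poly_Mapping.single a c * p = Poly_Mapping.single a c *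
      (\<Sum>k\<in>Poly_Mapping.keys p. Poly_Mapping.single k (Poly_Mapping.lookup p k))"
    by (rule arg_cong)
  then have "Poly_Mapping.single a c * p
      = (\<Sum>k\<in>Poly_Mapping.keys p. Poly_Mapping.single (a + k) (c * Poly_Mapping.lookup p k))"
    by (simp add: sum_distrib_left mult_single)
  then have "Poly_Mapping.lookup (Poly_Mapping.single a c * p) m
      = (\<Sum>k\<in>Poly_Mapping.keys p. if a + k = m then c * Poly_Mapping.lookup p k else 0)"
    by (simp add: lookup_sum lookup_single when_def)
  also have "\<dots> = (if a \<preceq> m then c * Poly_Mapping.lookup p (m - a) else 0)"
    by (simp add: eq sum.delta in_keys_iff)
  finally show ?thesis .
qed

definition supported_on :: "'b set \<Rightarrow> ('b \<Rightarrow> 'k::zero) \<Rightarrow> bool" where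
  "supported_on B z \<longleftrightarrow> (\<forall>b. z b \<noteq> 0 \<longrightarrow> b \<in> B)"

definition lin_ext :: "'b set \<Rightarrow> ('b \<Rightarrow> 'c \<Rightarrow> 'k::field) \<Rightarrow> ('b \<Rightarrow> 'k) \<Rightarrow> 'c \<Rightarrow> 'k" where
  "lin_ext B s z = (\<lambda>c. \<Sum>b\<in>B. s b c * z b)"

definition homogenization ::
  "('b \<Rightarrow> mdeg) \<Rightarrow> 'b set \<Rightarrow> ('b \<Rightarrow> 'b \<Rightarrow> 'k::field) \<Rightarrow> ('b \<Rightarrow> 'k mpoly) \<Rightarrow> 'b \<Rightarrow> 'k mpoly" where
  "homogenization deg B s x = (\<lambda>c. \<Sum>b\<in>B. Poly_Mapping.single (deg b - deg c) (s b c) * x b)"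

text \<open>
  Coordinates of the homogeneous component of degree \<open>\<alpha>\<close>: the basis element \<open>b\<close> enters it with the
  monomial of exponent \<open>\<alpha> - deg b\<close>, and this is why the elements of a strand are scalar functions.
\<close>

definition component :: "('b \<Rightarrow> mdeg) \<Rightarrow> mdeg \<Rightarrow> ('b \<Rightarrow> 'k::field mpoly) \<Rightarrow> 'b \<Rightarrow> 'k" where
  "component deg \<alpha> x = (\<lambda>b. if deg b \<preceq> \<alpha> then Poly_Mapping.lookup (x b) (\<alpha> - deg b) else 0)"

definition of_component :: "('b \<Rightarrow> mdeg) \<Rightarrow> mdeg \<Rightarrow> ('b \<Rightarrow> 'k::field) \<Rightarrow> 'b \<Rightarrow> 'k mpoly" where
  "of_component deg \<alpha> z = (\<lambda>b. Poly_Mapping.single (\<alpha> - deg b) (z b))"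

lemma component_zero [simp]: "component deg \<alpha> (\<lambda>_. 0) = (\<lambda>_. 0)"
  by (auto simp: component_def)

lemma component_add_deg: "component deg (m + deg b) x b = Poly_Mapping.lookup (x b) m"
  by (simp add: component_def mdeg_le_iff_add) (metis add.commute)

lemma eq_if_components_eq:
  assumes "\<And>\<alpha>. component deg \<alpha> x = component deg \<alpha> y"
  shows "x = y"
  by (intro ext poly_mapping_eqI) (metis assms component_add_deg)

lemma component_of_component:
  assumes "supported_on {b. deg b \<preceq> \<alpha>} z"
  shows "component deg \<beta> (of_component deg \<alpha> z) = (if \<beta> = \<alpha> then z else (\<lambda>_. 0))"
proof -
  have "\<beta> - deg b = \<alpha> - deg b \<Longrightarrow> \<beta> = \<alpha>" if "deg b \<preceq> \<alpha>" "deg b \<preceq> \<beta>" for b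
    using that by (auto simp: mdeg_le_iff_add)
  then show ?thesis
    using assms
    by (fastforce simp: component_def of_component_def lookup_single when_def supported_on_def)
qed

lemma component_sum:
  "component deg \<alpha> (\<lambda>b. \<Sum>i\<in>F. x i b) = (\<lambda>b. \<Sum>i\<in>F. component deg \<alpha> (x i) b)"
  by (auto simp: component_def lookup_sum)

text \<open>
  In a fixed degree, multiplication by \<open>x\<^bsup>deg b - deg c\<^esup>\<close> is just the identification of the monomial
  at \<open>b\<close> with the monomial at \<open>c\<close>.  If \<open>c\<close> is not in the strand, then neither is any \<open>b\<close> that
  contributes to it, so that both sides vanish.
\<close>

lemma component_homogenization:
  assumes "\<And>b c. b \<in> B \<Longrightarrow> s b c \<noteq> 0 \<Longrightarrow> deg c \<preceq> deg b"
  shows "component deg \<alpha> (homogenization deg B s x) = lin_ext B s (component deg \<alpha> x)"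
proof
  fix c
  have "(if deg c \<preceq> \<alpha>
         then Poly_Mapping.lookup (Poly_Mapping.single (deg b - deg c) (s b c) * x b) (\<alpha> - deg c)
         else 0) = s b c * component deg \<alpha> x b" if "b \<in> B" for b
  proof (cases "s b c = 0")
    case False
    then obtain d where d: "deg b = deg c + d"
      using assms[OF \<open>b \<in> B\<close> False] mdeg_le_iff_add by metis
    have "deg b \<preceq> \<alpha> \<longleftrightarrow> deg c \<preceq> \<alpha> \<and> d \<preceq> \<alpha> - deg c"
      unfolding d by (auto simp: mdeg_le_def lookup_add lookup_minus) (metis add_leD1, metis add_leD1 le_diff_conv2 add.commute, metis le_diff_conv2 add.commute)
    then show ?thesis
      by (auto simp: component_def lookup_single_times d diff_diff_eq)
  qed simp
  then show "component deg \<alpha> (homogenization deg B s x) c = lin_ext B s (component deg \<alpha> x) c"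
    by (auto simp: component_def homogenization_def lin_ext_def lookup_sum
        cong: sum.cong intro!: sum.neutral dest: sum.cong) 
qed

text \<open>
  Membership in the free module is a condition on the components, which makes it possible to argue
  with components only.
\<close>

lemma free_module_iff_components:
  assumes "deg ` B \<subseteq> mdegs n"
  shows "x \<in> free_module n B \<longleftrightarrow>
    (\<forall>\<alpha>. supported_on B (component deg \<alpha> x) \<and> (\<alpha> \<notin> mdegs n \<longrightarrow> component deg \<alpha> x = (\<lambda>_. 0)))"
    (is "_ \<longleftrightarrow> (\<forall>\<alpha>. ?S \<alpha> \<and> ?Z \<alpha>)")
proof
  assume x: "x \<in> free_module n B"
  have "b \<in> B \<and> \<alpha> \<in> mdegs n" if nz: "component deg \<alpha> x b \<noteq> 0" for \<alpha> b
  proof -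
    have le: "deg b \<preceq> \<alpha>" and m: "\<alpha> - deg b \<in> Poly_Mapping.keys (x b)"
      using nz by (auto simp: component_def in_keys_iff split: if_splits)
    then have "b \<in> B" and "\<alpha> - deg b \<in> mdegs n"
      using x by (auto simp: free_module_def polys_def)
    moreover have "\<alpha> = (\<alpha> - deg b) + deg b"
      using le by (auto simp: mdeg_le_iff_add add.commute)
    ultimately show ?thesis
      using assms mdegs_add_iff by (metis image_subset_iff)
  qed
  then show "\<forall>\<alpha>. ?S \<alpha> \<and> ?Z \<alpha>"
    unfolding supported_on_def by blast
next
  assume H: "\<forall>\<alpha>. ?S \<alpha> \<and> ?Z \<alpha>"
  have *: "b \<in> B \<and> m \<in> mdegs n" if "Poly_Mapping.lookup (x b) m \<noteq> 0" for b m
  proof -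
    have "component deg (m + deg b) x b \<noteq> 0"
      using that by (simp add: component_add_deg)
    then show ?thesis
      using H unfolding supported_on_def by (metis mdegs_add_iff)
  qed
  show "x \<in> free_module n B"
    unfolding free_module_def polys_def
  proof (intro CollectI conjI allI impI)
    show "Poly_Mapping.keys (x b) \<subseteq> mdegs n" for b
      using * by (auto simp: in_keys_iff)
    show "x b = 0" if "b \<notin> B" for b
      using * that by (intro poly_mapping_eqI) auto
  qed
qed

lemma finite_nonzero_components:
  assumes "finite B" "x \<in> free_module n B"
  shows "finite {\<alpha>. component deg \<alpha> x \<noteq> (\<lambda>_. 0)}"
proof (rule finite_subset)
  show "{\<alpha>. component deg \<alpha> x \<noteq> (\<lambda>_. 0)} \<subseteq> (\<Union>b\<in>B. (\<lambda>m. m + deg b) ` Poly_Mapping.keys (x b))"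
  proof
    fix \<alpha> assume "\<alpha> \<in> {\<alpha>. component deg \<alpha> x \<noteq> (\<lambda>_. 0)}"
    then obtain b where "deg b \<preceq> \<alpha>" and m: "\<alpha> - deg b \<in> Poly_Mapping.keys (x b)"
      unfolding component_def in_keys_iff by (auto simp: fun_eq_iff split: if_splits)
    then have "\<alpha> = (\<alpha> - deg b) + deg b"
      by (auto simp: mdeg_le_iff_add add.commute)
    moreover have "b \<in> B"
      using m assms(2) by (auto simp: free_module_def)
    ultimately show "\<alpha> \<in> (\<Union>b\<in>B. (\<lambda>m. m + deg b) ` Poly_Mapping.keys (x b))"
      using m by blast
  qed
qed (use assms in auto)

definition strand :: "('b \<Rightarrow> mdeg) \<Rightarrow> mdeg \<Rightarrow> 'b set \<Rightarrow> ('b \<Rightarrow> 'k::field) set" where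
  "strand deg \<alpha> B = {z. supported_on {b \<in> B. deg b \<preceq> \<alpha>} z}"

lemma component_in_strand:
  assumes "deg ` B \<subseteq> mdegs n" "x \<in> free_module n B"
  shows "component deg \<alpha> x \<in> strand deg \<alpha> B"
proof -
  have "supported_on B (component deg \<alpha> x)"
    using free_module_iff_components[of deg B n x] assms by blast
  then show ?thesis
    by (auto simp: strand_def supported_on_def component_def split: if_splits)
qed

lemma sum_of_components_in_free_module:
  assumes "deg ` B \<subseteq> mdegs n" "finite F" "F \<subseteq> mdegs n"
    and w: "\<And>\<alpha>. \<alpha> \<in> F \<Longrightarrow> w \<alpha> \<in> strand deg \<alpha> B"
  defines "y \<equiv> \<lambda>b. \<Sum>\<alpha>\<in>F. of_component deg \<alpha> (w \<alpha>) b"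
  shows "component deg \<beta> y = (if \<beta> \<in> F then w \<beta> else (\<lambda>_. 0))" and "y \<in> free_module n B"
proof -
  have "component deg \<beta> (of_component deg \<alpha> (w \<alpha>)) = (if \<beta> = \<alpha> then w \<alpha> else (\<lambda>_. 0))"
    if "\<alpha> \<in> F" for \<alpha> \<beta>
    using w[OF that] by (intro component_of_component) (auto simp: strand_def supported_on_def)
  then have comp: "component deg \<beta> y = (if \<beta> \<in> F then w \<beta> else (\<lambda>_. 0))" for \<beta>
    unfolding y_def component_sum using \<open>finite F\<close>
    by (auto simp: fun_eq_iff if_distribR sum.delta cong: if_cong)
  then show "component deg \<beta> y = (if \<beta> \<in> F then w \<beta> else (\<lambda>_. 0))" .
  show "y \<in> free_module n B"
    unfolding free_module_iff_components[of deg B n y, OF assms(1)] comp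
    using w \<open>F \<subseteq> mdegs n\<close> by (auto simp: strand_def supported_on_def)
qed

text \<open>
  A kernel and an image are graded, and a finite sum of preimages of the components is a preimage of
  the sum.  Only finitely many components of an element are nonzero, so that no choice has to be made
  in the other degrees.
\<close>

lemma exact_iff_strands_exact:
  fixes s t :: "'b \<Rightarrow> 'b \<Rightarrow> 'k::field"
  assumes fin: "finite B" "finite B'"
    and dB: "deg ` B \<subseteq> mdegs n" and dB': "deg ` B' \<subseteq> mdegs n"
    and s: "\<And>b c. b \<in> B' \<Longrightarrow> s b c \<noteq> 0 \<Longrightarrow> deg c \<preceq> deg b"
    and t: "\<And>b c. b \<in> B \<Longrightarrow> t b c \<noteq> 0 \<Longrightarrow> deg c \<preceq> deg b"
  shows "{x \<in> free_module n B. homogenization deg B t x = (\<lambda>_. 0)}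
        = homogenization deg B' s ` free_module n B'
     \<longleftrightarrow> (\<forall>\<alpha>\<in>mdegs n. {z \<in> strand deg \<alpha> B. lin_ext B t z = (\<lambda>_. 0)}
                     = lin_ext B' s ` strand deg \<alpha> B')"
    (is "?Ker = ?Im \<longleftrightarrow> (\<forall>\<alpha>\<in>mdegs n. ?ker \<alpha> = ?im \<alpha>)")
proof -
  have comp_s: "component deg \<alpha> (homogenization deg B' s x) = lin_ext B' s (component deg \<alpha> x)" for \<alpha> x
    using s by (rule component_homogenization)
  have comp_t: "component deg \<alpha> (homogenization deg B t x) = lin_ext B t (component deg \<alpha> x)" for \<alpha> x
    using t by (rule component_homogenization)
  have lin0: "lin_ext B t (\<lambda>_. 0) = (\<lambda>_. 0)" "lin_ext B' s (\<lambda>_. 0) = (\<lambda>_. 0)"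
    by (auto simp: lin_ext_def)
  have single: "\<exists>x \<in> free_module n A. \<forall>\<beta>. component deg \<beta> x = (if \<beta> = \<alpha> then z else (\<lambda>_. 0))"
    if "deg ` A \<subseteq> mdegs n" "\<alpha> \<in> mdegs n" "z \<in> strand deg \<alpha> A" for A \<alpha> and z :: "'b \<Rightarrow> 'k"
    using sum_of_components_in_free_module[of deg A n "{\<alpha>}" "\<lambda>_. z"] that by (intro bexI) auto
  show ?thesis
  proof
    assume E: "?Ker = ?Im"
    show "\<forall>\<alpha>\<in>mdegs n. ?ker \<alpha> = ?im \<alpha>"
    proof (intro ballI equalityI subsetI)
      fix \<alpha> z assume \<alpha>: "\<alpha> \<in> mdegs n" and z: "z \<in> ?ker \<alpha>"
      then obtain x where x: "x \<in> free_module n B"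
        and cx: "\<And>\<beta>. component deg \<beta> x = (if \<beta> = \<alpha> then z else (\<lambda>_. 0))"
        using single[OF dB] by blast
      have "homogenization deg B t x = (\<lambda>_. 0)"
        using z by (intro eq_if_components_eq[where deg = deg]) (auto simp: comp_t cx lin0)
      then obtain y where y: "y \<in> free_module n B'" "x = homogenization deg B' s y"
        using E x by blast
      then have "z = lin_ext B' s (component deg \<alpha> y)"
        using cx[of \<alpha>] comp_s by simp
      then show "z \<in> ?im \<alpha>"
        using component_in_strand[OF dB' y(1)] by blast
    next
      fix \<alpha> z assume \<alpha>: "\<alpha> \<in> mdegs n" and "z \<in> ?im \<alpha>"
      then obtain w where w: "w \<in> strand deg \<alpha> B'" "z = lin_ext B' s w"
        by blast
      obtain y where y: "y \<in> free_module n B'"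
        and cy: "\<And>\<beta>. component deg \<beta> y = (if \<beta> = \<alpha> then w else (\<lambda>_. 0))"
        using single[OF dB' \<alpha> w(1)] by blast
      define x where "x = homogenization deg B' s y"
      have x: "x \<in> free_module n B" "homogenization deg B t x = (\<lambda>_. 0)"
        using E y unfolding x_def by auto
      have "component deg \<alpha> x = z"
        by (simp add: x_def comp_s cy w)
      then show "z \<in> ?ker \<alpha>"
        using component_in_strand[OF dB x(1), of \<alpha>] comp_t[of \<alpha> x] x(2) by simp
    qed
  next
    assume E: "\<forall>\<alpha>\<in>mdegs n. ?ker \<alpha> = ?im \<alpha>"
    show "?Ker = ?Im"
    proof (intro equalityI subsetI)
      fix x assume "x \<in> ?Ker"
      then have x: "x \<in> free_module n B" and tx: "homogenization deg B t x = (\<lambda>_. 0)"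
        by auto
      define F where "F = {\<alpha>. component deg \<alpha> x \<noteq> (\<lambda>_. 0)}"
      have finF: "finite F"
        unfolding F_def using fin(1) x by (rule finite_nonzero_components)
      have F: "F \<subseteq> mdegs n"
        using free_module_iff_components[of deg B n x, OF dB] x unfolding F_def by blast
      have "\<exists>w. w \<in> strand deg \<alpha> B' \<and> component deg \<alpha> x = lin_ext B' s w" if "\<alpha> \<in> F" for \<alpha>
      proof -
        have "component deg \<alpha> x \<in> ?ker \<alpha>"
          using component_in_strand[OF dB x, of \<alpha>] comp_t[of \<alpha> x] tx by simp
        then show ?thesis
          using E F that by blast
      qed
      then obtain w where w: "\<And>\<alpha>. \<alpha> \<in> F \<Longrightarrow> w \<alpha> \<in> strand deg \<alpha> B'"
        and xw: "\<And>\<alpha>. \<alpha> \<in> F \<Longrightarrow> component deg \<alpha> x = lin_ext B' s (w \<alpha>)"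
        by metis
      note y = sum_of_components_in_free_module[of deg B' n F w, OF dB' finF F w]
      have "x = homogenization deg B' s (\<lambda>b. \<Sum>\<alpha>\<in>F. of_component deg \<alpha> (w \<alpha>) b)"
        by (intro eq_if_components_eq[where deg = deg]) (auto simp: comp_s y(1) xw lin0, simp add: F_def)
      then show "x \<in> ?Im"
        using y(2) by blast
    next
      fix x assume "x \<in> ?Im"
      then obtain y where y: "y \<in> free_module n B'" "x = homogenization deg B' s y"
        by blast
      have ker: "component deg \<alpha> x \<in> ?ker \<alpha>" if "\<alpha> \<in> mdegs n" for \<alpha>
        using E that component_in_strand[OF dB' y(1), of \<alpha>] y(2) comp_s by auto
      have zero: "component deg \<alpha> x = (\<lambda>_. 0)" if "\<alpha> \<notin> mdegs n" for \<alpha>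
        using that free_module_iff_components[of deg B' n y, OF dB'] y comp_s lin0 by metis
      have "x \<in> free_module n B"
        unfolding free_module_iff_components[of deg B n x, OF dB]
        using ker zero by (fastforce simp: strand_def supported_on_def)
      moreover have "homogenization deg B t x = (\<lambda>_. 0)"
        using ker zero lin0
        by (intro eq_if_components_eq[where deg = deg]) (auto simp: comp_t, metis (mono_tags, lifting) mem_Collect_eq)
      ultimately show "x \<in> ?Ker"
        by blast
    qed
  qed
qed


section \<open>The contracting homotopy\<close>

text \<open>
  The diagonal has to be assumed to vanish, since \<open>t l l = - t l l\<close> says nothing in characteristic 2.
\<close>

lemma sum_alternating_eq_0:
  fixes t :: "'i \<Rightarrow> 'i \<Rightarrow> 'm::ab_group_add"
  assumes "finite N" "\<And>l m. l \<in> N \<Longrightarrow> m \<in> N \<Longrightarrow> t l m = - t m l" "\<And>l. l \<in> N \<Longrightarrow> t l l = 0"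
  shows "(\<Sum>l\<in>N. \<Sum>m\<in>N. t l m) = 0"
  using assms
proof (induction N rule: finite_induct)
  case (insert n N)
  have "(\<Sum>l\<in>N. t l n) = - (\<Sum>m\<in>N. t n m)"
    unfolding sum_negf[symmetric] by (intro sum.cong refl insert.prems(1)) auto
  moreover have "(\<Sum>l\<in>N. \<Sum>m\<in>N. t l m) = 0"
    using insert.IH insert.prems by blast
  moreover have "t n n = 0"
    by (rule insert.prems(2)) simp
  ultimately show ?case
    using insert.hyps by (simp add: sum.distrib)
qed simp

text \<open>
  This is \<open>\<iota>\<^sub>0 \<iota>\<^sub>1 \<dots> \<iota>\<^bsub>m-1\<^esub> x\<close>; the innermost operator has the largest index, so that a recursion step
  corresponds to the expansion of a determinant along its last row.
\<close>

primrec iterated_contraction :: "(nat \<Rightarrow> 'm \<Rightarrow> 'm) \<Rightarrow> nat \<Rightarrow> 'm \<Rightarrow> 'm" where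
  "iterated_contraction \<iota> 0 x = x"
| "iterated_contraction \<iota> (Suc m) x = iterated_contraction \<iota> m (\<iota> m x)"

text \<open>
  This is \<open>h\<^bsub>m-1\<^esub> \<dots> h\<^sub>1 h\<^sub>0 x\<close>, in the order in which the iterated contraction undoes it.
\<close>

primrec iterated_product :: "(nat \<Rightarrow> 'm \<Rightarrow> 'm) \<Rightarrow> nat \<Rightarrow> 'm \<Rightarrow> 'm" where
  "iterated_product h 0 x = x"
| "iterated_product h (Suc m) x = h m (iterated_product h m x)"

text \<open>
  The product of the idempotents \<open>h\<^sub>k \<iota>\<^sub>k\<close> for \<open>k < m\<close>.  When \<open>h\<^sub>k\<close> is exterior multiplication by \<open>u\<^sub>k\<close>,
  it is a projection onto the multiples of \<open>u\<^sub>0 \<and> \<dots> \<and> u\<^bsub>m-1\<^esub>\<close>.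
\<close>

primrec top_projection :: "(nat \<Rightarrow> 'm \<Rightarrow> 'm) \<Rightarrow> (nat \<Rightarrow> 'm \<Rightarrow> 'm) \<Rightarrow> nat \<Rightarrow> 'm \<Rightarrow> 'm" where
  "top_projection \<iota> h 0 x = x"
| "top_projection \<iota> h (Suc m) x = top_projection \<iota> h m (h m (\<iota> m x))"

lemma top_projection_closed:
  assumes "x \<in> S" "\<And>k x. k < m \<Longrightarrow> x \<in> S \<Longrightarrow> h k (\<iota> k x) \<in> S"
  shows "top_projection \<iota> h m x \<in> S"
  using assms by (induction m arbitrary: x) auto

locale contractions =
  fixes r :: nat and \<iota> :: "nat \<Rightarrow> 'm::ab_group_add \<Rightarrow> 'm"
  assumes contr_add: "i < r \<Longrightarrow> \<iota> i (x + y) = \<iota> i x + \<iota> i y"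
    and contr_contr: "i < r \<Longrightarrow> j < r \<Longrightarrow> \<iota> i (\<iota> j x) = - \<iota> j (\<iota> i x)"
    and contr_sq: "i < r \<Longrightarrow> \<iota> i (\<iota> i x) = 0"
begin

lemma additive_contr: "i < r \<Longrightarrow> Modules.additive (\<iota> i)"
  by (simp add: Modules.additive_def contr_add)

lemmas contr_0 = Modules.additive.zero[OF additive_contr]
  and contr_minus = Modules.additive.minus[OF additive_contr]
  and contr_sum = Modules.additive.sum[OF additive_contr]

lemma additive_iterated_contraction: "m \<le> r \<Longrightarrow> Modules.additive (iterated_contraction \<iota> m)"
proof (induction m)
  case (Suc m)
  then have "Modules.additive (iterated_contraction \<iota> m)"
    by simp
  with Suc.prems show ?case
    by (simp add: Modules.additive_def contr_add)
qed (simp add: Modules.additive_def)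

lemma iterated_contraction_contr:
  assumes "m \<le> r" "i < m"
  shows "iterated_contraction \<iota> m (\<iota> i x) = 0"
  using assms
proof (induction m arbitrary: x)
  case (Suc m)
  interpret additive "iterated_contraction \<iota> m"
    using Suc.prems by (intro additive_iterated_contraction) simp
  show ?case
  proof (cases "i = m")
    case True
    then show ?thesis
      using Suc.prems contr_sq zero by simp
  next
    case False
    then have "\<iota> m (\<iota> i x) = - \<iota> i (\<iota> m x)"
      using Suc.prems by (intro contr_contr) auto
    then show ?thesis
      using Suc False minus by simp
  qed
qed simp

lemma contr_iterated_contraction:
  assumes "m \<le> r" "i < m"
  shows "\<iota> i (iterated_contraction \<iota> m x) = 0"
  using assms
proof (induction m arbitrary: x)
  case (Suc m)
  show ?case
  proof (cases "i = m")
    case True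
    have "\<iota> m (iterated_contraction \<iota> k (\<iota> m y)) = 0" if "k \<le> m" for k y
      using that
    proof (induction k arbitrary: y)
      case 0
      then show ?case using Suc.prems contr_sq by simp
    next
      case (Suc k)
      have km: "\<iota> k (\<iota> m y) = - \<iota> m (\<iota> k y)"
        using Suc.prems \<open>Suc m \<le> r\<close> by (intro contr_contr) auto
      interpret additive "iterated_contraction \<iota> k"
        using Suc.prems \<open>Suc m \<le> r\<close> by (intro additive_iterated_contraction) simp
      show ?case
        using Suc \<open>Suc m \<le> r\<close> contr_minus by (simp add: km minus)
    qed
    then show ?thesis using True by simp
  next
    case False
    then show ?thesis using Suc by simp
  qed
qed simp

text \<open>
  The lowering operators commute and the contractions anticommute, so that the double sum is
  alternating.
\<close>

lemma koszul_square_zero: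
  "(\<Sum>j<r. \<iota> j (\<Sum>k<r. \<iota> k (X (((b :: nat \<Rightarrow> nat)(j := Suc (b j)))(k := Suc ((b(j := Suc (b j))) k)))))) = 0"
proof -
  have "(\<Sum>j<r. \<Sum>k<r. \<iota> j (\<iota> k (X ((b(j := Suc (b j)))(k := Suc ((b(j := Suc (b j))) k)))))) = 0"
  proof (rule sum_alternating_eq_0)
    fix j k assume jk: "j \<in> {..<r}" "k \<in> {..<r}"
    have swap: "(b(j := Suc (b j)))(k := Suc ((b(j := Suc (b j))) k))
        = (b(k := Suc (b k)))(j := Suc ((b(k := Suc (b k))) j))"
      by auto
    show "\<iota> j (\<iota> k (X ((b(j := Suc (b j)))(k := Suc ((b(j := Suc (b j))) k)))))
        = - \<iota> k (\<iota> j (X ((b(k := Suc (b k)))(j := Suc ((b(k := Suc (b k))) j)))))"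
      unfolding swap using jk by (intro contr_contr) auto
  qed (auto simp: contr_sq)
  then show ?thesis
    by (simp add: contr_sum)
qed

end

locale clifford_action = contractions r \<iota> for r and \<iota> :: "nat \<Rightarrow> 'a::ab_group_add \<Rightarrow> 'a" +
  fixes h :: "nat \<Rightarrow> 'a \<Rightarrow> 'a"
  assumes prod_add: "i < r \<Longrightarrow> h i (x + y) = h i x + h i y"
    and contr_prod: "i < r \<Longrightarrow> j < r \<Longrightarrow> \<iota> i (h j x) = (if i = j then x else 0) - h j (\<iota> i x)"
begin

lemma additive_prod: "i < r \<Longrightarrow> Modules.additive (h i)"
  by (simp add: Modules.additive_def prod_add)

lemmas prod_0 = Modules.additive.zero[OF additive_prod]
  and prod_minus = Modules.additive.minus[OF additive_prod]
  and prod_sum = Modules.additive.sum[OF additive_prod]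

lemma additive_top_projection: "m \<le> r \<Longrightarrow> Modules.additive (top_projection \<iota> h m)"
proof (induction m)
  case (Suc m)
  then have "Modules.additive (top_projection \<iota> h m)"
    by simp
  with Suc.prems show ?case
    by (simp add: Modules.additive_def contr_add prod_add)
qed (simp add: Modules.additive_def)

lemma contr_commutes_projector:
  assumes "i < r" "k < r" "i \<noteq> k"
  shows "\<iota> i (h k (\<iota> k x)) = h k (\<iota> k (\<iota> i x))"
proof -
  have "\<iota> i (h k (\<iota> k x)) = - h k (\<iota> i (\<iota> k x))"
    using assms contr_prod by simp
  also have "\<dots> = h k (\<iota> k (\<iota> i x))"
    unfolding contr_contr[OF assms(1,2), of x] using assms(2) by (simp add: prod_minus)
  finally show ?thesis .
qed

lemma contr_top_projection:
  assumes "m \<le> i" "i < r"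
  shows "\<iota> i (top_projection \<iota> h m x) = top_projection \<iota> h m (\<iota> i x)"
  using assms
proof (induction m arbitrary: x)
  case (Suc m)
  then show ?case
    using contr_commutes_projector[of i m x] by simp
qed simp

lemma top_projection_contr:
  assumes "m \<le> r" "i < m"
  shows "top_projection \<iota> h m (\<iota> i x) = 0"
  using assms
proof (induction m arbitrary: x)
  case (Suc m)
  interpret additive "top_projection \<iota> h m"
    using Suc.prems by (intro additive_top_projection) simp
  show ?case
  proof (cases "i = m")
    case True
    then show ?thesis
      using Suc.prems contr_sq prod_0 zero by simp
  next
    case False
    then have "h m (\<iota> m (\<iota> i x)) = \<iota> i (h m (\<iota> m x))"
      using Suc.prems by (intro contr_commutes_projector[symmetric]) auto
    then show ?thesis
      using Suc False by simp
  qed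
qed simp

lemma iterated_contraction_prod:
  assumes "m \<le> i" "i < r" "iterated_contraction \<iota> m x = 0"
  shows "iterated_contraction \<iota> m (h i x) = 0"
  using assms
proof (induction m arbitrary: x)
  case (Suc m)
  interpret additive "iterated_contraction \<iota> m"
    using Suc.prems by (intro additive_iterated_contraction) simp
  show ?case
    using Suc contr_prod[of m i x] minus by simp
qed (simp add: prod_0)

lemma top_projection_eq_0:
  assumes "m \<le> r" "iterated_contraction \<iota> m x = 0"
  shows "top_projection \<iota> h m x = 0"
  using assms
proof (induction m arbitrary: x)
  case (Suc m)
  then have "iterated_contraction \<iota> m (h m (\<iota> m x)) = 0"
    by (intro iterated_contraction_prod) auto
  then show ?case
    using Suc by simp
qed simp

text \<open>
  Each \<open>\<iota>\<^sub>k\<close> removes the \<open>h\<^sub>k\<close> that it meets first: in the other term of \<open>\<iota>\<^sub>k h\<^sub>k = 1 - h\<^sub>k \<iota>\<^sub>k\<close> it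
  passes the \<open>h\<^sub>j\<close> with \<open>j < k\<close> and kills \<open>x\<close>.  This solves the equation \<open>\<iota>\<^sub>0 \<dots> \<iota>\<^bsub>m-1\<^esub> y = x\<close>, which is what exactness at \<open>E\<close> asks for.
\<close>

lemma iterated_contraction_iterated_product:
  assumes "m \<le> r" "\<And>i. i < m \<Longrightarrow> \<iota> i x = 0"
  shows "iterated_contraction \<iota> m (iterated_product h m x) = x"
  using assms
proof (induction m)
  case (Suc m)
  have "\<iota> m (iterated_product h k x) = 0" if "k \<le> m" for k
    using that
  proof (induction k)
    case 0
    then show ?case using Suc.prems by simp
  next
    case (Suc k)
    then show ?case
      using \<open>Suc m \<le> r\<close> contr_prod[of m k] prod_0 by simp
  qed
  then have "\<iota> m (h m (iterated_product h m x)) = iterated_product h m x"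
    using Suc.prems contr_prod[of m m] prod_0 by simp
  then show ?case
    using Suc by simp
qed simp

text \<open>
  The complex is a tensor product of \<open>r\<close> complexes, one for each index \<open>k\<close>, and the \<open>k\<close>-th one has
  homology only at exponent \<open>0\<close> and in the image of \<open>h\<^sub>k \<iota>\<^sub>k\<close>.  The usual homotopy of a tensor product
  acts on the first factor that is not in this position.  Written out, \<open>Y b\<close> is
  \<open>P\<^sub>m h\<^sub>m X(b - e\<^sub>m)\<close>, where \<open>m\<close> is the index of the first nonzero entry of \<open>b\<close> and \<open>P\<^sub>m\<close> is the
  product of the \<open>h\<^sub>k \<iota>\<^sub>k\<close> with \<open>k < m\<close>.  In the boundary of \<open>Y\<close> at \<open>b\<close> the summands with index
  below \<open>m\<close> telescope, and those above it are controlled by the cycle condition at \<open>b - e\<^sub>m\<close>.  For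
  \<open>p = 0\<close> there is no nonzero entry, and what remains of the telescope is \<open>P\<^sub>r X(0)\<close>, which vanishes
  because \<open>X(0)\<close> is killed by the iterated contraction.  The sets \<open>S\<close> and \<open>S'\<close> keep track of
  degrees and supports.
\<close>

theorem koszul_exact:
  fixes X :: "(nat \<Rightarrow> nat) \<Rightarrow> 'a" and p :: nat
  assumes cycle: "\<And>q b. p = Suc q \<Longrightarrow> b \<in> exponents r q \<Longrightarrow> (\<Sum>j<r. \<iota> j (X (b(j := Suc (b j))))) = 0"
    and cycle_0: "p = 0 \<Longrightarrow> iterated_contraction \<iota> r (X (\<lambda>_. 0)) = 0"
    and X: "\<And>b. b \<in> exponents r p \<Longrightarrow> X b \<in> S"
    and S': "\<And>i x. i < r \<Longrightarrow> x \<in> S \<Longrightarrow> h i x \<in> S'" "\<And>i x. i < r \<Longrightarrow> x \<in> S' \<Longrightarrow> h i (\<iota> i x) \<in> S'"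
  obtains Y where "\<And>b. b \<in> exponents r (Suc p) \<Longrightarrow> Y b \<in> S'"
    and "\<And>b. b \<in> exponents r p \<Longrightarrow> (\<Sum>j<r. \<iota> j (Y (b(j := Suc (b j))))) = X b"
proof
  \<comment> \<open>The least index exists for \<open>b\<close> of positive total degree, the only case in which \<open>Y b\<close> matters.\<close>
  define first where "first b = (LEAST i. b i \<noteq> 0)" for b :: "nat \<Rightarrow> nat"
  define Y where "Y b = (let m = first b in top_projection \<iota> h m (h m (X (b(m := b m - 1)))))" for b
  have first_eq: "first b = m" if "b m \<noteq> 0" "\<And>i. i < m \<Longrightarrow> b i = 0" for b m
    unfolding first_def using that by (intro Least_equality) (auto simp: not_less[symmetric])
  show "Y b \<in> S'" if b: "b \<in> exponents r (Suc p)" for b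
  proof -
    have "(\<Sum>j<r. b j) \<noteq> 0"
      using b by (simp add: exponents_def)
    then obtain i where "i < r" "b i \<noteq> 0"
      using sum.not_neutral_contains_not_neutral[of b "{..<r}"] by auto
    then have "b (first b) \<noteq> 0" "first b \<le> i"
      unfolding first_def using LeastI[of "\<lambda>i. b i \<noteq> 0" i] Least_le[of "\<lambda>i. b i \<noteq> 0" i] by auto
    then have m: "first b < r" "b (first b) \<noteq> 0"
      using \<open>i < r\<close> by auto
    have "(\<Sum>j<r. (b(first b := b (first b) - 1)) j) = p"
    proof -
      have "(\<Sum>j<r. b j) = b (first b) + (\<Sum>j\<in>{..<r} - {first b}. b j)"
        using m by (intro sum.remove) auto
      moreover have "(\<Sum>j<r. (b(first b := b (first b) - 1)) j)
          = b (first b) - 1 + (\<Sum>j\<in>{..<r} - {first b}. b j)"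
        using m by (subst sum.remove[of _ "first b"]) auto
      ultimately show ?thesis
        using b m by (simp add: exponents_def)
    qed
    then have "b(first b := b (first b) - 1) \<in> exponents r p"
      using b m by (auto simp: exponents_def)
    then show ?thesis
      unfolding Y_def Let_def using m X S' by (intro top_projection_closed) auto
  qed
  fix b assume b: "b \<in> exponents r p"
  \<comment> \<open>The first nonzero entry of \<open>b\<close>, or \<open>r\<close> if there is none.\<close>
  define m where "m = (LEAST i. i = r \<or> b i \<noteq> 0)"
  have m_le: "m \<le> r"
    unfolding m_def by (rule Least_le) simp
  have below: "b i = 0" if "i < m" for i
    using that not_less_Least unfolding m_def by blast
  have at: "b m \<noteq> 0" if "m < r"
    using LeastI[of "\<lambda>i. i = r \<or> b i \<noteq> 0" r] that unfolding m_def[symmetric] by auto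
  let ?P = "top_projection \<iota> h"
  have Y_low: "Y (b(i := Suc (b i))) = ?P i (h i (X b))" if "i \<le> m" "i < r" for i
  proof -
    have "first (b(i := Suc (b i))) = i"
      using that below by (intro first_eq) auto
    then show ?thesis
      by (simp add: Y_def)
  qed
  have low: "\<iota> i (Y (b(i := Suc (b i)))) = ?P i (X b) - ?P i (h i (\<iota> i (X b)))"
    if "i \<le> m" "i < r" for i
  proof -
    interpret additive "?P i"
      using that by (intro additive_top_projection) simp
    show ?thesis
      using that by (simp add: Y_low contr_top_projection contr_prod diff)
  qed
  have "(\<Sum>i<m. \<iota> i (Y (b(i := Suc (b i))))) = (\<Sum>i<m. ?P i (X b) - ?P (Suc i) (X b))"
    using m_le low by (intro sum.cong) auto
  then have sum_low: "(\<Sum>i<m. \<iota> i (Y (b(i := Suc (b i))))) = X b - ?P m (X b)"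
    using sum_lessThan_telescope'[of "\<lambda>i. ?P i (X b)" m] by simp
  show "(\<Sum>j<r. \<iota> j (Y (b(j := Suc (b j))))) = X b"
  proof (cases "m = r")
    case True
    then have "b i = 0" for i
      using b below[of i] by (cases "i < r") (auto simp: exponents_def)
    then have "b = (\<lambda>_. 0)"
      by (rule ext)
    moreover from this have "p = 0"
      using b by (simp add: exponents_def)
    ultimately have "?P m (X b) = 0"
      using True cycle_0 by (intro top_projection_eq_0) auto
    then show ?thesis
      using sum_low True by simp
  next
    case False
    then have m: "m < r"
      using m_le by simp
    interpret additive "?P m"
      using m by (intro additive_top_projection) simp
    define b' where "b' = b(m := b m - 1)"
    let ?x = "\<lambda>i. X (b'(i := Suc (b' i)))"
    have xm: "?x m = X b"
      using at[OF m] by (simp add: b'_def)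
    have high: "\<iota> i (Y (b(i := Suc (b i)))) = - ?P m (h m (\<iota> i (?x i)))" if "m < i" "i < r" for i
    proof -
      have "first (b(i := Suc (b i))) = m"
        using that below at[OF m] by (intro first_eq) auto
      moreover have "(b(i := Suc (b i)))(m := b m - 1) = b'(i := Suc (b' i))"
        using that by (auto simp: b'_def)
      ultimately have "Y (b(i := Suc (b i))) = ?P m (h m (?x i))"
        using that by (simp add: Y_def)
      then show ?thesis
        using that m by (simp add: contr_top_projection contr_prod minus)
    qed
    \<comment> \<open>Extends the cycle condition to a sum over all indices: the terms below \<open>m\<close> contribute nothing.\<close>
    have killed: "?P m (h m (\<iota> i (?x i))) = 0" if "i < m" for i
    proof -
      have "h m (\<iota> i (?x i)) = - \<iota> i (h m (?x i))"
        using that m by (simp add: contr_prod)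
      then show ?thesis
        using that m top_projection_contr by (simp add: minus)
    qed
    obtain q where q: "p = Suc q" and b': "b' \<in> exponents r q"
    proof
      have "(\<Sum>j<r. b j) = b m + (\<Sum>j\<in>{..<r} - {m}. b j)"
        using m by (intro sum.remove) auto
      moreover have "(\<Sum>j<r. b' j) = b m - 1 + (\<Sum>j\<in>{..<r} - {m}. b j)"
        unfolding b'_def using m by (subst sum.remove[of _ m]) auto
      ultimately show "p = Suc (p - 1)" "b' \<in> exponents r (p - 1)"
        using b at[OF m] m by (auto simp: exponents_def b'_def)
    qed
    have "?P m (h m (\<Sum>i<r. \<iota> i (?x i))) = 0"
      using cycle[OF q b'] prod_0[OF m] zero by simp
    then have tot: "(\<Sum>i<r. ?P m (h m (\<iota> i (?x i)))) = 0"
      using m by (simp add: prod_sum sum)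
    have split: "(\<Sum>i<r. t i) = (\<Sum>i<m. t i) + (t m + (\<Sum>i\<in>{m<..<r}. t i))" for t :: "nat \<Rightarrow> 'a"
    proof -
      have "{..<r} = {..<m} \<union> insert m {m<..<r}"
        using m by auto
      moreover have "sum t ({..<m} \<union> insert m {m<..<r}) = sum t {..<m} + sum t (insert m {m<..<r})"
        by (intro sum.union_disjoint) auto
      ultimately show ?thesis
        by simp
    qed
    have "(\<Sum>i\<in>{m<..<r}. ?P m (h m (\<iota> i (?x i)))) = - ?P m (h m (\<iota> m (X b)))"
      using tot unfolding split xm by (simp add: killed eq_neg_iff_add_eq_0 add.commute)
    moreover have "(\<Sum>i\<in>{m<..<r}. \<iota> i (Y (b(i := Suc (b i)))))
        = - (\<Sum>i\<in>{m<..<r}. ?P m (h m (\<iota> i (?x i))))"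
      unfolding sum_negf[symmetric] using high by (intro sum.cong) auto
    ultimately show ?thesis
      unfolding split sum_low using low[of m] m by simp
  qed
qed

end


section \<open>Contractions and exterior multiplication\<close>

lemma sgn_ins_sq [simp]: "sgn_ins l K * sgn_ins l K = (1 :: 'k::field)"
  by (simp add: sgn_ins_def power_mult_distrib[symmetric])

lemma sgn_ins_mult_sgn_ins [simp]: "sgn_ins l K * (sgn_ins l K * x) = (x :: 'k::field)"
  by (simp add: mult.assoc[symmetric])

lemma sgn_ins_insert:
  "sgn_ins m (insert l K) = (if l < m \<and> l \<notin> K then - sgn_ins m K else (sgn_ins m K :: 'k::field))"
proof -
  have "{k \<in> insert l K. k < m} = (if l < m then insert l {k \<in> K. k < m} else {k \<in> K. k < m})"
    by auto
  then show ?thesis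
    by (simp add: sgn_ins_def card_insert_if)
qed

lemma sgn_ins_remove:
  "sgn_ins m (K - {l}) = (if l < m \<and> l \<in> K then - sgn_ins m K else (sgn_ins m K :: 'k::field))"
  using sgn_ins_insert[of m l "K - {l}", where 'k = 'k]
  by (cases "l \<in> K") (auto simp: insert_absorb)

lemma sgn_ins_empty [simp]: "sgn_ins l {} = 1"
  by (simp add: sgn_ins_def)

text \<open>
  An element of the exterior algebra is given by its coordinates: \<open>F K\<close> is the coefficient of
  \<open>\<epsilon>\<^sub>K\<close>.  The next two operators are contraction with the \<open>l\<close>-th coordinate form and exterior
  multiplication by \<open>\<epsilon>\<^sub>l\<close> from the left; all sign computations are confined to them.
\<close>

definition annihilate :: "nat \<Rightarrow> (nat set \<Rightarrow> 'k::field) \<Rightarrow> nat set \<Rightarrow> 'k" where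
  "annihilate l F K = (if l \<in> K then 0 else sgn_ins l K * F (insert l K))"

definition create :: "nat \<Rightarrow> (nat set \<Rightarrow> 'k::field) \<Rightarrow> nat set \<Rightarrow> 'k" where
  "create l F K = (if l \<in> K then sgn_ins l K * F (K - {l}) else 0)"

lemma annihilate_annihilate: "annihilate l (annihilate m F) K = - annihilate m (annihilate l F) K"
  by (cases l m rule: linorder_cases) (auto simp: annihilate_def sgn_ins_insert insert_commute)

lemma annihilate_sq: "annihilate l (annihilate l F) K = 0"
  by (simp add: annihilate_def)

lemma annihilate_create:
  "annihilate l (create m F) K = (if l = m then F K else 0) - create m (annihilate l F) K"
proof (cases "l = m")
  case False
  then have "insert l K - {m} = insert l (K - {m})"
    by auto
  then show ?thesis
    using False
    by (cases l m rule: linorder_cases) (auto simp: annihilate_def create_def sgn_ins_insert sgn_ins_remove)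
qed (auto simp: annihilate_def create_def insert_absorb sgn_ins_insert sgn_ins_remove)

definition contract :: "nat set \<Rightarrow> (nat \<Rightarrow> 'k::field) \<Rightarrow> (nat set \<Rightarrow> 'k) \<Rightarrow> nat set \<Rightarrow> 'k" where
  "contract N f F K = (\<Sum>l\<in>N. f l * annihilate l F K)"

definition wedge :: "nat set \<Rightarrow> (nat \<Rightarrow> 'k::field) \<Rightarrow> (nat set \<Rightarrow> 'k) \<Rightarrow> nat set \<Rightarrow> 'k" where
  "wedge N u F K = (\<Sum>l\<in>N. u l * create l F K)"

lemma annihilate_contract_expand:
  "annihilate l (contract N f F) K = (\<Sum>m\<in>N. f m * annihilate l (annihilate m F) K)"
  by (auto simp: annihilate_def[of l] contract_def sum_distrib_left mult_ac)

lemma annihilate_wedge_expand: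
  "annihilate l (wedge N u F) K = (\<Sum>m\<in>N. u m * annihilate l (create m F) K)"
  by (auto simp: annihilate_def[of l] wedge_def sum_distrib_left mult_ac)

lemma create_contract_expand:
  "create l (contract N f F) K = (\<Sum>m\<in>N. f m * create l (annihilate m F) K)"
  by (auto simp: create_def[of l] contract_def sum_distrib_left mult_ac)

lemma annihilate_contract: "annihilate l (contract N f F) = - contract N f (annihilate l F)"
  by (rule ext) (simp add: annihilate_contract_expand annihilate_annihilate[of l] contract_def sum_negf)

lemma contract_contract: "contract N f (contract N f' F) = - contract N f' (contract N f F)"
proof
  fix K
  have "contract N f (contract N f' F) K
      = (\<Sum>l\<in>N. \<Sum>m\<in>N. f l * (f' m * annihilate l (annihilate m F) K))"
    by (simp add: contract_def[of N f] annihilate_contract_expand sum_distrib_left)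
  also have "\<dots> = (\<Sum>m\<in>N. \<Sum>l\<in>N. f l * (f' m * annihilate l (annihilate m F) K))"
    by (rule sum.swap)
  also have "\<dots> = (\<Sum>m\<in>N. \<Sum>l\<in>N. - (f' m * (f l * annihilate m (annihilate l F) K)))"
    by (intro sum.cong refl, subst annihilate_annihilate) (simp add: mult_ac)
  also have "\<dots> = (- contract N f' (contract N f F)) K"
    by (simp add: contract_def[of N f'] annihilate_contract_expand sum_distrib_left sum_negf)
  finally show "contract N f (contract N f' F) K = (- contract N f' (contract N f F)) K" .
qed

lemma contract_sq:
  assumes "finite N"
  shows "contract N f (contract N f F) = 0"
proof
  fix K
  have "(\<Sum>l\<in>N. \<Sum>m\<in>N. f l * (f m * annihilate l (annihilate m F) K)) = 0"
    using assms
  proof (rule sum_alternating_eq_0)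
    show "f l * (f m * annihilate l (annihilate m F) K) = - (f m * (f l * annihilate m (annihilate l F) K))"
      for l m
      unfolding annihilate_annihilate[of l m] by (simp add: mult_ac)
  qed (simp add: annihilate_sq)
  then show "contract N f (contract N f F) K = 0 K"
    by (simp add: contract_def[of N f] annihilate_contract_expand sum_distrib_left)
qed

lemma contract_wedge:
  assumes "finite N"
  shows "contract N f (wedge N u F) K = (\<Sum>l\<in>N. f l * u l) * F K - wedge N u (contract N f F) K"
proof -
  have "contract N f (wedge N u F) K
      = (\<Sum>l\<in>N. \<Sum>m\<in>N. f l * (u m * annihilate l (create m F) K))"
    by (simp add: contract_def[of N f] annihilate_wedge_expand sum_distrib_left)
  also have "\<dots> = (\<Sum>l\<in>N. \<Sum>m\<in>N. (if l = m then f l * u l * F K else 0)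
      - u m * (f l * create m (annihilate l F) K))"
    by (intro sum.cong refl, unfold annihilate_create) (simp add: right_diff_distrib mult_ac)
  also have "\<dots> = (\<Sum>l\<in>N. f l * u l * F K) - (\<Sum>l\<in>N. \<Sum>m\<in>N. u m * (f l * create m (annihilate l F) K))"
    using assms by (simp add: sum_subtractf)
  also have "(\<Sum>l\<in>N. \<Sum>m\<in>N. u m * (f l * create m (annihilate l F) K)) = wedge N u (contract N f F) K"
    unfolding wedge_def create_contract_expand sum_distrib_left by (rule sum.swap)
  finally show ?thesis
    by (simp only: sum_distrib_right)
qed

lemma contract_add: "contract N f (F + G) = contract N f F + contract N f G"
proof -
  have "annihilate l (F + G) K = annihilate l F K + annihilate l G K" for l K
    by (simp add: annihilate_def distrib_left)
  then show ?thesis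
    by (intro ext) (simp add: contract_def distrib_left sum.distrib)
qed

lemma wedge_add: "wedge N f (F + G) = wedge N f F + wedge N f G"
proof -
  have "create l (F + G) K = create l F K + create l G K" for l K
    by (simp add: create_def distrib_left)
  then show ?thesis
    by (intro ext) (simp add: wedge_def distrib_left sum.distrib)
qed

lemma contractions_contract: "finite N \<Longrightarrow> contractions r (\<lambda>j. contract N (f j))"
  by unfold_locales (rule contract_add contract_contract contract_sq, assumption?)+

text \<open>
  Vectors \<open>u\<^sub>j\<close> dual to the forms \<open>f\<^sub>j\<close> provide the operators on which the homotopy is built.
\<close>

lemma clifford_action_contract_wedge:
  assumes "finite N"
    and "\<And>i j. i < r \<Longrightarrow> j < r \<Longrightarrow> (\<Sum>l\<in>N. f i l * u j l) = (if i = j then 1 else 0)"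
  shows "clifford_action r (\<lambda>j. contract N (f j)) (\<lambda>j. wedge N (u j))"
proof -
  interpret contractions r "\<lambda>j. contract N (f j)"
    using assms(1) by (rule contractions_contract)
  show ?thesis
  proof
    show "contract N (f i) (wedge N (u j) F) = (if i = j then F else 0) - wedge N (u j) (contract N (f i) F)"
      if "i < r" "j < r" for i j F
      using assms(2)[OF that] by (intro ext) (simp add: contract_wedge[OF assms(1)])
  qed (rule wedge_add)
qed

definition ext_power :: "nat set \<Rightarrow> nat \<Rightarrow> (nat set \<Rightarrow> 'k::field) set" where
  "ext_power A q = {F. \<forall>K. F K \<noteq> 0 \<longrightarrow> K \<subseteq> A \<and> card K = q}"

lemma contract_in_ext_power:
  assumes "finite A" "F \<in> ext_power A (Suc q)"
  shows "contract N f F \<in> ext_power A q"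
  unfolding ext_power_def
proof (intro CollectI allI impI)
  fix K assume "contract N f F K \<noteq> 0"
  then have "\<exists>l. annihilate l F K \<noteq> 0"
    by (rule contrapos_np) (simp add: contract_def)
  then obtain l where l: "l \<notin> K" "F (insert l K) \<noteq> 0"
    by (auto simp: annihilate_def split: if_splits)
  then have K: "insert l K \<subseteq> A" "card (insert l K) = Suc q"
    using assms(2) unfolding ext_power_def by blast+
  then show "K \<subseteq> A \<and> card K = q"
    using l(1) finite_subset[OF K(1) assms(1)] by simp
qed

lemma wedge_in_ext_power:
  assumes "finite A" "F \<in> ext_power A q" "\<And>l. u l \<noteq> 0 \<Longrightarrow> l \<in> A"
  shows "wedge N u F \<in> ext_power A (Suc q)"
  unfolding ext_power_def
proof (intro CollectI allI impI)
  fix K assume "wedge N u F K \<noteq> 0"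
  then have "\<exists>l. u l * create l F K \<noteq> 0"
    by (rule contrapos_np) (simp add: wedge_def)
  then obtain l where l: "u l \<noteq> 0" "l \<in> K" "F (K - {l}) \<noteq> 0"
    by (auto simp: create_def split: if_splits)
  then have K: "K - {l} \<subseteq> A" "card (K - {l}) = q"
    using assms(2) unfolding ext_power_def by blast+
  then have KA: "K \<subseteq> A"
    using assms(3)[OF l(1)] by blast
  have "card K = Suc q"
    using card.remove[OF finite_subset[OF KA assms(1)] l(2)] unfolding K(2) .
  with KA show "K \<subseteq> A \<and> card K = Suc q" ..
qed


section \<open>Iterated contractions and minors\<close>

definition form_minor :: "(nat \<Rightarrow> nat \<Rightarrow> 'k::field) \<Rightarrow> nat \<Rightarrow> nat set \<Rightarrow> 'k" where
  "form_minor f m L = det (mat m m (\<lambda>(j, k). f j (sorted_list_of_set L ! k)))"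

lemma remove1_nth:
  "distinct xs \<Longrightarrow> k < length xs \<Longrightarrow> remove1 (xs ! k) xs = take k xs @ drop (Suc k) xs"
proof (induction xs arbitrary: k)
  case (Cons x xs)
  then show ?case
    by (cases k) (auto simp: in_set_conv_nth)
qed simp

lemma card_less_nth_sorted_list_of_set:
  assumes "finite J" "k < card J"
  shows "card {y \<in> J. y < sorted_list_of_set J ! k} = k"
proof -
  let ?xs = "sorted_list_of_set J"
  have len: "length ?xs = card J" and set: "set ?xs = J"
    using assms by auto
  have mono: "?xs ! i < ?xs ! j" if "i < j" "j < card J" for i j
    using that len by (intro sorted_wrt_nth_less[OF strict_sorted_list_of_set]) simp_all
  have less: "?xs ! i < ?xs ! k \<longleftrightarrow> i < k" if "i < card J" for i
    using that assms(2) mono[of i k] mono[of k i] by (cases i k rule: linorder_cases) auto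
  have "{y \<in> J. y < ?xs ! k} = (!) ?xs ` {..<k}"
  proof (intro equalityI subsetI)
    fix y assume y: "y \<in> {y \<in> J. y < ?xs ! k}"
    then obtain i where "i < card J" "y = ?xs ! i"
      using set len by (metis (no_types, lifting) in_set_conv_nth mem_Collect_eq)
    then show "y \<in> (!) ?xs ` {..<k}"
      using y less by auto
  next
    fix y assume "y \<in> (!) ?xs ` {..<k}"
    then obtain i where i: "i < k" "y = ?xs ! i"
      by auto
    then have "y \<in> set ?xs"
      using assms(2) len by (auto intro!: nth_mem)
    then show "y \<in> {y \<in> J. y < ?xs ! k}"
      using i set assms(2) mono[of i k] by auto
  qed
  moreover have "inj_on ((!) ?xs) {..<k}"
    using assms(2) len distinct_sorted_list_of_set[of J]
    by (intro inj_on_nth) auto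
  ultimately show ?thesis
    by (simp add: card_image)
qed

text \<open>
  If \<open>l\<close> is the \<open>k\<close>-th element of \<open>J\<close>, counted from \<open>0\<close>, then \<open>sgn_ins l J\<close> is \<open>(-1)\<^sup>k\<close>.  The sign in
  the expansion along row \<open>m\<close> is \<open>(-1)\<^bsup>m+k\<^esup>\<close>, so that \<open>(-1)\<^sup>m\<close> is left over.
\<close>

lemma form_minor_expand_last_row:
  fixes f :: "nat \<Rightarrow> nat \<Rightarrow> 'k::field"
  assumes "finite J" "card J = Suc m"
  shows "form_minor f (Suc m) J
    = (-1) ^ m * (\<Sum>l\<in>J. sgn_ins l J * f m l * form_minor f m (J - {l}))"
proof -
  define xs where "xs = sorted_list_of_set J"
  have xs: "length xs = Suc m" "set xs = J" "distinct xs"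
    using assms by (auto simp: xs_def)
  define A where "A = mat (Suc m) (Suc m) (\<lambda>(j, k). f j (xs ! k))"
  have minor: "det (mat_delete A m k) = form_minor f m (J - {xs ! k})" if k: "k < Suc m" for k
  proof -
    have "sorted_list_of_set (J - {xs ! k}) = take k xs @ drop (Suc k) xs"
      using xs k assms(1) by (simp add: sorted_list_of_set_remove xs_def[symmetric] remove1_nth)
    then have "sorted_list_of_set (J - {xs ! k}) ! c = xs ! (if c < k then c else Suc c)" if "c < m" for c
      using that xs k by (auto simp: nth_append)
    then have "mat_delete A m k = mat m m (\<lambda>(j, c). f j (sorted_list_of_set (J - {xs ! k}) ! c))"
      using k by (intro eq_matI) (auto simp: mat_delete_def A_def)
    then show ?thesis
      by (simp add: form_minor_def)
  qed
  have sgn: "sgn_ins (xs ! k) J = ((-1) ^ k :: 'k)" if "k < Suc m" for k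
    using card_less_nth_sorted_list_of_set[of J k] assms that by (simp add: sgn_ins_def xs_def)
  have last_row: "A $$ (m, k) = f m (xs ! k)" if "k < Suc m" for k
    using that by (simp add: A_def)
  have "form_minor f (Suc m) J = det A"
    by (simp add: form_minor_def A_def xs_def)
  also have "\<dots> = (\<Sum>k<Suc m. A $$ (m, k) * cofactor A m k)"
    by (rule laplace_expansion_row) (auto simp: A_def)
  also have "\<dots> = (\<Sum>k<Suc m. (-1) ^ m * (sgn_ins (xs ! k) J * f m (xs ! k) * form_minor f m (J - {xs ! k})))"
    by (intro sum.cong refl) (auto simp: cofactor_def minor sgn last_row power_add)
  also have "\<dots> = (\<Sum>l\<in>J. (-1) ^ m * (sgn_ins l J * f m l * form_minor f m (J - {l})))"
    using xs by (intro sum.reindex_bij_betw bij_betw_nth) auto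
  finally show ?thesis
    by (simp add: sum_distrib_left)
qed

lemma sum_subsets_insert:
  fixes g :: "nat set \<Rightarrow> nat \<Rightarrow> 'm::comm_monoid_add"
  assumes "finite N"
  shows "(\<Sum>L | L \<subseteq> N \<and> card L = m. \<Sum>l\<in>N - L. g L l)
    = (\<Sum>J | J \<subseteq> N \<and> card J = Suc m. \<Sum>l\<in>J. g (J - {l}) l)"
proof -
  have fin: "finite {L. L \<subseteq> N \<and> P L}" for P
    using assms by (auto intro: finite_subset[of _ "Pow N"])
  have finJ: "J \<subseteq> N \<Longrightarrow> finite J" for J
    using assms finite_subset by blast
  show ?thesis
    unfolding sum.Sigma[OF fin ballI[OF finite_Diff[OF assms]]]
    by (subst sum.Sigma; (simp add: fin finJ)?;
        intro sum.reindex_bij_witness[of _ "\<lambda>(J, l). (J - {l}, l)" "\<lambda>(L, l). (insert l L, l)"])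
       (auto simp: finJ insert_absorb card_Diff_singleton)
qed

definition reversal_sign :: "nat \<Rightarrow> 'k::field" where
  "reversal_sign m = (-1) ^ (\<Sum>k<m. k)"

text \<open>
  The elements of \<open>L\<close> are removed by \<open>\<iota>\<^bsub>m-1\<^esub>\<close>, \<open>\<dots>\<close>, \<open>\<iota>\<^sub>0\<close> in this order, and each step is an
  expansion along the last row.  The leftover signs \<open>(-1)\<^sup>k\<close>, \<open>k < m\<close>, multiply up to the sign of
  the reversal of \<open>m\<close> elements.
\<close>

lemma iterated_contraction_at_empty:
  fixes f :: "nat \<Rightarrow> nat \<Rightarrow> 'k::field"
  assumes "finite N"
  shows "iterated_contraction (\<lambda>j. contract N (f j)) m F {}
    = reversal_sign m * (\<Sum>L | L \<subseteq> N \<and> card L = m. form_minor f m L * F L)"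
proof (induction m arbitrary: F)
  case 0
  have "{L. L \<subseteq> N \<and> card L = 0} = {{}}"
    using assms finite_subset by fastforce
  then show ?case
    by (simp add: reversal_sign_def form_minor_def)
next
  case (Suc m)
  let ?t = "\<lambda>L l. form_minor f m L * (f m l * (sgn_ins l L * F (insert l L)))"
  have "form_minor f m L * contract N (f m) F L = (\<Sum>l\<in>N - L. ?t L l)" for L
  proof -
    have "form_minor f m L * contract N (f m) F L
        = (\<Sum>l\<in>N. if l \<in> L then 0 else ?t L l)"
      by (auto simp: contract_def annihilate_def sum_distrib_left intro!: sum.cong)
    also have "\<dots> = (\<Sum>l\<in>N - L. ?t L l)"
      using assms by (intro sum.mono_neutral_cong_right) auto
    finally show ?thesis .
  qed
  then have "(\<Sum>L | L \<subseteq> N \<and> card L = m. form_minor f m L * contract N (f m) F L)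
      = (\<Sum>J | J \<subseteq> N \<and> card J = Suc m. \<Sum>l\<in>J. ?t (J - {l}) l)"
    by (simp add: sum_subsets_insert[OF assms])
  also have "\<dots> = (\<Sum>J | J \<subseteq> N \<and> card J = Suc m. (-1) ^ m * (form_minor f (Suc m) J * F J))"
  proof (rule sum.cong)
    fix J assume "J \<in> {J. J \<subseteq> N \<and> card J = Suc m}"
    then have J: "finite J" "card J = Suc m"
      using assms finite_subset by auto
    have "(\<Sum>l\<in>J. ?t (J - {l}) l) = (\<Sum>l\<in>J. sgn_ins l J * f m l * form_minor f m (J - {l})) * F J"
      unfolding sum_distrib_right by (intro sum.cong) (auto simp: insert_absorb sgn_ins_remove mult_ac)
    then show "(\<Sum>l\<in>J. ?t (J - {l}) l) = (-1) ^ m * (form_minor f (Suc m) J * F J)"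
      by (simp add: form_minor_expand_last_row[OF J] mult.assoc[symmetric] power_mult_distrib[symmetric])
  qed simp
  finally show ?case
    by (simp add: Suc.IH reversal_sign_def power_add sum_distrib_left mult_ac)
qed

lemma annihilate_iterated_contraction:
  assumes "finite N"
  shows "annihilate l (iterated_contraction (\<lambda>j. contract N (f j)) m F) K
    = (-1) ^ m * iterated_contraction (\<lambda>j. contract N (f j)) m (annihilate l F) K"
proof (induction m arbitrary: F)
  case (Suc m)
  interpret contractions "Suc m" "\<lambda>j. contract N (f j)"
    using assms by (rule contractions_contract)
  interpret additive "iterated_contraction (\<lambda>j. contract N (f j)) m"
    by (rule additive_iterated_contraction) simp
  show ?case
    unfolding iterated_contraction.simps Suc annihilate_contract minus by simp
qed simp

text \<open>
  Reading off the coefficient at \<open>{l}\<close> amounts to contracting with the \<open>l\<close>-th coordinate form first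
  and then reading off the coefficient at the empty set; moving that contraction past the other \<open>m\<close>
  costs the sign \<open>(-1)\<^sup>m\<close>.
\<close>

lemma iterated_contraction_at_singleton:
  fixes f :: "nat \<Rightarrow> nat \<Rightarrow> 'k::field"
  assumes "finite N"
  shows "iterated_contraction (\<lambda>j. contract N (f j)) m F {l}
    = (-1) ^ m * reversal_sign m *
      (\<Sum>L | L \<subseteq> N \<and> card L = m. form_minor f m L * annihilate l F L)"
proof -
  have "iterated_contraction (\<lambda>j. contract N (f j)) m F {l}
      = annihilate l (iterated_contraction (\<lambda>j. contract N (f j)) m F) {}"
    by (simp add: annihilate_def)
  then show ?thesis
    by (simp add: annihilate_iterated_contraction[OF assms] iterated_contraction_at_empty[OF assms])
qed

lemma form_minor_eq_0:
  fixes f :: "nat \<Rightarrow> nat \<Rightarrow> 'k::field"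
  assumes "\<And>l. l \<in> L \<Longrightarrow> (\<Sum>j<m. c j * f j l) = 0" "j0 < m" "c j0 \<noteq> 0" "card L = m"
  shows "form_minor f m L = 0"
proof -
  have fin: "finite L"
    using assms(2,4) by (metis card.infinite not_less0)
  define M where "M = mat m m (\<lambda>(j, k). f j (sorted_list_of_set L ! k))"
  have M: "M\<^sup>T \<in> carrier_mat m m"
    by (simp add: M_def)
  have "M\<^sup>T *\<^sub>v vec m c = 0\<^sub>v m"
  proof (rule eq_vecI)
    fix k assume k: "k < dim_vec (0\<^sub>v m :: 'k vec)"
    then have "sorted_list_of_set L ! k \<in> L"
      using fin assms(4) nth_mem[of k "sorted_list_of_set L"] by simp
    then have "(\<Sum>j<m. c j * f j (sorted_list_of_set L ! k)) = 0"
      by (rule assms(1))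
    then show "(M\<^sup>T *\<^sub>v vec m c) $ k = 0\<^sub>v m $ k"
      using k by (simp add: M_def scalar_prod_def lessThan_atLeast0 mult.commute)
  qed (simp add: M_def)
  moreover have "vec m c \<noteq> 0\<^sub>v m"
    using assms(2,3) by (metis index_vec index_zero_vec(1))
  ultimately have "det M\<^sup>T = 0"
    using det_0_iff_vec_prod_zero_field[OF M] by (metis vec_carrier)
  then show ?thesis
    using det_transpose[of M m] by (simp add: form_minor_def M_def)
qed


section \<open>Ranks of column submatrices and bases of the dual of the image\<close>

context vec_space
begin

lemma span_cols_eq_mat_image:
  assumes "A \<in> carrier_mat n nc"
  shows "span (set (cols A)) = mat_image A"
  using col_space_eq[OF assms] assms unfolding col_space_def mat_image_def by auto

lemma span_maximal_indpt:
  assumes S: "S \<subseteq> carrier_vec n" and U: "maximal U (\<lambda>T. T \<subseteq> S \<and> lin_indpt T)"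
  shows "span U = span S"
proof
  have US: "U \<subseteq> S" "lin_indpt U"
    using U by (auto simp: maximal_def)
  then have carrier: "U \<subseteq> carrier_vec n"
    using S by blast
  show "span U \<subseteq> span S"
    using US(1) by (rule span_is_monotone)
  have "v \<in> span U" if "v \<in> S" for v
  proof (rule ccontr)
    assume v: "v \<notin> span U"
    then have "v \<notin> U"
      using span_mem[of U v] carrier by auto
    moreover have "lin_indpt (U \<union> {v})"
      using lin_dep_iff_in_span[of U v] carrier US(2) that S v \<open>v \<notin> U\<close> by auto
    ultimately show False
      using U that unfolding maximal_def by blast
  qed
  then show "span S \<subseteq> span U"
    using carrier span_is_submodule[of U] by (intro span_is_subset) auto
qed

text \<open>
  A maximal independent set of columns of \<open>A\<close> extends to one of \<open>B\<close>; the ranks agree exactly if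
  nothing has to be added, and then both span the same space.
\<close>

lemma rank_mono_cols:
  assumes "A \<in> carrier_mat n a" "B \<in> carrier_mat n b" "set (cols A) \<subseteq> set (cols B)"
  shows "rank A \<le> rank B" and "rank A = rank B \<longleftrightarrow> mat_image A = mat_image B"
proof -
  have cols: "set (cols A) \<subseteq> carrier_vec n" "set (cols B) \<subseteq> carrier_vec n"
    using assms(1,2) cols_dim[of A] cols_dim[of B] by auto
  obtain S where S: "maximal S (\<lambda>T. T \<subseteq> set (cols A) \<and> lin_indpt T)"
    using maximal_exists_superset[of "set (cols A)" "\<lambda>T. T \<subseteq> set (cols A) \<and> lin_indpt T" "{}"]
    by (auto simp: finite_lin_indpt2)
  then have "S \<subseteq> set (cols B) \<and> lin_indpt S"
    using assms(3) by (auto simp: maximal_def)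
  then obtain S' where S': "finite S'" "maximal S' (\<lambda>T. T \<subseteq> set (cols B) \<and> lin_indpt T)" "S \<subseteq> S'"
    using maximal_exists_superset[of "set (cols B)" "\<lambda>T. T \<subseteq> set (cols B) \<and> lin_indpt T" S]
    by auto
  have rank: "rank A = card S" "rank B = card S'"
    using rank_card_indpt[OF assms(1) S] rank_card_indpt[OF assms(2) S'(2)] by simp_all
  show "rank A \<le> rank B"
    unfolding rank using S' by (intro card_mono)
  have span: "span S = mat_image A" "span S' = mat_image B"
    using span_maximal_indpt[OF cols(1) S] span_maximal_indpt[OF cols(2) S'(2)]
      span_cols_eq_mat_image assms(1,2) by simp_all
  show "rank A = rank B \<longleftrightarrow> mat_image A = mat_image B"
  proof
    assume "rank A = rank B"
    then have "S = S'"
      using rank S' by (intro card_subset_eq) auto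
    then show "mat_image A = mat_image B"
      using span by simp
  next
    assume "mat_image A = mat_image B"
    then show "rank A = rank B"
      using assms(1,2) by (simp add: rank_def span_cols_eq_mat_image)
  qed
qed

lemma rank_eq_dim_col_iff:
  assumes A: "A \<in> carrier_mat n nc"
  shows "rank A = nc \<longleftrightarrow> (\<forall>v \<in> carrier_vec nc. A *\<^sub>v v = 0\<^sub>v n \<longrightarrow> v = 0\<^sub>v nc)"
proof
  assume r: "rank A = nc"
  have "card (set (cols A)) \<ge> nc"
  proof -
    obtain S where S: "maximal S (\<lambda>T. T \<subseteq> set (cols A) \<and> lin_indpt T)"
      using maximal_exists_superset[of "set (cols A)" "\<lambda>T. T \<subseteq> set (cols A) \<and> lin_indpt T" "{}"]
      by (auto simp: finite_lin_indpt2)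
    then have "S \<subseteq> set (cols A)" "card S = nc"
      using rank_card_indpt[OF A] r by (auto simp: maximal_def)
    then show ?thesis
      using card_mono[of "set (cols A)" S] by simp
  qed
  then have dist: "distinct (cols A)"
    using A card_length[of "cols A"] by (intro card_distinct) auto
  then have "lin_indpt (set (cols A))"
    using full_rank_lin_indpt A r by blast
  then show "\<forall>v \<in> carrier_vec nc. A *\<^sub>v v = 0\<^sub>v n \<longrightarrow> v = 0\<^sub>v nc"
    using lin_depI[OF A] dist by blast
next
  assume inj: "\<forall>v \<in> carrier_vec nc. A *\<^sub>v v = 0\<^sub>v n \<longrightarrow> v = 0\<^sub>v nc"
  have dist: "distinct (cols A)"
  proof (rule ccontr)
    assume "\<not> distinct (cols A)"
    then obtain i j where ij: "i < nc" "j < nc" "i \<noteq> j" "col A i = col A j"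
      using A by (auto simp: distinct_conv_nth)
    have "A *\<^sub>v (unit_vec nc i - unit_vec nc j) = A *\<^sub>v unit_vec nc i - A *\<^sub>v unit_vec nc j"
      using A by (intro mult_minus_distrib_mat_vec) auto
    also have "\<dots> = 0\<^sub>v n"
    proof -
      have "A *\<^sub>v unit_vec nc k = col A k" if "k < nc" for k
        using A that by (intro eq_vecI) (auto simp: scalar_prod_right_unit)
      then show ?thesis
        using A ij by (auto intro!: minus_cancel_vec)
    qed
    finally have "unit_vec nc i - unit_vec nc j = (0\<^sub>v nc :: 'a vec)"
      using inj by (metis minus_carrier_vec unit_vec_carrier)
    then have "(unit_vec nc i - unit_vec nc j) $ i = (0\<^sub>v nc :: 'a vec) $ i"
      by simp
    then show False
      using ij by simp
  qed
  then have "lin_indpt (set (cols A))"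
    using lin_depE[OF A] inj by metis
  then show "rank A = nc"
    using lin_indpt_full_rank[OF A dist] by simp
qed

end

definition basis_index_set :: "nat \<Rightarrow> (nat \<Rightarrow> mdeg) \<Rightarrow> mdeg \<Rightarrow> nat set" where
  "basis_index_set e dE \<alpha> = {l. l < e \<and> dE l \<preceq> \<alpha>}"

lemma finite_basis_index_set [simp]: "finite (basis_index_set e dE \<alpha>)"
  by (simp add: basis_index_set_def)

lemma bij_betw_pick:
  assumes "finite A"
  shows "bij_betw (pick A) {..<card A} A"
proof (rule bij_betwI)
  show "pick A \<in> {..<card A} \<rightarrow> A"
    using pick_in_set_le by auto
  show "(\<lambda>l. card {a \<in> A. a < l}) \<in> A \<rightarrow> {..<card A}"
  proof
    fix l assume "l \<in> A"
    then have "{a \<in> A. a < l} \<subset> A"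
      by auto
    then show "card {a \<in> A. a < l} \<in> {..<card A}"
      using assms by (simp add: psubset_card_mono)
  qed
qed (auto simp: card_pick pick_card_in_set)

context
  fixes C :: "'k::field mat" and g e :: nat and dE :: "nat \<Rightarrow> mdeg" and \<alpha> :: mdeg
  assumes C: "C \<in> carrier_mat g e"
begin

lemma mult_mat_vec_index: "k < g \<Longrightarrow> (C *\<^sub>v vec e u) $ k = (\<Sum>l<e. C $$ (k, l) * u l)"
  using C by (auto simp: scalar_prod_def lessThan_atLeast0 intro!: sum.cong)

lemma cols_upto_carrier: "cols_upto C dE \<alpha> \<in> carrier_mat g (card (basis_index_set e dE \<alpha>))"
  by (rule carrier_matI) (use C in \<open>simp_all add: cols_upto_def dim_submatrix basis_index_set_def\<close>)

lemma cols_upto_index: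
  assumes "k < g" "i < card (basis_index_set e dE \<alpha>)"
  shows "cols_upto C dE \<alpha> $$ (k, i) = C $$ (k, pick (basis_index_set e dE \<alpha>) i)"
  using assms C pick_reduce_set[of i e "{l. dE l \<preceq> \<alpha>}"]
  by (simp add: cols_upto_def basis_index_set_def submatrix_index pick_UNIV)

lemma cols_upto_mult_vec:
  assumes "\<And>l. u l \<noteq> 0 \<Longrightarrow> l \<in> basis_index_set e dE \<alpha>"
  shows "cols_upto C dE \<alpha> *\<^sub>v vec (card (basis_index_set e dE \<alpha>)) (\<lambda>i. u (pick (basis_index_set e dE \<alpha>) i))
    = C *\<^sub>v vec e u"
proof (rule eq_vecI)
  let ?A = "basis_index_set e dE \<alpha>"
  fix k assume "k < dim_vec (C *\<^sub>v vec e u)"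
  then have k: "k < g"
    using C by simp
  have "(cols_upto C dE \<alpha> *\<^sub>v vec (card ?A) (\<lambda>i. u (pick ?A i))) $ k
      = (\<Sum>i<card ?A. C $$ (k, pick ?A i) * u (pick ?A i))"
    using k cols_upto_carrier
    by (auto simp: scalar_prod_def lessThan_atLeast0 cols_upto_index intro!: sum.cong)
  also have "\<dots> = (\<Sum>l\<in>?A. C $$ (k, l) * u l)"
    by (rule sum.reindex_bij_betw) (simp add: bij_betw_pick)
  also have "\<dots> = (\<Sum>l<e. C $$ (k, l) * u l)"
    using assms by (intro sum.mono_neutral_left) (auto simp: basis_index_set_def)
  finally show "(cols_upto C dE \<alpha> *\<^sub>v vec (card ?A) (\<lambda>i. u (pick ?A i))) $ k = (C *\<^sub>v vec e u) $ k"
    using k by (simp add: mult_mat_vec_index)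
qed (use C cols_upto_carrier in auto)

lemma obtain_coordinates:
  assumes "w \<in> carrier_vec (card (basis_index_set e dE \<alpha>))"
  obtains u where "\<And>l. u l \<noteq> 0 \<Longrightarrow> l \<in> basis_index_set e dE \<alpha>"
    and "w = vec (card (basis_index_set e dE \<alpha>)) (\<lambda>i. u (pick (basis_index_set e dE \<alpha>) i))"
proof
  let ?A = "basis_index_set e dE \<alpha>"
  define u where "u l = (if l \<in> ?A then w $ card {a \<in> ?A. a < l} else 0)" for l
  show "u l \<noteq> 0 \<Longrightarrow> l \<in> ?A" for l
    by (auto simp: u_def split: if_splits)
  show "w = vec (card ?A) (\<lambda>i. u (pick ?A i))"
    using assms pick_in_set_le[of _ ?A] by (intro eq_vecI) (auto simp: u_def card_pick)
qed

lemma mat_image_cols_upto: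
  "mat_image (cols_upto C dE \<alpha>) = {C *\<^sub>v vec e u |u. \<forall>l. u l \<noteq> 0 \<longrightarrow> l \<in> basis_index_set e dE \<alpha>}"
  (is "_ = ?R")
proof
  show "mat_image (cols_upto C dE \<alpha>) \<subseteq> ?R"
  proof
    fix v assume "v \<in> mat_image (cols_upto C dE \<alpha>)"
    then have "\<exists>w. v = cols_upto C dE \<alpha> *\<^sub>v w \<and> w \<in> carrier_vec (card (basis_index_set e dE \<alpha>))"
      using cols_upto_carrier by (simp add: mat_image_def)
    then obtain w where "w \<in> carrier_vec (card (basis_index_set e dE \<alpha>))" "v = cols_upto C dE \<alpha> *\<^sub>v w"
      by blast
    moreover obtain u where u: "\<And>l. u l \<noteq> 0 \<Longrightarrow> l \<in> basis_index_set e dE \<alpha>"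
      "w = vec (card (basis_index_set e dE \<alpha>)) (\<lambda>i. u (pick (basis_index_set e dE \<alpha>) i))"
      using obtain_coordinates calculation(1) by metis
    ultimately have "v = C *\<^sub>v vec e u"
      using cols_upto_mult_vec[of u, OF u(1)] by simp
    then show "v \<in> ?R"
      using u(1) by blast
  qed
  show "?R \<subseteq> mat_image (cols_upto C dE \<alpha>)"
  proof
    fix v assume "v \<in> ?R"
    then obtain u where u: "v = C *\<^sub>v vec e u" "\<forall>l. u l \<noteq> 0 \<longrightarrow> l \<in> basis_index_set e dE \<alpha>"
      by blast
    let ?w = "vec (card (basis_index_set e dE \<alpha>)) (\<lambda>i. u (pick (basis_index_set e dE \<alpha>) i))"
    have "v = cols_upto C dE \<alpha> *\<^sub>v ?w" "?w \<in> carrier_vec (dim_col (cols_upto C dE \<alpha>))"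
      using cols_upto_mult_vec[of u] u cols_upto_carrier by auto
    then show "v \<in> mat_image (cols_upto C dE \<alpha>)"
      unfolding mat_image_def by blast
  qed
qed

lemma mat_image_eq: "mat_image C = range (\<lambda>u. C *\<^sub>v vec e u)"
proof (intro equalityI subsetI)
  fix v assume "v \<in> mat_image C"
  then obtain w where w: "v = C *\<^sub>v w" "w \<in> carrier_vec e"
    using C by (auto simp: mat_image_def)
  then have "w = vec e (($) w)"
    by auto
  then have "v = C *\<^sub>v vec e (($) w)"
    using w(1) by simp
  then show "v \<in> range (\<lambda>u. C *\<^sub>v vec e u)"
    by blast
next
  fix v assume "v \<in> range (\<lambda>u. C *\<^sub>v vec e u)"
  then obtain u where "v = C *\<^sub>v vec e u"
    by blast
  moreover have "vec e u \<in> carrier_vec (dim_col C)"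
    using C by simp
  ultimately show "v \<in> mat_image C"
    unfolding mat_image_def by blast
qed

lemma mat_rank_cols_upto:
  shows "mat_rank (cols_upto C dE \<alpha>) \<le> mat_rank C"
    and "mat_rank (cols_upto C dE \<alpha>) \<le> card (basis_index_set e dE \<alpha>)"
    and "mat_rank (cols_upto C dE \<alpha>) = mat_rank C \<longleftrightarrow> mat_image (cols_upto C dE \<alpha>) = mat_image C"
    and "mat_rank (cols_upto C dE \<alpha>) = card (basis_index_set e dE \<alpha>) \<longleftrightarrow>
      (\<forall>u. (\<forall>l. u l \<noteq> 0 \<longrightarrow> l \<in> basis_index_set e dE \<alpha>) \<longrightarrow> C *\<^sub>v vec e u = 0\<^sub>v g \<longrightarrow> (\<forall>l. u l = 0))"
proof -
  let ?A = "basis_index_set e dE \<alpha>"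
  let ?D = "cols_upto C dE \<alpha>"
  interpret vec_space "TYPE('k)" g .
  note D = cols_upto_carrier
  have rank: "mat_rank ?D = rank ?D" "mat_rank C = rank C"
    using D C by (auto simp: mat_rank_def)
  have "set (cols ?D) \<subseteq> set (cols C)"
  proof
    fix v assume "v \<in> set (cols ?D)"
    then obtain i where i: "i < card ?A" "v = col ?D i"
      using D by (auto simp: cols_def)
    then have p: "pick ?A i < e"
      using pick_in_set_le[of i ?A] by (simp add: basis_index_set_def)
    have "v = col C (pick ?A i)"
      using i p C D by (intro eq_vecI) (auto simp: cols_upto_index)
    then show "v \<in> set (cols C)"
      using p C by (auto simp: cols_def)
  qed
  note mono = rank_mono_cols[OF D C this]
  show "mat_rank ?D \<le> mat_rank C" "mat_rank ?D \<le> card ?A"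
    "mat_rank ?D = mat_rank C \<longleftrightarrow> mat_image ?D = mat_image C"
    using mono rank_le_nc[OF D] by (simp_all add: rank)
  show "mat_rank ?D = card ?A \<longleftrightarrow>
      (\<forall>u. (\<forall>l. u l \<noteq> 0 \<longrightarrow> l \<in> ?A) \<longrightarrow> C *\<^sub>v vec e u = 0\<^sub>v g \<longrightarrow> (\<forall>l. u l = 0))"
    unfolding rank rank_eq_dim_col_iff[OF D]
  proof (intro iffI allI impI ballI)
    fix u l
    assume inj: "\<forall>v\<in>carrier_vec (card ?A). ?D *\<^sub>v v = 0\<^sub>v g \<longrightarrow> v = 0\<^sub>v (card ?A)"
      and u: "\<forall>l. u l \<noteq> 0 \<longrightarrow> l \<in> ?A" "C *\<^sub>v vec e u = 0\<^sub>v g"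
    have "?D *\<^sub>v vec (card ?A) (\<lambda>i. u (pick ?A i)) = 0\<^sub>v g"
      using cols_upto_mult_vec[of u] u by simp
    then have z: "vec (card ?A) (\<lambda>i. u (pick ?A i)) = 0\<^sub>v (card ?A)"
      using inj vec_carrier by blast
    show "u l = 0"
    proof (cases "l \<in> ?A")
      case True
      then have "l \<in> pick ?A ` {..<card ?A}"
        using bij_betw_imp_surj_on[OF bij_betw_pick[of ?A]] by simp
      then obtain i where "i < card ?A" "l = pick ?A i"
        by blast
      then show ?thesis
        using arg_cong[OF z, of "\<lambda>v. v $ i"] by simp
    qed (use u in auto)
  next
    fix v
    assume inj: "\<forall>u. (\<forall>l. u l \<noteq> 0 \<longrightarrow> l \<in> ?A) \<longrightarrow> C *\<^sub>v vec e u = 0\<^sub>v g \<longrightarrow> (\<forall>l. u l = 0)"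
      and v: "v \<in> carrier_vec (card ?A)" "?D *\<^sub>v v = 0\<^sub>v g"
    obtain u where u: "\<And>l. u l \<noteq> 0 \<Longrightarrow> l \<in> ?A" "v = vec (card ?A) (\<lambda>i. u (pick ?A i))"
      using obtain_coordinates[OF v(1)] by blast
    have "C *\<^sub>v vec e u = 0\<^sub>v g"
      using cols_upto_mult_vec[of u, OF u(1)] v(2) unfolding u(2) by simp
    then have "\<forall>l. u l = 0"
      using inj u(1) by blast
    then show "v = 0\<^sub>v (card ?A)"
      unfolding u(2) by auto
  qed
qed

end

definition forms_independent_on :: "nat set \<Rightarrow> nat \<Rightarrow> (nat \<Rightarrow> nat \<Rightarrow> 'k::field) \<Rightarrow> bool" where
  "forms_independent_on A r f \<longleftrightarrow>
    (\<forall>c. (\<forall>l\<in>A. (\<Sum>j<r. c j * f j l) = 0) \<longrightarrow> (\<forall>j<r. c j = 0))"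

text \<open>
  Induction on the number of forms, as in the Gram-Schmidt process.  The part of \<open>f\<^sub>r\<close> that is not a
  combination of the earlier forms is nonzero at some \<open>l0\<close>; correcting \<open>\<epsilon>\<^bsub>l0\<^esub>\<close> by the earlier dual
  vectors gives the last dual vector, by which the earlier ones are then corrected.
\<close>

lemma forms_independent_on_dual_vectors:
  fixes f :: "nat \<Rightarrow> nat \<Rightarrow> 'k::field"
  assumes "finite A" "forms_independent_on A r f"
  shows "\<exists>u. (\<forall>j l. u j l \<noteq> 0 \<longrightarrow> l \<in> A) \<and>
    (\<forall>i<r. \<forall>j<r. (\<Sum>l\<in>A. f i l * u j l) = (if i = j then 1 else 0))"
  using assms(2)
proof (induction r)
  case 0
  show ?case
    by (intro exI[of _ "\<lambda>_ _. 0"]) simp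
next
  case (Suc r)
  have "forms_independent_on A r f"
    unfolding forms_independent_on_def
  proof (intro allI impI)
    fix c j assume c: "\<forall>l\<in>A. (\<Sum>j<r. c j * f j l) = 0" and j: "j < r"
    have "\<forall>l\<in>A. (\<Sum>j<Suc r. (c(r := 0)) j * f j l) = 0"
      using c by simp
    then have "(c(r := 0)) j = 0"
      using Suc.prems j unfolding forms_independent_on_def by (metis less_SucI)
    then show "c j = 0"
      using j by simp
  qed
  then obtain u where u_props: "(\<forall>j l. u j l \<noteq> 0 \<longrightarrow> l \<in> A) \<and>
      (\<forall>i<r. \<forall>j<r. (\<Sum>l\<in>A. f i l * u j l) = (if i = j then 1 else 0))"
    using Suc.IH by blast
  then have u0: "\<And>j l. u j l \<noteq> 0 \<Longrightarrow> l \<in> A"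
    and u: "\<And>i j. i < r \<Longrightarrow> j < r \<Longrightarrow> (\<Sum>l\<in>A. f i l * u j l) = (if i = j then 1 else 0)"
    by blast+
  define a where "a k = (\<Sum>l\<in>A. f r l * u k l)" for k
  have "\<exists>l0\<in>A. f r l0 - (\<Sum>k<r. a k * f k l0) \<noteq> 0"
  proof (rule ccontr)
    assume H: "\<not> ?thesis"
    \<comment> \<open>Otherwise the last form would be a combination of the others.\<close>
    define c where "c k = (if k = r then 1 else - a k)" for k
    have "\<forall>l\<in>A. (\<Sum>j<Suc r. c j * f j l) = 0"
      using H by (simp add: c_def sum_negf)
    then have "c r = 0"
      using Suc.prems unfolding forms_independent_on_def by blast
    then show False
      by (simp add: c_def)
  qed
  then obtain l0 where l0: "l0 \<in> A" "f r l0 - (\<Sum>k<r. a k * f k l0) \<noteq> 0"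
    by blast
  define d where "d = f r l0 - (\<Sum>k<r. a k * f k l0)"
  define w where "w l = ((if l = l0 then 1 else 0) - (\<Sum>k<r. f k l0 * u k l)) / d" for l
  have w0: "l \<in> A" if "w l \<noteq> 0" for l
  proof (rule ccontr)
    assume "l \<notin> A"
    then have "u k l = 0" for k
      using u0 by blast
    moreover have "l \<noteq> l0"
      using l0(1) \<open>l \<notin> A\<close> by blast
    ultimately show False
      using that by (simp add: w_def)
  qed
  have fw: "(\<Sum>l\<in>A. f i l * w l) = (f i l0 - (\<Sum>k<r. f k l0 * (\<Sum>l\<in>A. f i l * u k l))) / d" for i
  proof -
    have "(\<Sum>l\<in>A. f i l * w l)
        = (\<Sum>l\<in>A. (if l = l0 then f i l else 0) - (\<Sum>k<r. f k l0 * (f i l * u k l))) / d"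
      unfolding sum_divide_distrib
      by (intro sum.cong refl) (simp add: w_def right_diff_distrib sum_distrib_left mult_ac)
    also have "\<dots> = (f i l0 - (\<Sum>l\<in>A. \<Sum>k<r. f k l0 * (f i l * u k l))) / d"
      using assms(1) l0(1) by (simp add: sum_subtractf)
    also have "(\<Sum>l\<in>A. \<Sum>k<r. f k l0 * (f i l * u k l)) = (\<Sum>k<r. f k l0 * (\<Sum>l\<in>A. f i l * u k l))"
      by (subst sum.swap) (simp add: sum_distrib_left)
    finally show ?thesis .
  qed
  have fw_low: "(\<Sum>l\<in>A. f i l * w l) = 0" if "i < r" for i
  proof -
    have "(\<Sum>k<r. f k l0 * (\<Sum>l\<in>A. f i l * u k l)) = (\<Sum>k<r. if i = k then f k l0 else 0)"
      using u that by (intro sum.cong) auto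
    then show ?thesis
      using that by (simp add: fw)
  qed
  have fw_r: "(\<Sum>l\<in>A. f r l * w l) = 1"
    using l0(2) unfolding fw a_def[symmetric] d_def by (simp add: mult.commute)
  define u' where "u' j l = (if j = r then w l else u j l - a j * w l)" for j l
  have "l \<in> A" if "u' j l \<noteq> 0" for j l
    using that u0[of j l] w0[of l] by (cases "w l = 0") (auto simp: u'_def split: if_splits)
  moreover have "(\<Sum>l\<in>A. f i l * u' j l) = (if i = j then 1 else 0)" if "i < Suc r" "j < Suc r" for i j
  proof (cases "j = r")
    case True
    then show ?thesis
      using that fw_low fw_r by (auto simp: u'_def less_Suc_eq)
  next
    case False
    have "(\<Sum>l\<in>A. f i l * u' j l) = (\<Sum>l\<in>A. f i l * u j l - a j * (f i l * w l))"
      using False by (intro sum.cong) (auto simp: u'_def algebra_simps)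
    also have "\<dots> = (\<Sum>l\<in>A. f i l * u j l) - a j * (\<Sum>l\<in>A. f i l * w l)"
      by (simp add: sum_subtractf sum_distrib_left)
    finally show ?thesis
      using that False fw_low fw_r u by (auto simp: less_Suc_eq a_def)
  qed
  ultimately show ?case
    by blast
qed

context
  fixes C :: "'k::field mat" and g e r :: nat and \<upsilon> :: "nat \<Rightarrow> 'k vec \<Rightarrow> 'k"
  assumes C: "C \<in> carrier_mat g e" and \<upsilon>: "dual_space_basis (mat_image C) r \<upsilon>"
begin

lemma linear_form_mult_vec:
  assumes "linear_form (mat_image C) h"
  shows "h (C *\<^sub>v vec e u) = (\<Sum>l<e. h (s_eps C l) * u l)"
proof -
  have im: "C *\<^sub>v vec e w \<in> mat_image C" for w
    by (simp add: mat_image_eq[OF C])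
  have add: "h (v + w) = h v + h w" if "v \<in> mat_image C" "w \<in> mat_image C" for v w
    using assms that unfolding linear_form_def by blast
  have scale: "h (a \<cdot>\<^sub>v v) = a * h v" if "v \<in> mat_image C" for a v
    using assms that unfolding linear_form_def by blast
  have "h (C *\<^sub>v vec e (\<lambda>l. if l < m then u l else 0)) = (\<Sum>l<m. h (s_eps C l) * u l)"
    if "m \<le> e" for m
    using that
  proof (induction m)
    case 0
    have z: "0 \<cdot>\<^sub>v (C *\<^sub>v vec e (\<lambda>_. 0)) = C *\<^sub>v vec e (\<lambda>_. 0)"
      using C by (intro eq_vecI) (auto simp: mult_mat_vec_index[OF C] simp del: index_mult_mat_vec)
    then show ?case
      using scale[OF im, of 0 "\<lambda>_. 0"] unfolding z by simp
  next
    case (Suc m)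
    have m: "m < e"
      using Suc.prems by simp
    have s: "u m \<cdot>\<^sub>v s_eps C m = C *\<^sub>v vec e (\<lambda>l. if l = m then u m else 0)"
    proof (rule eq_vecI)
      fix k assume "k < dim_vec (C *\<^sub>v vec e (\<lambda>l. if l = m then u m else 0))"
      then have k: "k < g"
        using C by simp
      have "(C *\<^sub>v vec e (\<lambda>l. if l = m then u m else 0)) $ k = (\<Sum>l<e. if l = m then C $$ (k, m) * u m else 0)"
        unfolding mult_mat_vec_index[OF C k] by (intro sum.cong) auto
      then show "(u m \<cdot>\<^sub>v s_eps C m) $ k = (C *\<^sub>v vec e (\<lambda>l. if l = m then u m else 0)) $ k"
        using C k m by (simp add: s_eps_def scalar_prod_right_unit mult.commute del: index_mult_mat_vec)
          (simp add: scalar_prod_right_unit)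
    qed (use C in \<open>simp add: s_eps_def\<close>)
    have split: "C *\<^sub>v vec e (\<lambda>l. if l < Suc m then u l else 0)
        = C *\<^sub>v vec e (\<lambda>l. if l < m then u l else 0) + u m \<cdot>\<^sub>v s_eps C m"
    proof -
      have sum: "vec e (\<lambda>l. if l < Suc m then u l else 0)
          = vec e (\<lambda>l. if l < m then u l else 0) + vec e (\<lambda>l. if l = m then u m else 0)"
        by (rule eq_vecI) (simp_all add: less_Suc_eq)
      show ?thesis
        unfolding s sum by (intro mult_add_distrib_mat_vec[OF C] vec_carrier)
    qed
    have sm: "s_eps C m \<in> mat_image C"
    proof -
      have "s_eps C m = C *\<^sub>v unit_vec (dim_col C) m"
        by (simp add: s_eps_def)
      moreover have "unit_vec (dim_col C) m \<in> carrier_vec (dim_col C)"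
        by simp
      ultimately show ?thesis
        unfolding mat_image_def by blast
    qed
    have "u m \<cdot>\<^sub>v s_eps C m \<in> mat_image C"
      unfolding s by (rule im)
    then have "h (C *\<^sub>v vec e (\<lambda>l. if l < Suc m then u l else 0))
        = h (C *\<^sub>v vec e (\<lambda>l. if l < m then u l else 0)) + u m * h (s_eps C m)"
      unfolding split by (simp only: add[OF im] scale[OF sm])
    then show ?case
      using Suc by simp
  qed
  from this[of e] have "h (C *\<^sub>v vec e (\<lambda>l. if l < e then u l else 0)) = (\<Sum>l<e. h (s_eps C l) * u l)"
    by simp
  moreover have "vec e (\<lambda>l. if l < e then u l else 0) = vec e u"
    by auto
  ultimately show ?thesis
    by simp
qed

text \<open>
  The coordinate functions of the ambient space are linear forms on the image, hence combinations of
  the \<open>\<upsilon>\<^sub>j\<close>; therefore the \<open>\<upsilon>\<^sub>j\<close> separate the points of the image.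
\<close>

lemma mult_vec_eq_0_iff:
  "C *\<^sub>v vec e u = 0\<^sub>v g \<longleftrightarrow> (\<forall>j<r. (\<Sum>l<e. \<upsilon> j (s_eps C l) * u l) = 0)"
proof
  have lin: "linear_form (mat_image C) (\<upsilon> j)" if "j < r" for j
    using \<upsilon> that by (simp add: dual_space_basis_def)
  show "\<forall>j<r. (\<Sum>l<e. \<upsilon> j (s_eps C l) * u l) = 0" if z: "C *\<^sub>v vec e u = 0\<^sub>v g"
  proof (intro allI impI)
    fix j assume j: "j < r"
    have "C *\<^sub>v vec e u = C *\<^sub>v vec e (\<lambda>_. 0)"
      unfolding z using C by (intro eq_vecI) (auto simp: mult_mat_vec_index[OF C] simp del: index_mult_mat_vec)
    then have "\<upsilon> j (C *\<^sub>v vec e u) = \<upsilon> j (C *\<^sub>v vec e (\<lambda>_. 0))"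
      by simp
    then show "(\<Sum>l<e. \<upsilon> j (s_eps C l) * u l) = 0"
      unfolding linear_form_mult_vec[OF lin[OF j]] by simp
  qed
  assume z: "\<forall>j<r. (\<Sum>l<e. \<upsilon> j (s_eps C l) * u l) = 0"
  show "C *\<^sub>v vec e u = 0\<^sub>v g"
  proof (rule eq_vecI)
    fix k assume "k < dim_vec (0\<^sub>v g :: 'k vec)"
    then have k: "k < g"
      by simp
    have dim: "dim_vec v = g" if "v \<in> mat_image C" for v
      using that C by (auto simp: mat_image_def)
    have "linear_form (mat_image C) (\<lambda>v. v $ k)"
      using k dim by (auto simp: linear_form_def)
    then obtain c where "\<forall>v\<in>mat_image C. v $ k = (\<Sum>j<r. c j * \<upsilon> j v)"
      using \<upsilon> unfolding dual_space_basis_def by metis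
    then have "(C *\<^sub>v vec e u) $ k = (\<Sum>j<r. c j * \<upsilon> j (C *\<^sub>v vec e u))"
      by (simp add: mat_image_eq[OF C])
    also have "\<dots> = 0"
      using z lin by (intro sum.neutral) (simp add: linear_form_mult_vec)
    finally show "(C *\<^sub>v vec e u) $ k = 0\<^sub>v g $ k"
      using k by simp
  qed (use C in simp)
qed

text \<open>
  If the forms are independent on the chosen columns, dual vectors supported on these columns produce
  a preimage of every vector of the image.  Conversely, a relation between the forms that holds on
  a spanning set of the image holds on all of it.
\<close>

lemma mat_image_cols_upto_eq_iff:
  "mat_image (cols_upto C dE \<alpha>) = mat_image C
    \<longleftrightarrow> forms_independent_on (basis_index_set e dE \<alpha>) r (\<lambda>j l. \<upsilon> j (s_eps C l))"
  (is "?I \<longleftrightarrow> forms_independent_on ?A r ?f")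
proof
  have lin: "linear_form (mat_image C) (\<upsilon> j)" if "j < r" for j
    using \<upsilon> that by (simp add: dual_space_basis_def)
  have A: "?A \<subseteq> {..<e}"
    by (auto simp: basis_index_set_def)
  assume I: ?I
  show "forms_independent_on ?A r ?f"
    unfolding forms_independent_on_def
  proof (intro allI impI)
    fix c j assume c: "\<forall>l\<in>?A. (\<Sum>j<r. c j * ?f j l) = 0" and j: "j < r"
    have "(\<Sum>j<r. c j * \<upsilon> j v) = 0" if "v \<in> mat_image C" for v
    proof -
      have "v \<in> {C *\<^sub>v vec e u |u. \<forall>l. u l \<noteq> 0 \<longrightarrow> l \<in> ?A}"
        using that I mat_image_cols_upto[OF C, of dE \<alpha>] by simp
      then obtain u where u: "v = C *\<^sub>v vec e u" "\<forall>l. u l \<noteq> 0 \<longrightarrow> l \<in> ?A"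
        by blast
      have "(\<Sum>j<r. c j * \<upsilon> j v) = (\<Sum>j<r. \<Sum>l<e. c j * ?f j l * u l)"
        unfolding u(1) by (intro sum.cong refl)
          (simp add: linear_form_mult_vec[OF lin] sum_distrib_left mult.assoc)
      also have "\<dots> = (\<Sum>l<e. (\<Sum>j<r. c j * ?f j l) * u l)"
        by (subst sum.swap) (simp add: sum_distrib_right)
      also have "\<dots> = 0"
      proof (intro sum.neutral ballI)
        fix l
        show "(\<Sum>j<r. c j * ?f j l) * u l = 0"
          using c u(2) by (cases "l \<in> ?A") auto
      qed
      finally show ?thesis .
    qed
    then show "c j = 0"
      using \<upsilon> j unfolding dual_space_basis_def by blast
  qed
next
  assume "forms_independent_on ?A r ?f"
  then obtain u where u_props: "(\<forall>j l. u j l \<noteq> 0 \<longrightarrow> l \<in> ?A) \<and>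
      (\<forall>i<r. \<forall>j<r. (\<Sum>l\<in>?A. ?f i l * u j l) = (if i = j then 1 else 0))"
    using forms_independent_on_dual_vectors[of ?A r ?f] by auto
  then have u0: "\<And>j l. u j l \<noteq> 0 \<Longrightarrow> l \<in> ?A"
    and u: "\<And>i j. i < r \<Longrightarrow> j < r \<Longrightarrow> (\<Sum>l\<in>?A. ?f i l * u j l) = (if i = j then 1 else 0)"
    by blast+
  have u_all: "(\<Sum>l<e. ?f i l * u j l) = (if i = j then 1 else 0)" if "i < r" "j < r" for i j
  proof -
    have "(\<Sum>l<e. ?f i l * u j l) = (\<Sum>l\<in>?A. ?f i l * u j l)"
      using u0 by (intro sum.mono_neutral_right) (auto simp: basis_index_set_def)
    then show ?thesis
      using u[OF that] by simp
  qed
  show ?I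
  proof
    show "mat_image (cols_upto C dE \<alpha>) \<subseteq> mat_image C"
      by (auto simp: mat_image_cols_upto[OF C] mat_image_eq[OF C])
    show "mat_image C \<subseteq> mat_image (cols_upto C dE \<alpha>)"
    proof
      fix v assume "v \<in> mat_image C"
      then obtain w where v: "v = C *\<^sub>v vec e w"
        by (auto simp: mat_image_eq[OF C])
      define a where "a j = (\<Sum>l<e. ?f j l * w l)" for j
      define w' where "w' l = (\<Sum>k<r. a k * u k l)" for l
      have "(\<Sum>l<e. ?f j l * w' l) = a j" if "j < r" for j
      proof -
        have "(\<Sum>l<e. ?f j l * w' l) = (\<Sum>k<r. a k * (\<Sum>l<e. ?f j l * u k l))"
          unfolding w'_def sum_distrib_left by (subst sum.swap) (simp add: mult_ac)
        also have "\<dots> = (\<Sum>k<r. if j = k then a k else 0)"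
          using u_all that by (intro sum.cong) auto
        finally show ?thesis
          using that by simp
      qed
      then have "C *\<^sub>v vec e (\<lambda>l. w l - w' l) = 0\<^sub>v g"
        unfolding mult_vec_eq_0_iff by (simp add: right_diff_distrib sum_subtractf a_def)
      then have "(C *\<^sub>v vec e w) $ k = (C *\<^sub>v vec e w') $ k" if "k < g" for k
        using that mult_mat_vec_index[OF C that, of "\<lambda>l. w l - w' l"]
        by (simp add: mult_mat_vec_index[OF C] right_diff_distrib sum_subtractf)
      then have "v = C *\<^sub>v vec e w'"
        unfolding v using C by (intro eq_vecI) auto
      moreover have "l \<in> ?A" if "w' l \<noteq> 0" for l
      proof (rule ccontr)
        assume "l \<notin> ?A"
        then have "u k l = 0" for k
          using u0 by blast
        then show False
          using that by (simp add: w'_def)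
      qed
      ultimately show "v \<in> mat_image (cols_upto C dE \<alpha>)"
        unfolding mat_image_cols_upto[OF C] by blast
    qed
  qed
qed

end


section \<open>Degrees in the Taylor complex\<close>

lemma lookup_lcm_deg:
  assumes "finite I"
  shows "Poly_Mapping.lookup (lcm_deg d I) v = Max (insert 0 ((\<lambda>i. Poly_Mapping.lookup (d i) v) ` I))"
proof -
  have "{v. Max (insert 0 ((\<lambda>i. Poly_Mapping.lookup (d i) v) ` I)) \<noteq> 0} \<subseteq> (\<Union>i\<in>I. Poly_Mapping.keys (d i))"
  proof
    fix v assume v: "v \<in> {v. Max (insert 0 ((\<lambda>i. Poly_Mapping.lookup (d i) v) ` I)) \<noteq> 0}"
    have "Max (insert 0 ((\<lambda>i. Poly_Mapping.lookup (d i) v) ` I)) \<in> insert 0 ((\<lambda>i. Poly_Mapping.lookup (d i) v) ` I)"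
      using assms by (intro Max_in) auto
    then show "v \<in> (\<Union>i\<in>I. Poly_Mapping.keys (d i))"
      using v by (auto simp: in_keys_iff)
  qed
  then have "finite {v. Max (insert 0 ((\<lambda>i. Poly_Mapping.lookup (d i) v) ` I)) \<noteq> 0}"
    by (rule finite_subset) (use assms in simp)
  then show ?thesis
    unfolding lcm_deg_def by simp
qed

lemma lcm_deg_le_iff:
  assumes "finite I"
  shows "lcm_deg d I \<preceq> \<alpha> \<longleftrightarrow> (\<forall>i\<in>I. d i \<preceq> \<alpha>)"
  using assms by (auto simp: mdeg_le_def lookup_lcm_deg Max_le_iff)

lemma lcm_deg_in_mdegs:
  assumes "finite I" "\<And>i. i \<in> I \<Longrightarrow> d i \<in> mdegs n"
  shows "lcm_deg d I \<in> mdegs n"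
proof -
  have "v < n" if "Poly_Mapping.lookup (lcm_deg d I) v \<noteq> 0" for v
  proof (rule ccontr)
    assume "\<not> v < n"
    then have "Poly_Mapping.lookup (d i) v = 0" if "i \<in> I" for i
      using assms(2)[OF that] by (auto simp: mdegs_def in_keys_iff)
    then have eq: "insert 0 ((\<lambda>i. Poly_Mapping.lookup (d i) v) ` I) = {0}"
      by auto
    show False
      using that unfolding lookup_lcm_deg[OF assms(1)] eq by simp
  qed
  then show ?thesis
    by (auto simp: mdegs_def in_keys_iff)
qed

lemma finite_exponents: "finite (exponents r p)"
proof (rule finite_subset)
  show "exponents r p \<subseteq> {b. \<forall>j. (j \<in> {..<r} \<longrightarrow> b j \<in> {..p}) \<and> (j \<notin> {..<r} \<longrightarrow> b j = 0)}"
  proof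
    fix b assume b: "b \<in> exponents r p"
    then have "b j \<le> p" if "j < r" for j
      using member_le_sum[of j "{..<r}" b] that by (simp add: exponents_def)
    then show "b \<in> {b. \<forall>j. (j \<in> {..<r} \<longrightarrow> b j \<in> {..p}) \<and> (j \<notin> {..<r} \<longrightarrow> b j = 0)}"
      using b by (auto simp: exponents_def)
  qed
qed (intro finite_set_of_finite_funs; simp)

lemma exponents_0: "exponents r 0 = {\<lambda>_. 0}"
proof
  show "exponents r 0 \<subseteq> {\<lambda>_. 0}"
  proof
    fix b assume b: "b \<in> exponents r 0"
    have "b j = 0" for j
      using b by (cases "j < r") (auto simp: exponents_def)
    then show "b \<in> {\<lambda>_. 0}"
      by auto
  qed
qed (simp add: exponents_def)

lemma exponents_Suc_iff:
  assumes "j < r"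
  shows "b(j := Suc (b j)) \<in> exponents r (Suc p) \<longleftrightarrow> b \<in> exponents r p"
proof -
  have "(\<Sum>k<r. (b(j := Suc (b j))) k) = Suc (\<Sum>k<r. b k)"
    using assms by (simp add: sum.remove[of "{..<r}" j])
  then show ?thesis
    using assms by (auto simp: exponents_def)
qed

lemma finite_taylor_basis: "finite (taylor_basis e g r i)"
proof -
  have "{Tay b I |b I. b \<in> exponents r (i - 2) \<and> I \<subseteq> {..<e} \<and> card I = r + i - 1}
      \<subseteq> (\<lambda>(b, I). Tay b I) ` (exponents r (i - 2) \<times> Pow {..<e})"
    by auto
  then have "finite {Tay b I |b I. b \<in> exponents r (i - 2) \<and> I \<subseteq> {..<e} \<and> card I = r + i - 1}"
    by (rule finite_subset) (simp add: finite_exponents)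
  then show ?thesis
    by (simp add: taylor_basis_def)
qed

lemma Tay_in_taylor_basis_iff:
  "2 \<le> i \<Longrightarrow> Tay b I \<in> taylor_basis e g r i
    \<longleftrightarrow> b \<in> exponents r (i - 2) \<and> I \<subseteq> {..<e} \<and> card I = r + i - 1"
  by (auto simp: taylor_basis_def)

lemma taylor_basis_cases:
  assumes "2 \<le> i" "x \<in> taylor_basis e g r i"
  obtains b I where "x = Tay b I" "b \<in> exponents r (i - 2)" "I \<subseteq> {..<e}" "finite I" "card I = r + i - 1"
  using assms finite_subset[of _ "{..<e}"] by (auto simp: taylor_basis_def)

text \<open>
  The scalars of the first differential, indexed by basis elements like those of the other ones.  The
  guard replaces the undefined entries below the last row by zero.
\<close>

fun entry_coeff :: "'k::field mat \<Rightarrow> gen \<Rightarrow> gen \<Rightarrow> 'k" where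
  "entry_coeff C (Eps l) (Gam k) = (if k < dim_row C then C $$ (k, l) else 0)"
| "entry_coeff C _ _ = 0"

definition taylor_coeff :: "'k::field mat \<Rightarrow> nat \<Rightarrow> (nat \<Rightarrow> 'k vec \<Rightarrow> 'k) \<Rightarrow> nat \<Rightarrow> gen \<Rightarrow> gen \<Rightarrow> 'k" where
  "taylor_coeff C r \<upsilon> i = (if i = 1 then entry_coeff C else taylor_s C r \<upsilon> i)"

text \<open>
  Only the coefficient matrix of the morphism is kept; \<open>entries\<close> is what remains of the condition
  that the morphism preserves multidegrees.
\<close>

locale taylor_complex =
  fixes n e g r :: nat and dE dG :: "nat \<Rightarrow> mdeg"
    and C :: "'k::field mat" and \<upsilon> :: "nat \<Rightarrow> 'k vec \<Rightarrow> 'k"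
  assumes dE: "l < e \<Longrightarrow> dE l \<in> mdegs n" and dG: "k < g \<Longrightarrow> dG k \<in> mdegs n"
    and C: "C \<in> carrier_mat g e" and r: "r = mat_rank C"
    and entries: "k < g \<Longrightarrow> l < e \<Longrightarrow> C $$ (k, l) \<noteq> 0 \<Longrightarrow> dG k \<preceq> dE l"
    and \<upsilon>: "dual_space_basis (mat_image C) r \<upsilon>"
begin

abbreviation "deg \<equiv> gen_deg dE dG"
abbreviation "T \<equiv> taylor_basis e g r"
abbreviation "f \<equiv> \<lambda>j l. \<upsilon> j (s_eps C l)"
abbreviation "d i \<equiv> lin_ext (T i) (taylor_coeff C r \<upsilon> i)"
abbreviation "A \<equiv> basis_index_set e dE"
abbreviation "\<iota> \<equiv> \<lambda>j. contract {..<e} (f j)"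

lemma deg_in_mdegs: "deg ` T i \<subseteq> mdegs n"
proof
  fix \<alpha> assume "\<alpha> \<in> deg ` T i"
  then obtain x where x: "x \<in> T i" "\<alpha> = deg x"
    by blast
  show "\<alpha> \<in> mdegs n"
  proof (cases "2 \<le> i")
    case True
    then obtain b I where "x = Tay b I" "I \<subseteq> {..<e}" "finite I"
      using x(1) by (rule taylor_basis_cases)
    then show ?thesis
      using x(2) dE by (auto intro!: lcm_deg_in_mdegs)
  next
    case False
    then have "i = 0 \<or> i = 1"
      by auto
    then show ?thesis
      using x dE dG by (auto simp: taylor_basis_def)
  qed
qed

lemma taylor_s_nonzeroD:
  assumes "taylor_s C r \<upsilon> i (Tay b I) c \<noteq> 0"
  obtains l where "i = 2" "l \<in> I" "c = Eps l"
  | j l where "i \<noteq> 2" "j < r" "l \<in> I" "0 < b j" "c = Tay (b(j := b j - 1)) (I - {l})"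
proof (cases "i = 2")
  case True
  then have "\<exists>l\<in>I. c = Eps l"
    using assms by (intro ccontr[of "\<exists>l\<in>I. c = Eps l"]) (simp add: sum.neutral)
  then show ?thesis
    using True that(1) by blast
next
  case False
  have "\<exists>j<r. \<exists>l\<in>I. 0 < b j \<and> c = Tay (b(j := b j - 1)) (I - {l})"
  proof (rule ccontr)
    assume H: "\<not> ?thesis"
    have "taylor_s C r \<upsilon> i (Tay b I) c = 0"
      using False H by (auto intro!: sum.neutral)
    then show False
      using assms by blast
  qed
  then show ?thesis
    using False that(2) by blast
qed

lemma taylor_coeff_nonzero:
  assumes "1 \<le> i" "x \<in> T i" "taylor_coeff C r \<upsilon> i x c \<noteq> 0"
  shows "deg c \<preceq> deg x" and "c \<in> T (i - 1)"
proof -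
  have "deg c \<preceq> deg x \<and> c \<in> T (i - 1)"
  proof (cases "i = 1")
    case True
    then obtain l where l: "l < e" "x = Eps l"
      using assms(2) by (auto simp: taylor_basis_def)
    then show ?thesis
      using assms(3) True C entries by (cases c) (auto simp: taylor_coeff_def taylor_basis_def split: if_splits)
  next
    case False
    then have i: "2 \<le> i"
      using assms(1) by simp
    obtain b I where x: "x = Tay b I" "b \<in> exponents r (i - 2)" "I \<subseteq> {..<e}" "finite I" "card I = r + i - 1"
      using i assms(2) by (rule taylor_basis_cases)
    have "taylor_s C r \<upsilon> i (Tay b I) c \<noteq> 0"
      using assms(3) False x(1) by (simp add: taylor_coeff_def)
    then show ?thesis
    proof (cases rule: taylor_s_nonzeroD)
      case (1 l)
      then show ?thesis
        using x lcm_deg_le_iff[of I dE "lcm_deg dE I"] by (auto simp: taylor_basis_def)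
    next
      case (2 j l)
      then have i3: "2 \<le> i - 1"
        using i by simp
      define p where "p = i - 3"
      have p: "i - 2 = Suc p" "i - 1 - 2 = p"
        using i3 by (auto simp: p_def)
      have "(b(j := b j - 1))(j := Suc ((b(j := b j - 1)) j)) = b"
        using 2 by auto
      then have "b(j := b j - 1) \<in> exponents r p"
        using exponents_Suc_iff[OF \<open>j < r\<close>, of "b(j := b j - 1)" p] x(2) unfolding p by simp
      moreover have "card (I - {l}) = r + (i - 1) - 1"
        using 2 x i3 by (simp add: card_Diff_singleton)
      ultimately have "c \<in> T (i - 1)"
        using 2(5) x(3) Tay_in_taylor_basis_iff[OF i3] unfolding p by auto
      moreover have "deg c \<preceq> deg x"
        using 2(5) x lcm_deg_le_iff[of "I - {l}" dE "lcm_deg dE I"] lcm_deg_le_iff[of I dE "lcm_deg dE I"]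
        by auto
      ultimately show ?thesis
        by blast
    qed
  qed
  then show "deg c \<preceq> deg x" "c \<in> T (i - 1)"
    by blast+
qed

lemma d_in_strand:
  assumes "1 \<le> i" "z \<in> strand deg \<alpha> (T i)"
  shows "d i z \<in> strand deg \<alpha> (T (i - 1))"
  unfolding strand_def supported_on_def
proof (intro CollectI allI impI)
  fix c assume nz: "d i z c \<noteq> 0"
  have "\<exists>x\<in>T i. taylor_coeff C r \<upsilon> i x c * z x \<noteq> 0"
  proof (rule ccontr)
    assume "\<not> ?thesis"
    then have "d i z c = 0"
      unfolding lin_ext_def by (intro sum.neutral) blast
    then show False
      using nz by blast
  qed
  then obtain x where x: "x \<in> T i" "taylor_coeff C r \<upsilon> i x c \<noteq> 0" "z x \<noteq> 0"
    by auto
  have "deg x \<preceq> \<alpha>"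
    using assms(2) x(3) by (simp add: strand_def supported_on_def)
  then show "c \<in> T (i - 1) \<and> deg c \<preceq> \<alpha>"
    using taylor_coeff_nonzero[OF assms(1) x(1,2)] mdeg_le_trans by blast
qed

section \<open>The differentials in terms of contractions\<close>

text \<open>
  For a fixed divided power monomial \<open>b\<close>, the coefficients form an element of the exterior algebra.
\<close>

definition slice :: "(gen \<Rightarrow> 'k) \<Rightarrow> (nat \<Rightarrow> nat) \<Rightarrow> nat set \<Rightarrow> 'k" where
  "slice z b = (\<lambda>I. z (Tay b I))"

text \<open>
  A summand of \<open>s\<^sub>i\<close> leads to \<open>Tay b K\<close> only from \<open>b\<close> with one entry raised and from \<open>K\<close> with one
  element inserted.
\<close>

lemma d_Tay:
  assumes i: "3 \<le> i" and z: "supported_on (T i) z"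
  shows "d i z (Tay b K) = (\<Sum>j<r. \<iota> j (slice z (b(j := Suc (b j)))) K)"
proof -
  let ?x = "\<lambda>j l. Tay (b(j := Suc (b j))) (insert l K)"
  have "taylor_coeff C r \<upsilon> i x (Tay b K) * z x
      = (\<Sum>j<r. \<Sum>l<e. if x = ?x j l then (if l \<in> K then 0 else f j l * (sgn_ins l K * z x)) else 0)"
    if xT: "x \<in> T i" for x
  proof -
    have "2 \<le> i" using i by simp
    then obtain b' I where x: "x = Tay b' I" "I \<subseteq> {..<e}" "finite I"
      using xT by (rule taylor_basis_cases)
    have "taylor_coeff C r \<upsilon> i x (Tay b K) * z x
        = (\<Sum>j<r. \<Sum>l\<in>I. (if 0 < b' j
           then sgn_ins l (I - {l}) * f j l * of_bool (Tay b K = Tay (b'(j := b' j - 1)) (I - {l}))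
           else 0) * z x)"
      using i by (simp add: taylor_coeff_def x(1) sum_distrib_right)
    also have "\<dots> = (\<Sum>j<r. \<Sum>l<e. if x = ?x j l then (if l \<in> K then 0 else f j l * (sgn_ins l K * z x)) else 0)"
    proof (rule sum.cong[OF refl], rule sum.mono_neutral_cong_left)
      fix j l assume l: "l \<in> I"
      have b': "0 < b' j \<and> b = b'(j := b' j - 1) \<longleftrightarrow> b' = b(j := Suc (b j))"
        by auto
      have I: "K = I - {l} \<longleftrightarrow> I = insert l K \<and> l \<notin> K"
        using l by auto
      show "(if 0 < b' j
           then sgn_ins l (I - {l}) * f j l * of_bool (Tay b K = Tay (b'(j := b' j - 1)) (I - {l}))
           else 0) * z x
          = (if x = ?x j l then (if l \<in> K then 0 else f j l * (sgn_ins l K * z x)) else 0)"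
      proof (cases "b' = b(j := Suc (b j)) \<and> I = insert l K \<and> l \<notin> K")
        case True
        then show ?thesis
          using b' I by (simp add: x(1) sgn_ins_remove)
      next
        case False
        then show ?thesis
          using b' I by (auto simp: x(1))
      qed
    qed (use x in auto)
    finally show ?thesis .
  qed
  then have "d i z (Tay b K)
      = (\<Sum>x\<in>T i. \<Sum>j<r. \<Sum>l<e. if x = ?x j l then (if l \<in> K then 0 else f j l * (sgn_ins l K * z x)) else 0)"
    unfolding lin_ext_def by (intro sum.cong) auto
  also have "\<dots> = (\<Sum>j<r. \<Sum>l<e. \<Sum>x\<in>T i. if x = ?x j l then (if l \<in> K then 0 else f j l * (sgn_ins l K * z x)) else 0)"
    by (subst sum.swap, intro sum.cong refl, rule sum.swap)
  also have "\<dots> = (\<Sum>j<r. \<Sum>l<e. f j l * annihilate l (slice z (b(j := Suc (b j)))) K)"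
  proof (intro sum.cong refl)
    fix j l
    have "z (?x j l) = 0" if "?x j l \<notin> T i"
      using z that unfolding supported_on_def by blast
    then show "(\<Sum>x\<in>T i. if x = ?x j l then (if l \<in> K then 0 else f j l * (sgn_ins l K * z x)) else 0)
        = f j l * annihilate l (slice z (b(j := Suc (b j)))) K"
      by (simp add: finite_taylor_basis annihilate_def slice_def)
  qed
  finally show ?thesis
    by (simp add: contract_def)
qed

lemma form_minor_eq_minor_det: "minor_det C r \<upsilon> K = form_minor f r K"
  by (simp add: minor_det_def form_minor_def)

abbreviation "contraction_sign \<equiv> (- 1) ^ r * reversal_sign r"

lemma contraction_sign_sq: "contraction_sign * (contraction_sign * x) = (x :: 'k)"
  by (simp add: reversal_sign_def mult.assoc[symmetric] power_add[symmetric] mult_2[symmetric]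
      flip: power_add)

text \<open>
  A set \<open>I\<close> with \<open>r + 1\<close> elements, one of them \<open>l\<close>, corresponds to the set \<open>L = I - {l}\<close> with \<open>r\<close>
  elements, and the sign in \<open>s\<^sub>2\<close> is the one of the contraction with the \<open>l\<close>-th coordinate form.
\<close>

lemma d_Eps:
  assumes z: "supported_on (T 2) z"
  shows "d 2 z (Eps l) = (\<Sum>L | L \<subseteq> {..<e} \<and> card L = r.
      form_minor f r L * annihilate l (slice z (\<lambda>_. 0)) L)"
proof -
  let ?P = "{L. L \<subseteq> {..<e} \<and> card L = r}"
  let ?t = "\<lambda>L x. if x = Tay (\<lambda>_. 0) (insert l L) then (if l \<in> L then 0 else form_minor f r L * (sgn_ins l L * z x)) else 0"
  have finP: "finite ?P"
    by (rule finite_subset[of _ "Pow {..<e}"]) auto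
  have "taylor_coeff C r \<upsilon> 2 x (Eps l) * z x = (\<Sum>L\<in>?P. ?t L x)" if xT: "x \<in> T 2" for x
  proof -
    obtain I where x: "x = Tay (\<lambda>_. 0) I" "I \<subseteq> {..<e}" "finite I" "card I = r + 1"
    proof -
      obtain b I where "x = Tay b I" "b \<in> exponents r (2 - 2)" "I \<subseteq> {..<e}" "finite I" "card I = r + 2 - 1"
        using order_refl xT by (rule taylor_basis_cases)
      then show thesis
        using that[of I] by (simp add: exponents_0)
    qed
    have "taylor_coeff C r \<upsilon> 2 x (Eps l)
        = (\<Sum>k\<in>I. if k = l then sgn_ins l I * form_minor f r (I - {l}) else 0)"
      unfolding taylor_coeff_def x(1)
      by simp (intro sum.cong refl, simp add: form_minor_eq_minor_det sgn_ins_remove)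
    also have "\<dots> = (if l \<in> I then sgn_ins l I * form_minor f r (I - {l}) else 0)"
      using x(3) by simp
    finally have lhs: "taylor_coeff C r \<upsilon> 2 x (Eps l) = \<dots>" .
    have "(\<Sum>L\<in>?P. ?t L x) = (\<Sum>L\<in>?P. if L = I - {l} then (if l \<in> I then form_minor f r L * (sgn_ins l I * z x) else 0) else 0)"
    proof (intro sum.cong refl)
      fix L
      show "?t L x = (if L = I - {l} then (if l \<in> I then form_minor f r L * (sgn_ins l I * z x) else 0) else 0)"
      proof (cases "I = insert l L \<and> l \<notin> L")
        case True
        then have "L = I - {l}" "l \<in> I"
          by auto
        then show ?thesis
          using True by (simp add: x(1) sgn_ins_insert)
      next
        case False
        then have "?t L x = 0"
          by (simp add: x(1))
        moreover have "\<not> (L = I - {l} \<and> l \<in> I)"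
          using False by blast
        ultimately show ?thesis
          by (simp only: if_False de_Morgan_conj split: if_split) blast
      qed
    qed
    also have "\<dots> = (if I - {l} \<in> ?P then (if l \<in> I then form_minor f r (I - {l}) * (sgn_ins l I * z x) else 0) else 0)"
      using finP by (simp only: sum.delta)
    also have "\<dots> = (if l \<in> I then form_minor f r (I - {l}) * (sgn_ins l I * z x) else 0)"
    proof -
      have "I - {l} \<in> ?P" if "l \<in> I"
        using x(2,4) card_Diff_singleton[OF that] by auto
      then show ?thesis
        by simp
    qed
    finally show ?thesis
      unfolding lhs by (simp add: mult_ac)
  qed
  then have "d 2 z (Eps l) = (\<Sum>x\<in>T 2. \<Sum>L\<in>?P. ?t L x)"
    unfolding lin_ext_def by (intro sum.cong) auto
  also have "\<dots> = (\<Sum>L\<in>?P. \<Sum>x\<in>T 2. ?t L x)"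
    by (rule sum.swap)
  also have "\<dots> = (\<Sum>L\<in>?P. form_minor f r L * annihilate l (slice z (\<lambda>_. 0)) L)"
  proof (intro sum.cong refl)
    fix L
    have "z (Tay (\<lambda>_. 0) (insert l L)) = 0" if "Tay (\<lambda>_. 0) (insert l L) \<notin> T 2"
      using z that unfolding supported_on_def by blast
    then show "(\<Sum>x\<in>T 2. ?t L x) = form_minor f r L * annihilate l (slice z (\<lambda>_. 0)) L"
      by (simp add: finite_taylor_basis annihilate_def slice_def)
  qed
  finally show ?thesis .
qed

lemma d_Eps_contraction:
  assumes "supported_on (T 2) z"
  shows "d 2 z (Eps l) = contraction_sign * iterated_contraction \<iota> r (slice z (\<lambda>_. 0)) {l}"
  by (simp only: d_Eps[OF assms] iterated_contraction_at_singleton[OF finite_lessThan] contraction_sign_sq)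

lemma d_Gam:
  "d 1 z (Gam k) = (if k < g then (C *\<^sub>v vec e (\<lambda>l. z (Eps l))) $ k else 0)"
proof -
  have "d 1 z (Gam k) = (\<Sum>l<e. (if k < g then C $$ (k, l) else 0) * z (Eps l))"
    using C by (simp add: lin_ext_def taylor_coeff_def taylor_basis_def sum.reindex inj_on_def)
  then show ?thesis
    by (simp add: mult_mat_vec_index[OF C] del: index_mult_mat_vec)
qed

lemma d_other:
  assumes "1 \<le> i" "c \<notin> T (i - 1)"
  shows "d i z c = 0"
  unfolding lin_ext_def using taylor_coeff_nonzero(2)[OF assms(1)] assms(2)
  by (intro sum.neutral) auto

lemma d_1_eq_0_iff: "d 1 z = (\<lambda>_. 0) \<longleftrightarrow> C *\<^sub>v vec e (\<lambda>l. z (Eps l)) = 0\<^sub>v g"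
proof
  assume d: "d 1 z = (\<lambda>_. 0)"
  show "C *\<^sub>v vec e (\<lambda>l. z (Eps l)) = 0\<^sub>v g"
  proof (rule eq_vecI)
    fix k assume "k < dim_vec (0\<^sub>v g :: 'k vec)"
    then show "(C *\<^sub>v vec e (\<lambda>l. z (Eps l))) $ k = 0\<^sub>v g $ k"
      using fun_cong[OF d, of "Gam k"] unfolding d_Gam by simp
  qed (use C in simp)
next
  assume eq: "C *\<^sub>v vec e (\<lambda>l. z (Eps l)) = 0\<^sub>v g"
  show "d 1 z = (\<lambda>_. 0)"
  proof
    fix c
    show "d 1 z c = 0"
    proof (cases "c \<in> T 0")
      case True
      then obtain k where "c = Gam k" "k < g"
        by (auto simp: taylor_basis_def)
      then show ?thesis
        unfolding \<open>c = Gam k\<close> d_Gam eq by simp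
    qed (simp add: d_other)
  qed
qed

end


section \<open>Exactness of the strands\<close>

lemma sum_fun_apply: "(\<Sum>j\<in>N. F j) K = (\<Sum>j\<in>N. F j K)"
  by (induction N rule: infinite_finite_induct) auto

lemma contract_at_empty: "contract N h F {} = (\<Sum>l\<in>N. h l * F {l})"
  by (simp add: contract_def annihilate_def)

lemma iterated_contraction_in_ext_power:
  assumes "finite B" "F \<in> ext_power B (q + m)"
  shows "iterated_contraction (\<lambda>j. contract N (h j)) m F \<in> ext_power B q"
  using assms(2)
proof (induction m arbitrary: F)
  case (Suc m)
  then have "contract N (h m) F \<in> ext_power B (q + m)"
    using contract_in_ext_power[OF assms(1)] by simp
  then show ?case
    using Suc.IH by simp
qed simp

lemma iterated_product_in_ext_power:
  assumes "finite B" "F \<in> ext_power B q" "\<And>j l. u j l \<noteq> 0 \<Longrightarrow> l \<in> B"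
  shows "iterated_product (\<lambda>j. wedge N (u j)) m F \<in> ext_power B (q + m)"
  using assms(2)
proof (induction m)
  case (Suc m)
  then show ?case
    using wedge_in_ext_power[OF assms(1), of _ "q + m" "u m"] assms(3) by simp
qed simp

context taylor_complex
begin

lemma strand_supported: "z \<in> strand deg \<alpha> (T i) \<Longrightarrow> supported_on (T i) z"
  by (auto simp: strand_def supported_on_def)

lemma strand_1_iff:
  "z \<in> strand deg \<alpha> (T 1) \<longleftrightarrow> supported_on (Eps ` A \<alpha>) z"
proof -
  have "{x \<in> T 1. deg x \<preceq> \<alpha>} = Eps ` A \<alpha>"
    by (auto simp: taylor_basis_def basis_index_set_def)
  then show ?thesis
    by (simp add: strand_def)
qed

lemma strand_TayD:
  assumes "2 \<le> i" "z \<in> strand deg \<alpha> (T i)" "z x \<noteq> 0"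
  obtains b I where "x = Tay b I" "b \<in> exponents r (i - 2)" "I \<subseteq> A \<alpha>" "card I = r + i - 1"
proof -
  have x: "x \<in> T i" "deg x \<preceq> \<alpha>"
    using assms(2,3) by (auto simp: strand_def supported_on_def)
  obtain b I where bI: "x = Tay b I" "b \<in> exponents r (i - 2)" "I \<subseteq> {..<e}" "finite I" "card I = r + i - 1"
    using assms(1) x(1) by (rule taylor_basis_cases)
  have "I \<subseteq> A \<alpha>"
    using x(2) bI(1,3) lcm_deg_le_iff[OF bI(4)] by (auto simp: basis_index_set_def)
  then show thesis
    using bI that by blast
qed

lemma slice_in_ext_power:
  assumes "2 \<le> i" "z \<in> strand deg \<alpha> (T i)"
  shows "slice z b \<in> ext_power (A \<alpha>) (r + i - 1)"
  unfolding ext_power_def slice_def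
proof (intro CollectI allI impI)
  fix I assume "z (Tay b I) \<noteq> 0"
  then obtain b' I' where "Tay b I = Tay b' I'" "I' \<subseteq> A \<alpha>" "card I' = r + i - 1"
    using strand_TayD[OF assms] by metis
  then show "I \<subseteq> A \<alpha> \<and> card I = r + i - 1"
    by simp
qed

lemma slice_eq_0:
  assumes "2 \<le> i" "z \<in> strand deg \<alpha> (T i)" "b \<notin> exponents r (i - 2)"
  shows "slice z b = 0"
proof
  fix I
  show "slice z b I = 0 I"
  proof (rule ccontr)
    assume "slice z b I \<noteq> 0 I"
    then have "z (Tay b I) \<noteq> 0"
      by (simp add: slice_def)
    then obtain b' I' where "Tay b I = Tay b' I'" "b' \<in> exponents r (i - 2)"
      using strand_TayD[OF assms(1,2)] by metis
    then show False
      using assms(3) by simp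
  qed
qed

definition unslice :: "((nat \<Rightarrow> nat) \<Rightarrow> nat set \<Rightarrow> 'k) \<Rightarrow> gen \<Rightarrow> 'k" where
  "unslice Y x = (case x of Tay b I \<Rightarrow> Y b I | _ \<Rightarrow> 0)"

lemma slice_unslice [simp]: "slice (unslice Y) b = Y b"
  by (simp add: slice_def unslice_def)

lemma unslice_in_strand:
  assumes i: "2 \<le> i" and Y: "\<And>b. b \<in> exponents r (i - 2) \<Longrightarrow> Y b \<in> ext_power (A \<alpha>) (r + i - 1)"
    and Y0: "\<And>b. b \<notin> exponents r (i - 2) \<Longrightarrow> Y b = 0"
  shows "unslice Y \<in> strand deg \<alpha> (T i)"
  unfolding strand_def supported_on_def
proof (intro CollectI allI impI)
  fix x assume nz: "unslice Y x \<noteq> 0"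
  then obtain b I where x: "x = Tay b I" "Y b I \<noteq> 0"
    by (cases x) (auto simp: unslice_def)
  have b: "b \<in> exponents r (i - 2)"
    using Y0 x(2) by (metis zero_fun_apply)
  then have I: "I \<subseteq> A \<alpha>" "card I = r + i - 1"
    using Y x(2) unfolding ext_power_def by blast+
  have "finite I"
    using finite_subset[OF I(1) finite_basis_index_set] .
  moreover have "I \<subseteq> {..<e}"
    using I(1) by (auto simp: basis_index_set_def)
  ultimately show "x \<in> T i \<and> deg x \<preceq> \<alpha>"
    using b I x(1) i by (auto simp: Tay_in_taylor_basis_iff lcm_deg_le_iff basis_index_set_def)
qed

lemma slice_d:
  assumes "3 \<le> i" "supported_on (T i) z"
  shows "slice (d i z) b = (\<Sum>j<r. \<iota> j (slice z (b(j := Suc (b j)))))"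
  by (rule ext) (simp add: slice_def[of "d i z"] d_Tay[OF assms] sum_fun_apply)

text \<open>
  At \<open>E\<close> and at the term above it, the reason is that an iterated contraction is killed by, and kills,
  every single contraction.
\<close>

lemma d_d_eq_0:
  assumes i: "1 \<le> i" and z: "z \<in> strand deg \<alpha> (T (i + 1))"
  shows "d i (d (i + 1) z) = (\<lambda>_. 0)"
proof -
  interpret contractions r \<iota>
    by (rule contractions_contract) simp
  have sup: "supported_on (T (i + 1)) z"
    using z by (rule strand_supported)
  have sup': "supported_on (T i) (d (i + 1) z)"
    using d_in_strand[OF _ z] strand_supported by simp
  consider "i = 1" | "i = 2" | "3 \<le> i"
    using i by linarith
  then show ?thesis
  proof cases
    case 1
    then have i2: "i + 1 = 2"
      by simp
    have "(\<Sum>l<e. f j l * d 2 z (Eps l)) = 0" if "j < r" for j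
    proof -
      let ?F = "iterated_contraction \<iota> r (slice z (\<lambda>_. 0))"
      have "(\<Sum>l<e. f j l * d 2 z (Eps l)) = contraction_sign * \<iota> j ?F {}"
        unfolding d_Eps_contraction[OF sup[unfolded i2]] contract_at_empty sum_distrib_left
        by (intro sum.cong refl) (simp only: mult_ac)
      then show ?thesis
        using contr_iterated_contraction[OF order_refl that] by simp
    qed
    then show ?thesis
      unfolding i2 unfolding 1 d_1_eq_0_iff mult_vec_eq_0_iff[OF C \<upsilon>] by blast
  next
    case 2
    then have i3: "i + 1 = 3"
      by simp
    interpret additive "iterated_contraction \<iota> r"
      by (rule additive_iterated_contraction) simp
    have "iterated_contraction \<iota> r (slice (d 3 z) (\<lambda>_. 0)) = 0"
    proof -
      have "slice (d 3 z) (\<lambda>_. 0) = (\<Sum>j<r. \<iota> j (slice z ((\<lambda>_. 0)(j := Suc 0))))"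
        by (simp only: slice_d[OF order_refl sup[unfolded i3]])
      then show ?thesis
        using iterated_contraction_contr[OF order_refl] by (simp add: sum)
    qed
    then have "d 2 (d 3 z) (Eps l) = 0" for l
      using d_Eps_contraction[OF sup'[unfolded 2 i3[unfolded 2]]] by simp
    moreover have "d 2 (d 3 z) c = 0" if "c \<notin> range Eps" for c
      using that by (intro d_other) (auto simp: taylor_basis_def)
    ultimately have "d 2 (d 3 z) c = 0" for c
      by (cases "c \<in> range Eps") auto
    then show ?thesis
      unfolding i3 unfolding 2 by (rule ext)
  next
    case 3
    have "slice (d i (d (i + 1) z)) b = 0" for b
      unfolding slice_d[OF 3 sup'] slice_d[OF le_trans[OF 3 le_add1] sup]
      by (rule koszul_square_zero)
    then have "d i (d (i + 1) z) (Tay b K) = 0" for b K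
      by (metis slice_def zero_fun_apply)
    moreover have "d i (d (i + 1) z) c = 0" if "\<And>b K. c \<noteq> Tay b K" for c
      using that 3 by (intro d_other) (auto simp: taylor_basis_def)
    ultimately have "d i (d (i + 1) z) c = 0" for c
      by (cases c) auto
    then show ?thesis
      by (rule ext)
  qed
qed

lemma exists_clifford_action:
  assumes "forms_independent_on (A \<alpha>) r f"
  shows "\<exists>u. clifford_action r \<iota> (\<lambda>j. wedge {..<e} (u j)) \<and> (\<forall>j l. u j l \<noteq> 0 \<longrightarrow> l \<in> A \<alpha>)"
proof -
  obtain u where props: "(\<forall>j l. u j l \<noteq> 0 \<longrightarrow> l \<in> A \<alpha>) \<and>
      (\<forall>i<r. \<forall>j<r. (\<Sum>l\<in>A \<alpha>. f i l * u j l) = (if i = j then 1 else 0))"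
    using forms_independent_on_dual_vectors[OF _ assms] by auto
  then have u0: "\<And>j l. u j l \<noteq> 0 \<Longrightarrow> l \<in> A \<alpha>"
    and u: "\<And>i j. i < r \<Longrightarrow> j < r \<Longrightarrow> (\<Sum>l\<in>A \<alpha>. f i l * u j l) = (if i = j then 1 else 0)"
    by blast+
  have "(\<Sum>l<e. f i l * u j l) = (if i = j then 1 else 0)" if "i < r" "j < r" for i j
  proof -
    have "(\<Sum>l<e. f i l * u j l) = (\<Sum>l\<in>A \<alpha>. f i l * u j l)"
      using u0 by (intro sum.mono_neutral_right) (auto simp: basis_index_set_def)
    then show ?thesis
      using u[OF that] by simp
  qed
  then have "clifford_action r \<iota> (\<lambda>j. wedge {..<e} (u j))"
    by (intro clifford_action_contract_wedge) auto
  then show ?thesis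
    using u0 by blast
qed

text \<open>
  A cycle is an element of \<open>U\<^sub>A\<close> on which all \<open>f\<^sub>j\<close> vanish.  Multiplying it by all the dual vectors gives
  an element of \<open>\<Lambda>\<^bsup>r+1\<^esup> U\<^sub>A\<close> whose iterated contraction is the given cycle.
\<close>

lemma cycle_is_boundary_at_1:
  assumes ind: "forms_independent_on (A \<alpha>) r f"
    and z: "z \<in> strand deg \<alpha> (T 1)" and dz: "d 1 z = (\<lambda>_. 0)"
  shows "\<exists>w\<in>strand deg \<alpha> (T 2). d 2 w = z"
proof -
  obtain u where cliff: "clifford_action r \<iota> (\<lambda>j. wedge {..<e} (u j))"
    and u: "\<And>j l. u j l \<noteq> 0 \<Longrightarrow> l \<in> A \<alpha>"
    using exists_clifford_action[OF ind] by blast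
  interpret clifford_action r \<iota> "\<lambda>j. wedge {..<e} (u j)"
    by (rule cliff)
  have z_Eps: "z (Eps l) = 0" if "l \<notin> A \<alpha>" for l
    using z[unfolded strand_1_iff] that by (auto simp: supported_on_def)
  \<comment> \<open>The cycle as an element of the first exterior power.\<close>
  define F where "F K = (if card K = 1 then z (Eps (the_elem K)) else 0)" for K
  have F: "F \<in> ext_power (A \<alpha>) 1"
    unfolding ext_power_def
  proof (intro CollectI allI impI)
    fix K assume nz: "F K \<noteq> 0"
    then have "card K = 1"
      by (auto simp: F_def split: if_splits)
    then obtain l where "K = {l}"
      by (auto simp: card_1_singleton_iff)
    then show "K \<subseteq> A \<alpha> \<and> card K = 1"
      using nz z_Eps[of l] by (auto simp: F_def)
  qed
  have F_single: "F {l} = z (Eps l)" for l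
    by (simp add: F_def)
  have "\<iota> j F = 0" if j: "j < r" for j
  proof
    fix K
    have "\<iota> j F \<in> ext_power (A \<alpha>) 0"
      using contract_in_ext_power[of "A \<alpha>" F 0] F by simp
    have "K = {}" if "\<iota> j F K \<noteq> 0"
    proof -
      have K: "K \<subseteq> A \<alpha>" "card K = 0"
        using \<open>\<iota> j F \<in> ext_power (A \<alpha>) 0\<close> that unfolding ext_power_def by blast+
      then show ?thesis
        using finite_subset[OF K(1) finite_basis_index_set] by simp
    qed
    moreover have "\<iota> j F {} = 0"
      using dz[unfolded d_1_eq_0_iff mult_vec_eq_0_iff[OF C \<upsilon>]] j
      by (simp add: contract_at_empty F_single)
    ultimately show "\<iota> j F K = 0 K"
      by auto
  qed
  then have top: "iterated_contraction \<iota> r (iterated_product (\<lambda>j. wedge {..<e} (u j)) r F) = F"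
    by (intro iterated_contraction_iterated_product) auto
  define G where "G = iterated_product (\<lambda>j. wedge {..<e} (u j)) r F"
  have G: "G \<in> ext_power (A \<alpha>) (1 + r)"
    unfolding G_def by (rule iterated_product_in_ext_power[OF _ F u]) auto
  \<comment> \<open>The sign cancels the one by which the differential differs from the iterated contraction.\<close>
  define w where "w = unslice (\<lambda>b K. if b = (\<lambda>_. 0) then contraction_sign * G K else 0)"
  have w: "w \<in> strand deg \<alpha> (T 2)"
    unfolding w_def
  proof (rule unslice_in_strand)
    show "(\<lambda>K. if b = (\<lambda>_. 0) then contraction_sign * G K else 0) \<in> ext_power (A \<alpha>) (r + 2 - 1)" for b
      using G by (auto simp: ext_power_def)
  qed (auto simp: exponents_0)
  have "d 2 w (Eps l) = z (Eps l)" for l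
  proof -
    let ?S = "\<lambda>H. \<Sum>L | L \<subseteq> {..<e} \<and> card L = r. form_minor f r L * annihilate l H L"
    have "slice w (\<lambda>_. 0) = (\<lambda>K. contraction_sign * G K)"
      by (simp add: w_def)
    then have "d 2 w (Eps l) = ?S (\<lambda>K. contraction_sign * G K)"
      by (simp only: d_Eps[OF strand_supported[OF w]])
    also have "\<dots> = contraction_sign * ?S G"
      unfolding sum_distrib_left by (intro sum.cong refl) (simp add: annihilate_def mult_ac)
    also have "\<dots> = iterated_contraction \<iota> r G {l}"
      by (simp only: iterated_contraction_at_singleton[OF finite_lessThan])
    also have "\<dots> = z (Eps l)"
      using top by (simp add: G_def F_single)
    finally show ?thesis .
  qed
  moreover have "d 2 w c = z c" if "c \<notin> range Eps" for c
  proof -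
    have "c \<notin> T (2 - 1)"
      using that by (auto simp: taylor_basis_def)
    then have "d 2 w c = 0"
      by (intro d_other) auto
    moreover have "z c = 0"
      using z[unfolded strand_1_iff] that by (auto simp: supported_on_def)
    ultimately show ?thesis
      by simp
  qed
  ultimately have "d 2 w c = z c" for c
    by (cases "c \<in> range Eps") auto
  then have "d 2 w = z"
    by (rule ext)
  then show ?thesis
    using w by blast
qed

text \<open>
  For \<open>p = 0\<close> a cycle is only known to have iterated contraction zero at the singletons; as the
  iterated contraction has degree \<open>1\<close>, it vanishes altogether.
\<close>

lemma cycle_is_boundary:
  assumes ind: "forms_independent_on (A \<alpha>) r f"
    and z: "z \<in> strand deg \<alpha> (T (p + 2))" and dz: "d (p + 2) z = (\<lambda>_. 0)"
  shows "\<exists>w\<in>strand deg \<alpha> (T (p + 3)). d (p + 3) w = z"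
proof -
  obtain u where cliff: "clifford_action r \<iota> (\<lambda>j. wedge {..<e} (u j))"
    and u: "\<And>j l. u j l \<noteq> 0 \<Longrightarrow> l \<in> A \<alpha>"
    using exists_clifford_action[OF ind] by blast
  interpret clifford_action r \<iota> "\<lambda>j. wedge {..<e} (u j)"
    by (rule cliff)
  have X: "slice z b \<in> ext_power (A \<alpha>) (r + p + 1)" for b
    using slice_in_ext_power[OF _ z] by (simp add: add.assoc)
  have cycle: "(\<Sum>j<r. \<iota> j (slice z (b(j := Suc (b j))))) = 0" if "p = Suc q" for q b
  proof -
    have "slice (d (p + 2) z) b = 0"
      unfolding dz by (rule ext) (simp add: slice_def)
    then show ?thesis
      using that slice_d[OF _ strand_supported[OF z]] by simp
  qed
  have cycle_0: "iterated_contraction \<iota> r (slice z (\<lambda>_. 0)) = 0" if p: "p = 0"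
  proof
    fix K
    let ?F = "iterated_contraction \<iota> r (slice z (\<lambda>_. 0))"
    have "slice z (\<lambda>_. 0) \<in> ext_power (A \<alpha>) (1 + r)"
      using X[of "\<lambda>_. 0"] p by simp
    then have "?F \<in> ext_power (A \<alpha>) 1"
      by (intro iterated_contraction_in_ext_power) auto
    then have card1: "?F K \<noteq> 0 \<Longrightarrow> card K = 1"
      unfolding ext_power_def by blast
    have "?F {l} = 0" for l
    proof -
      have "contraction_sign * ?F {l} = 0"
        using d_Eps_contraction[OF strand_supported[OF z, unfolded p add_0], of l]
          fun_cong[OF dz[unfolded p add_0], of "Eps l"] by (simp only:)
      then show ?thesis
        by (simp add: reversal_sign_def)
    qed
    then show "?F K = 0 K"
      using card1 by (auto simp: card_1_singleton_iff)
  qed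
  obtain Y where Y: "\<And>b. b \<in> exponents r (Suc p) \<Longrightarrow> Y b \<in> ext_power (A \<alpha>) (r + p + 2)"
    and dY: "\<And>b. b \<in> exponents r p \<Longrightarrow> (\<Sum>j<r. \<iota> j (Y (b(j := Suc (b j))))) = slice z b"
  proof (rule koszul_exact[where X = "slice z" and p = p and S = "ext_power (A \<alpha>) (r + p + 1)"
        and S' = "ext_power (A \<alpha>) (r + p + 2)"])
    show "wedge {..<e} (u i) x \<in> ext_power (A \<alpha>) (r + p + 2)"
      if "x \<in> ext_power (A \<alpha>) (r + p + 1)" for i x
      using wedge_in_ext_power[OF _ that, of "u i"] u by simp
    show "wedge {..<e} (u i) (\<iota> i x) \<in> ext_power (A \<alpha>) (r + p + 2)"
      if "x \<in> ext_power (A \<alpha>) (r + p + 2)" for i x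
    proof -
      have "\<iota> i x \<in> ext_power (A \<alpha>) (r + p + 1)"
        using contract_in_ext_power[of "A \<alpha>" x "r + p + 1"] that by simp
      then show ?thesis
        using wedge_in_ext_power[of "A \<alpha>" "\<iota> i x" "r + p + 1" "u i"] u by simp
    qed
  qed (use cycle cycle_0 X in blast)+
  define w where "w = unslice (\<lambda>b. if b \<in> exponents r (Suc p) then Y b else 0)"
  have w: "w \<in> strand deg \<alpha> (T (p + 3))"
    unfolding w_def
  proof (rule unslice_in_strand)
    fix b assume "b \<in> exponents r (p + 3 - 2)"
    then show "(if b \<in> exponents r (Suc p) then Y b else 0) \<in> ext_power (A \<alpha>) (r + (p + 3) - 1)"
      using Y[of b] by (simp add: numeral_3_eq_3 numeral_2_eq_2)
  qed (simp_all add: numeral_3_eq_3 numeral_2_eq_2)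
  have "slice (d (p + 3) w) b = slice z b" for b
  proof -
    have eq: "slice (d (p + 3) w) b
        = (\<Sum>j<r. \<iota> j (if b(j := Suc (b j)) \<in> exponents r (Suc p) then Y (b(j := Suc (b j))) else 0))"
      unfolding slice_d[OF le_add2 strand_supported[OF w]] by (simp add: w_def)
    show ?thesis
    proof (cases "b \<in> exponents r p")
      case True
      then show ?thesis
        unfolding eq dY[OF True, symmetric] by (intro sum.cong refl) (simp add: exponents_Suc_iff)
    next
      case False
      then have "slice z b = 0"
        using slice_eq_0[OF _ z] by simp
      moreover have "slice (d (p + 3) w) b = 0"
        unfolding eq using False by (intro sum.neutral) (simp add: exponents_Suc_iff contr_0)
      ultimately show ?thesis
        by simp
    qed
  qed
  then have "d (p + 3) w (Tay b K) = z (Tay b K)" for b K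
    by (metis slice_def)
  moreover have "d (p + 3) w c = z c" if c: "\<And>b K. c \<noteq> Tay b K" for c
  proof -
    have "c \<notin> T (p + 2)"
      using c by (auto simp: taylor_basis_def)
    then show ?thesis
      using d_other[of "p + 3" c w] strand_supported[OF z] by (auto simp: supported_on_def)
  qed
  ultimately have "d (p + 3) w c = z c" for c
    by (cases c) auto
  then have "d (p + 3) w = z"
    by (rule ext)
  then show ?thesis
    using w by blast
qed

text \<open>
  The exterior powers from degree \<open>r + 1\<close> on vanish.
\<close>

lemma strand_trivial:
  assumes "card (A \<alpha>) \<le> r" "2 \<le> i"
  shows "strand deg \<alpha> (T i) = {(\<lambda>_. 0) :: gen \<Rightarrow> 'k}"
proof -
  have "z = (\<lambda>_. 0)" if z: "z \<in> strand deg \<alpha> (T i)" for z :: "gen \<Rightarrow> 'k"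
  proof (rule ext, rule ccontr)
    fix x assume "z x \<noteq> 0"
    with assms(2) z obtain b I where "x = Tay b I" "I \<subseteq> A \<alpha>" "card I = r + i - 1"
      by (rule strand_TayD)
    then have "r + i - 1 \<le> card (A \<alpha>)"
      using card_mono[of "A \<alpha>" I] by simp
    then show False
      using assms by simp
  qed
  moreover have "(\<lambda>_. 0) \<in> strand deg \<alpha> (T i)"
    by (simp add: strand_def supported_on_def)
  ultimately show ?thesis
    by blast
qed

abbreviation "exact_at \<alpha> i \<equiv>
  {z \<in> strand deg \<alpha> (T i). d i z = (\<lambda>_. 0)} = d (i + 1) ` strand deg \<alpha> (T (i + 1))"

lemma exact_if_independent:
  assumes ind: "forms_independent_on (A \<alpha>) r f" and i: "1 \<le> i"
  shows "exact_at \<alpha> i"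
proof (intro equalityI subsetI)
  fix z assume "z \<in> {z \<in> strand deg \<alpha> (T i). d i z = (\<lambda>_. 0)}"
  then have z: "z \<in> strand deg \<alpha> (T i)" "d i z = (\<lambda>_. 0)"
    by auto
  show "z \<in> d (i + 1) ` strand deg \<alpha> (T (i + 1))"
  proof (cases "i = 1")
    case True
    show ?thesis
      using cycle_is_boundary_at_1[OF ind z[unfolded True]] unfolding True one_add_one by blast
  next
    case False
    then have p: "i = (i - 2) + 2" "i + 1 = (i - 2) + 3"
      using i by auto
    have "\<exists>w\<in>strand deg \<alpha> (T ((i - 2) + 3)). d ((i - 2) + 3) w = z"
      using z p(1) by (intro cycle_is_boundary[OF ind]) simp_all
    then show ?thesis
      unfolding p(2) by blast
  qed
next
  fix z assume "z \<in> d (i + 1) ` strand deg \<alpha> (T (i + 1))"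
  then show "z \<in> {z \<in> strand deg \<alpha> (T i). d i z = (\<lambda>_. 0)}"
    using d_in_strand[of "i + 1"] d_d_eq_0[OF i] by fastforce
qed

lemma d_0: "d i (\<lambda>_. 0) = (\<lambda>_. 0)"
  by (simp add: lin_ext_def)

text \<open>
  If \<open>s\<^sub>2\<close> vanishes on the strand, exactness at \<open>E\<close> means that \<open>s\<close> is injective on \<open>U\<^sub>A\<close>.
\<close>

lemma exact_at_1_iff_full_column_rank:
  assumes zero: "\<And>w. w \<in> strand deg \<alpha> (T 2) \<Longrightarrow> d 2 w = (\<lambda>_. 0)"
  shows "exact_at \<alpha> 1 \<longleftrightarrow> mat_rank (cols_upto C dE \<alpha>) = card (A \<alpha>)"
  unfolding mat_rank_cols_upto(4)[OF C]
proof
  have im: "d (1 + 1) ` strand deg \<alpha> (T (1 + 1)) = {\<lambda>_. 0}"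
    unfolding one_add_one
  proof (intro equalityI subsetI)
    fix y assume "y \<in> d 2 ` strand deg \<alpha> (T 2)"
    then obtain w where "y = d 2 w" "w \<in> strand deg \<alpha> (T 2)"
      by (rule imageE)
    then show "y \<in> {\<lambda>_. 0}"
      using zero[of w] by (simp only: singleton_iff)
  next
    fix y :: "gen \<Rightarrow> 'k" assume "y \<in> {\<lambda>_. 0}"
    then have "y = d 2 (\<lambda>_. 0)"
      by (simp only: d_0 singleton_iff)
    moreover have "(\<lambda>_. 0) \<in> strand deg \<alpha> (T 2)"
      by (simp add: strand_def supported_on_def)
    ultimately show "y \<in> d 2 ` strand deg \<alpha> (T 2)"
      by (rule image_eqI)
  qed
  show "\<forall>u. (\<forall>l. u l \<noteq> 0 \<longrightarrow> l \<in> A \<alpha>) \<longrightarrow> C *\<^sub>v vec e u = 0\<^sub>v g \<longrightarrow> (\<forall>l. u l = 0)"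
    if ex: "exact_at \<alpha> 1"
  proof (intro allI impI)
    fix u l assume u: "\<forall>l. u l \<noteq> 0 \<longrightarrow> l \<in> A \<alpha>" "C *\<^sub>v vec e u = 0\<^sub>v g"
    define z where "z x = (case x of Eps l \<Rightarrow> u l | _ \<Rightarrow> 0)" for x
    have "z \<in> strand deg \<alpha> (T 1)"
      unfolding strand_1_iff using u(1) by (auto simp: supported_on_def z_def split: gen.splits)
    moreover have "d 1 z = (\<lambda>_. 0)"
      unfolding d_1_eq_0_iff using u(2) by (simp add: z_def)
    ultimately have "z \<in> {z \<in> strand deg \<alpha> (T 1). d 1 z = (\<lambda>_. 0)}"
      by (intro CollectI conjI)
    then have "z = (\<lambda>_. 0)"
      unfolding ex im by (rule singletonD)
    then show "u l = 0"
      using z_def[of "Eps l"] by simp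
  qed
  show "exact_at \<alpha> 1"
    if inj: "\<forall>u. (\<forall>l. u l \<noteq> 0 \<longrightarrow> l \<in> A \<alpha>) \<longrightarrow> C *\<^sub>v vec e u = 0\<^sub>v g \<longrightarrow> (\<forall>l. u l = 0)"
    unfolding im
  proof (intro equalityI subsetI)
    fix z assume "z \<in> {z \<in> strand deg \<alpha> (T 1). d 1 z = (\<lambda>_. 0)}"
    then have z: "supported_on (Eps ` A \<alpha>) z" "C *\<^sub>v vec e (\<lambda>l. z (Eps l)) = 0\<^sub>v g"
      unfolding strand_1_iff d_1_eq_0_iff by blast+
    have "\<forall>l. z (Eps l) \<noteq> 0 \<longrightarrow> l \<in> A \<alpha>"
      using z(1) by (auto simp: supported_on_def)
    then have Eps: "z (Eps l) = 0" for l
      using spec[OF inj, of "\<lambda>l. z (Eps l)"] z(2) by blast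
    have "z x = 0" for x
    proof (rule ccontr)
      assume "z x \<noteq> 0"
      then have "x \<in> Eps ` A \<alpha>"
        using z(1) unfolding supported_on_def by blast
      then show False
        using \<open>z x \<noteq> 0\<close> Eps by auto
    qed
    then have "z = (\<lambda>_. 0)"
      by (rule ext)
    then show "z \<in> {\<lambda>_. 0}"
      by (simp only: singleton_iff)
  qed (auto simp: d_0 strand_def supported_on_def)
qed

text \<open>
  A linear relation between the forms is a linear relation between the rows of every minor.
\<close>

lemma d_2_eq_0_if_dependent:
  assumes dep: "\<not> forms_independent_on (A \<alpha>) r f" and w: "w \<in> strand deg \<alpha> (T 2)"
  shows "d 2 w = (\<lambda>_. 0)"
proof -
  obtain c j0 where c: "\<And>l. l \<in> A \<alpha> \<Longrightarrow> (\<Sum>j<r. c j * f j l) = 0" and j0: "j0 < r" "c j0 \<noteq> 0"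
    using dep unfolding forms_independent_on_def by blast
  have "d 2 w (Eps l) = 0" for l
    unfolding d_Eps[OF strand_supported[OF w]]
  proof (intro sum.neutral ballI)
    fix L assume "L \<in> {L. L \<subseteq> {..<e} \<and> card L = r}"
    then have card: "card L = r"
      by simp
    show "form_minor f r L * annihilate l (slice w (\<lambda>_. 0)) L = 0"
    proof (cases "L \<subseteq> A \<alpha>")
      case True
      then have "form_minor f r L = 0"
        using c j0 card by (intro form_minor_eq_0[where c = c and ?j0.0 = j0]) auto
      then show ?thesis
        by simp
    next
      case False
      then have "slice w (\<lambda>_. 0) (insert l L) = 0"
        using slice_in_ext_power[OF order_refl w, of "\<lambda>_. 0"] unfolding ext_power_def by blast
      then show ?thesis
        by (simp add: annihilate_def)
    qed
  qed
  moreover have "d 2 w c' = 0" if "c' \<notin> range Eps" for c'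
    using that by (intro d_other) (auto simp: taylor_basis_def)
  ultimately have "d 2 w c' = 0" for c'
    by (cases "c' \<in> range Eps") auto
  then show ?thesis
    by (rule ext)
qed

theorem strand_exact_iff_maximal_rank:
  "(\<forall>i\<ge>1. exact_at \<alpha> i) \<longleftrightarrow> maximal_rank C dE \<alpha>"
proof -
  let ?rank = "mat_rank (cols_upto C dE \<alpha>)"
  have max: "maximal_rank C dE \<alpha> \<longleftrightarrow> ?rank = min r (card (A \<alpha>))"
    using cols_upto_carrier[OF C, of dE \<alpha>] by (simp add: maximal_rank_def r)
  have rank_r: "?rank = r \<longleftrightarrow> forms_independent_on (A \<alpha>) r f"
    using mat_rank_cols_upto(3)[OF C] mat_image_cols_upto_eq_iff[OF C \<upsilon>] by (simp add: r)
  show ?thesis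
  proof (cases "card (A \<alpha>) \<le> r")
    case True
    have zero: "d 2 w = (\<lambda>_. 0)" if "w \<in> strand deg \<alpha> (T 2)" for w
    proof -
      have "w = (\<lambda>_. 0)"
        using that strand_trivial[OF True order_refl] by blast
      then show ?thesis
        by (simp only: d_0)
    qed
    have high: "exact_at \<alpha> i" if "2 \<le> i" for i
      unfolding strand_trivial[OF True that] strand_trivial[OF True trans_le_add1[OF that]]
      by (auto simp: d_0)
    have "(\<forall>i\<ge>1. exact_at \<alpha> i) \<longleftrightarrow> exact_at \<alpha> 1"
    proof
      assume ex: "exact_at \<alpha> 1"
      show "\<forall>i\<ge>1. exact_at \<alpha> i"
      proof (intro allI impI)
        fix i :: nat assume "1 \<le> i"
        then consider "i = 1" | "2 \<le> i"
          by linarith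
        then show "exact_at \<alpha> i"
          using ex high by cases auto
      qed
    qed blast
    then show ?thesis
      using exact_at_1_iff_full_column_rank[OF zero] True by (simp add: max min_def)
  next
    case False
    have "forms_independent_on (A \<alpha>) r f" if ex: "exact_at \<alpha> 1"
    proof (rule ccontr)
      assume "\<not> forms_independent_on (A \<alpha>) r f"
      then have zero: "d 2 w = (\<lambda>_. 0)" if "w \<in> strand deg \<alpha> (T 2)" for w
        using that by (rule d_2_eq_0_if_dependent)
      have "?rank = card (A \<alpha>)"
        by (rule iffD1[OF exact_at_1_iff_full_column_rank[OF zero] ex])
      then show False
        using mat_rank_cols_upto(1)[OF C, of dE \<alpha>] False by (simp add: r)
    qed
    then have "(\<forall>i\<ge>1. exact_at \<alpha> i) \<longleftrightarrow> forms_independent_on (A \<alpha>) r f"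
      using exact_if_independent by blast
    moreover have "min r (card (A \<alpha>)) = r"
      using False by simp
    ultimately show ?thesis
      unfolding max by (simp only: rank_r)
  qed
qed

end

section \<open>The morphism as the homogenization of its coefficient matrix\<close>

lemma basis_elem_in_free_module: "b \<in> B \<Longrightarrow> basis_elem b \<in> free_module n B"
  by (auto simp: free_module_def polys_def mdegs_def basis_elem_def)

lemma homogeneous_basis_elem: "homogeneous deg (deg b) (basis_elem b)"
  by (auto simp: homogeneous_def basis_elem_def)

text \<open>
  The image of a basis element is homogeneous, so that each of its coordinates involves one monomial
  only.
\<close>

lemma multigraded_hom_entry:
  fixes \<phi> :: "(nat \<Rightarrow> 'k::field mpoly) \<Rightarrow> (nat \<Rightarrow> 'k mpoly)"
  assumes \<phi>: "multigraded_hom n {..<e} dE {..<g} dG \<phi>" and j: "j < e" "dE j \<in> mdegs n"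
  shows "\<phi> (basis_elem j) k
      = Poly_Mapping.single (dE j - dG k) (Poly_Mapping.lookup (\<phi> (basis_elem j) k) (dE j - dG k))"
    and "Poly_Mapping.lookup (\<phi> (basis_elem j) k) (dE j - dG k) \<noteq> 0 \<Longrightarrow> dG k \<preceq> dE j"
proof -
  have "homogeneous dG (dE j) (\<phi> (basis_elem j))"
    using \<phi> j basis_elem_in_free_module[of j "{..<e}" n] homogeneous_basis_elem[of dE j]
    unfolding multigraded_hom_def by blast
  then have deg: "m + dG k = dE j" if "Poly_Mapping.lookup (\<phi> (basis_elem j) k) m \<noteq> 0" for m
    using that unfolding homogeneous_def by (metis in_keys_iff)
  have "Poly_Mapping.lookup (\<phi> (basis_elem j) k) m = 0" if "m \<noteq> dE j - dG k" for m
    using deg[of m] that by (metis add_diff_cancel_right')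
  then show "\<phi> (basis_elem j) k
      = Poly_Mapping.single (dE j - dG k) (Poly_Mapping.lookup (\<phi> (basis_elem j) k) (dE j - dG k))"
    by (intro poly_mapping_eqI) (auto simp: lookup_single when_def)
  show "dG k \<preceq> dE j" if "Poly_Mapping.lookup (\<phi> (basis_elem j) k) (dE j - dG k) \<noteq> 0"
    using deg[OF that] mdeg_le_iff_add by (metis add.commute)
qed

lemma multigraded_hom_expand:
  fixes \<phi> :: "(nat \<Rightarrow> 'k::field mpoly) \<Rightarrow> (nat \<Rightarrow> 'k mpoly)"
  assumes \<phi>: "multigraded_hom n {..<e} dE {..<g} dG \<phi>" and x: "x \<in> free_module n {..<e}"
  shows "\<phi> x k = (\<Sum>j<e. x j * \<phi> (basis_elem j) k)"
proof -
  let ?M = "free_module n {..<e} :: (nat \<Rightarrow> 'k mpoly) set"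
  have add: "\<phi> (\<lambda>b. y b + z b) = (\<lambda>c. \<phi> y c + \<phi> z c)" if "y \<in> ?M" "z \<in> ?M" for y z
    using \<phi> that unfolding multigraded_hom_def by blast
  have scale: "\<phi> (\<lambda>b. p * y b) = (\<lambda>c. p * \<phi> y c)" if "p \<in> polys n" "y \<in> ?M" for p y
    using \<phi> that unfolding multigraded_hom_def by blast
  have polys: "x b \<in> polys n" for b
    using x by (simp add: free_module_def)
  have zero: "0 \<in> polys n"
    by (simp add: polys_def)
  have trunc: "(\<lambda>b. if b < m then x b else 0) \<in> ?M" if "m \<le> e" for m
    using that polys zero by (auto simp: free_module_def)
  have term_in: "(\<lambda>b. x m * basis_elem m b) \<in> ?M" if "m < e" for m
    using that polys zero by (auto simp: free_module_def basis_elem_def)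
  \<comment> \<open>The coordinates are added one at a time, as additivity is known for two summands only.\<close>
  have "\<phi> (\<lambda>b. if b < m then x b else 0) k = (\<Sum>j<m. x j * \<phi> (basis_elem j) k)" if "m \<le> e" for m
    using that
  proof (induction m)
    case 0
    show ?case
      using scale[OF zero trunc[of 0]] by (simp add: fun_eq_iff)
  next
    case (Suc m)
    have m: "m \<le> e" "m < e"
      using Suc.prems by auto
    have "(\<lambda>b. if b < Suc m then x b else 0) = (\<lambda>b. (if b < m then x b else 0) + x m * basis_elem m b)"
      by (auto simp: fun_eq_iff basis_elem_def less_Suc_eq)
    then have "\<phi> (\<lambda>b. if b < Suc m then x b else 0) k
        = \<phi> (\<lambda>b. if b < m then x b else 0) k + \<phi> (\<lambda>b. x m * basis_elem m b) k"
      using add[OF trunc[OF m(1)] term_in[OF m(2)]] by simp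
    then show ?case
      using Suc.IH[OF m(1)] scale[OF polys basis_elem_in_free_module] m(2) by simp
  qed
  from this[of e] have "\<phi> (\<lambda>b. if b < e then x b else 0) k = (\<Sum>j<e. x j * \<phi> (basis_elem j) k)"
    by simp
  moreover have "(\<lambda>b. if b < e then x b else 0) = x"
    using x by (auto simp: free_module_def fun_eq_iff)
  ultimately show ?thesis
    by simp
qed

text \<open>
  For \<open>i = 1\<close> the differential is given as a function, and it is determined by its values on the basis.
\<close>

lemma taylor_diff_eq_homogenization:
  fixes n e g :: nat and dE dG :: "nat \<Rightarrow> mdeg"
    and \<phi> :: "(nat \<Rightarrow> 'k::field mpoly) \<Rightarrow> (nat \<Rightarrow> 'k mpoly)"
  defines "C \<equiv> coeff_matrix e g dE dG \<phi>"
  assumes dE: "\<forall>j<e. dE j \<in> mdegs n"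
    and \<phi>: "multigraded_hom n {..<e} dE {..<g} dG \<phi>" and i: "1 \<le> i"
    and x: "x \<in> taylor_module n e g (mat_rank C) i"
  shows "taylor_diff e g dE dG \<phi> \<upsilon> i x
    = homogenization (gen_deg dE dG) (taylor_basis e g (mat_rank C) i) (taylor_coeff C (mat_rank C) \<upsilon> i) x"
proof (cases "i = 1")
  case False
  then show ?thesis
    by (simp add: taylor_diff_def Let_def homogenization_def taylor_coeff_def C_def)
next
  case True
  have xE: "(\<lambda>j. x (Eps j)) \<in> free_module n {..<e}"
    using x True by (auto simp: taylor_module_def free_module_def taylor_basis_def)
  then have "\<phi> (\<lambda>j. x (Eps j)) \<in> free_module n {..<g}"
    using \<phi> by (simp add: multigraded_hom_def)
  then have outside: "\<phi> (\<lambda>j. x (Eps j)) k = 0" if "\<not> k < g" for k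
    using that by (simp add: free_module_def)
  have dim: "dim_row C = g"
    by (simp add: C_def coeff_matrix_def)
  have T1: "taylor_basis e g (mat_rank C) i = Eps ` {..<e}"
    using True by (simp add: taylor_basis_def)
  show ?thesis
  proof
    fix c
    show "taylor_diff e g dE dG \<phi> \<upsilon> i x c = homogenization (gen_deg dE dG)
        (taylor_basis e g (mat_rank C) i) (taylor_coeff C (mat_rank C) \<upsilon> i) x c"
    proof (cases c)
      case (Gam k)
      have entry: "\<phi> (basis_elem j) k = Poly_Mapping.single (dE j - dG k) (C $$ (k, j))"
        if "j < e" "k < g" for j
        using multigraded_hom_entry(1)[OF \<phi> that(1)] dE that
        by (simp add: C_def coeff_matrix_def)
      have "\<phi> (\<lambda>j. x (Eps j)) k
          = (\<Sum>j<e. Poly_Mapping.single (dE j - dG k) (if k < g then C $$ (k, j) else 0) * x (Eps j))"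
      proof (cases "k < g")
        case True
        then show ?thesis
          unfolding multigraded_hom_expand[OF \<phi> xE] by (intro sum.cong) (simp_all add: entry mult.commute)
      qed (simp add: outside)
      then show ?thesis
        unfolding T1 using True Gam
        by (simp add: taylor_diff_def Let_def homogenization_def taylor_coeff_def dim
            sum.reindex inj_on_def)
    qed (simp_all add: T1 True taylor_diff_def Let_def homogenization_def taylor_coeff_def sum.reindex inj_on_def)
  qed
qed

theorem theorem4p5:
  fixes n e g :: nat
    and dE dG :: "nat \<Rightarrow> mdeg"
    and \<phi> :: "(nat \<Rightarrow> 'k::field mpoly) \<Rightarrow> (nat \<Rightarrow> 'k mpoly)"
    and \<upsilon> :: "nat \<Rightarrow> 'k vec \<Rightarrow> 'k"
  assumes "\<forall>j<e. dE j \<in> mdegs n"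
    and "\<forall>i<g. dG i \<in> mdegs n"
    and "multigraded_hom n {..<e} dE {..<g} dG \<phi>"
    and "dual_space_basis (mat_image (coeff_matrix e g dE dG \<phi>))
           (mat_rank (coeff_matrix e g dE dG \<phi>)) \<upsilon>"
  shows "taylor_exact n e g dE dG \<phi> \<upsilon> \<longleftrightarrow>
    (\<forall>\<alpha> \<in> mdegs n. maximal_rank (coeff_matrix e g dE dG \<phi>) dE \<alpha>)"
proof -
  define C where "C = coeff_matrix e g dE dG \<phi>"
  define r where "r = mat_rank C"
  have entries: "dG k \<preceq> dE l" if "k < g" "l < e" "C $$ (k, l) \<noteq> 0" for k l
    using multigraded_hom_entry(2)[OF assms(3) that(2)] that assms(1)
    by (simp add: C_def coeff_matrix_def)
  interpret taylor_complex n e g r dE dG C \<upsilon>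
  proof
    show "C \<in> carrier_mat g e"
      by (simp add: C_def coeff_matrix_def)
    show "dual_space_basis (mat_image C) r \<upsilon>"
      using assms(4) by (simp add: C_def r_def)
  qed (use assms(1,2) entries in \<open>auto simp: r_def\<close>)
  let ?M = "\<lambda>i. free_module n (T i) :: (gen \<Rightarrow> 'k mpoly) set"
  let ?D = "\<lambda>i. homogenization deg (T i) (taylor_coeff C r \<upsilon> i)"
  have diff: "taylor_diff e g dE dG \<phi> \<upsilon> i x = ?D i x" if "1 \<le> i" "x \<in> ?M i" for i x
    using taylor_diff_eq_homogenization[OF assms(1,3) that(1), of x \<upsilon>] that(2)
    by (simp add: C_def r_def taylor_module_def)
  have "taylor_exact n e g dE dG \<phi> \<upsilon>
      \<longleftrightarrow> (\<forall>i\<ge>1. {x \<in> ?M i. ?D i x = (\<lambda>_. 0)} = ?D (i + 1) ` ?M (i + 1))"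
  proof -
    have "{x \<in> ?M i. taylor_diff e g dE dG \<phi> \<upsilon> i x = (\<lambda>_. 0)} = {x \<in> ?M i. ?D i x = (\<lambda>_. 0)}"
      "taylor_diff e g dE dG \<phi> \<upsilon> (i + 1) ` ?M (i + 1) = ?D (i + 1) ` ?M (i + 1)" if "1 \<le> i" for i
      using diff that by (auto cong: image_cong)
    then show ?thesis
      by (simp add: taylor_exact_def Let_def taylor_module_def C_def[symmetric] r_def[symmetric])
  qed
  also have "\<dots> \<longleftrightarrow> (\<forall>i\<ge>1. \<forall>\<alpha>\<in>mdegs n. exact_at \<alpha> i)"
  proof (intro all_cong1 imp_cong refl exact_iff_strands_exact finite_taylor_basis deg_in_mdegs)
    fix i :: nat and x c assume i: "1 \<le> i"
    show "deg c \<preceq> deg x" if "x \<in> T i" "taylor_coeff C r \<upsilon> i x c \<noteq> 0"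
      using taylor_coeff_nonzero(1) i that by blast
    show "deg c \<preceq> deg x" if "x \<in> T (i + 1)" "taylor_coeff C r \<upsilon> (i + 1) x c \<noteq> 0"
      using taylor_coeff_nonzero(1)[of "i + 1"] that by simp
  qed
  also have "\<dots> \<longleftrightarrow> (\<forall>\<alpha>\<in>mdegs n. maximal_rank C dE \<alpha>)"
    using strand_exact_iff_maximal_rank by blast
  finally show ?thesis
    by (simp add: C_def)
qed

end
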